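(* Let $M_N=\frac1{\sqrt N}W_N+A_N$ be the deformed Wigner model described in the context and let $g_N(z)=\mathbb{E}\big[\frac1N\mathrm{Tr}\,(zI_N-M_N)^{-1}\big]$. For $z\in\mathbb{C}^+$, $g_N(z)$ satisfies $$g_N(z)=g_{\mu_{A_N}}(z-\sigma^2g_N(z))+\frac1NL_N(z)+O\Big(\frac1{N^2}\Big),$$ where $$L_N(z)=\frac{\kappa_4}{2N^2}\sum_{i,l=1}^N\big[(G_{A_N}(w))^2\big]_{ii}\,\big[G_{A_N}(w)\big]_{ii}\,\big(\big[G_{A_N}(w)\big]_{ll}\big)^2,\qquad w=z-\sigma^2g_N(z).$$
   Context: Model. $\sigma>0$. $W_N$ is an $N\times N$ random Hermitian matrix such that the random variables $(W_N)_{ii}$ ($1\le i\le N$), $\sqrt2\,\Re((W_N)_{ij})_{i<j}$, $\sqrt2\,\Im((W_N)_{ij})_{i<j}$ are i.i.d. with distribution $\mu$; $\mu$ is a symmetric probability measure on $\mathbb{R}$ of mean zero and variance $\sigma^2$ satisfying a Poincaré inequality: there is $C>0$ such that for every $C^1$ function $f:\mathbb{R}\to\mathbb{C}$ with $f,f'\in L^2(\mu)$, $\int|f-\int f\,d\mu|^2d\mu\le C\int|f'|^2d\mu$. $\kappa_4$ is the fourth cumulant of $\mu$. $A_N$ is a deterministic $N\times N$ Hermitian matrix whose spectral measure $\mu_{A_N}=\frac1N\sum_{i=1}^N\delta_{\gamma_i}$ ($\gamma_i=\gamma_i^{(N)}$ the eigenvalues of $A_N$) converges weakly to a compactly supported probability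 measure $\nu$. There is a fixed integer $r\ge0$ such that $A_N$ has $N-r$ eigenvalues $\beta_j(N)$ with $\max_{1\le j\le N-r}\mathrm{dist}(\beta_j(N),\mathrm{supp}(\nu))\to0$; the other $r$ eigenvalues are given by fixed real numbers $\theta_1>\dots>\theta_J$, independent of $N$, outside $\mathrm{supp}(\nu)$, each $\theta_j$ being an eigenvalue of $A_N$ with fixed multiplicity $k_j$, $\sum_{j=1}^Jk_j=r$. $\mathbb{C}^+=\{z:\Im z>0\}$. $G_{A_N}(w)=(wI_N-A_N)^{-1}$, and $g_{\mu_{A_N}}(w)=\int\frac{d\mu_{A_N}(x)}{w-x}$. A quantity $\Delta_N(z)$ is $O(N^{-p})$ if $|\Delta_N(z)|\le P(|\Im z|^{-1})/N^p$ for some polynomial $P$ with nonnegative coefficients independent of $N$ (and of $z$). *)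

theory Defs
  imports
    "HOL-Probability.Probability"
    "HOL-Computational_Algebra.Computational_Algebra"
    "Jordan_Normal_Form.Gauss_Jordan_Elimination"
    "Jordan_Normal_Form.Schur_Decomposition"
    "Jordan_Normal_Form.Char_Poly"
begin

definition hermitian_mat :: "nat \<Rightarrow> complex mat \<Rightarrow> bool" where
  "hermitian_mat n A \<longleftrightarrow> A \<in> carrier_mat n n \<and> mat_adjoint A = A"

definition mat_trace :: "'a :: comm_monoid_add mat \<Rightarrow> 'a" where
  "mat_trace A = (\<Sum>i<dim_row A. A $$ (i, i))"

text \<open>
  The resolvent is only used at \<open>w\<close> outside the spectrum, where
  \<open>mat_inverse\<close> returns \<open>Some\<close> of the two-sided inverse.
\<close>
definition resolvent :: "complex mat \<Rightarrow> complex \<Rightarrow> complex mat" where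
  "resolvent A w = the (mat_inverse (w \<cdot>\<^sub>m 1\<^sub>m (dim_row A) - A))"

text \<open>
  \<open>proots (char_poly A)\<close> is the multiset of eigenvalues with algebraic multiplicity, which for
  Hermitian \<open>A\<close> is real, so that \<open>Re\<close> only changes the type. The measure
  is meaningful for matrices of size at least 1.
\<close>
definition spectral_measure :: "complex mat \<Rightarrow> real measure" where
  "spectral_measure A =
     distr (measure_pmf (pmf_of_multiset (proots (char_poly A)))) borel Re"

definition measure_support :: "real measure \<Rightarrow> real set" where
  "measure_support \<nu> = {x. \<forall>U. open U \<longrightarrow> x \<in> U \<longrightarrow> emeasure \<nu> U > 0}"

definition stieltjes :: "real measure \<Rightarrow> complex \<Rightarrow> complex" where
  "stieltjes \<nu> w = (\<integral>x. 1 / (w - complex_of_real x) \<partial>\<nu>)"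

definition symmetric_measure :: "real measure \<Rightarrow> bool" where
  "symmetric_measure \<mu> \<longleftrightarrow> distr \<mu> borel uminus = \<mu>"

definition poincare_inequality :: "real measure \<Rightarrow> bool" where
  "poincare_inequality \<mu> \<longleftrightarrow>
     (\<exists>C>0. \<forall>f f' :: real \<Rightarrow> complex.
        (\<forall>x. (f has_vector_derivative f' x) (at x)) \<and> continuous_on UNIV f' \<and>
        integrable \<mu> (\<lambda>x. (norm (f x))\<^sup>2) \<and> integrable \<mu> (\<lambda>x. (norm (f' x))\<^sup>2) \<longrightarrow>
        (\<integral>x. (norm (f x - (\<integral>y. f y \<partial>\<mu>)))\<^sup>2 \<partial>\<mu>) \<le> C * (\<integral>x. (norm (f' x))\<^sup>2 \<partial>\<mu>))"

definition moment :: "real measure \<Rightarrow> nat \<Rightarrow> real" where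
  "moment \<mu> n = (\<integral>x. x ^ n \<partial>\<mu>)"

text \<open>
  The recursion comes from comparing coefficients in \<open>M' = K' M\<close>, where
  \<open>M\<close> is the moment generating series and \<open>K = log M\<close> the cumulant generating
  series: \<open>m (n+1) = (\<Sum>j\<le>n. (n choose j) * \<kappa> (j+1) * m (n-j))\<close>.
  The cumulant of order \<open>n\<close> is meaningful when the moments up to order \<open>n\<close> exist; a measure satisfying a Poincare
  inequality has moments of all orders.
\<close>
fun cumulant :: "real measure \<Rightarrow> nat \<Rightarrow> real" where
  "cumulant \<mu> 0 = 0"
| "cumulant \<mu> (Suc n) =
     moment \<mu> (Suc n) - (\<Sum>j<n. real (n choose j) * cumulant \<mu> (Suc j) * moment \<mu> (n - j))"

text \<open>
  The \<open>n\<^sup>2\<close> real random variables determining a Hermitian matrix, indexed by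
  \<open>{..<n} \<times> {..<n}\<close>: the diagonal entries at \<open>(i, i)\<close>, and for
  \<open>i < j\<close> the rescaled real part of the entry \<open>(i, j)\<close> at \<open>(i, j)\<close> and its rescaled
  imaginary part at \<open>(j, i)\<close>.
\<close>
definition wigner_component :: "complex mat \<Rightarrow> nat \<times> nat \<Rightarrow> real" where
  "wigner_component X = (\<lambda>(i, j).
     if i = j then Re (X $$ (i, i))
     else if i < j then sqrt 2 * Re (X $$ (i, j))
     else sqrt 2 * Im (X $$ (j, i)))"

definition wigner_matrix ::
    "real measure \<Rightarrow> nat \<Rightarrow> 'a measure \<Rightarrow> ('a \<Rightarrow> complex mat) \<Rightarrow> bool" where
  "wigner_matrix \<mu> n M W \<longleftrightarrow>
     prob_space M \<and>
     (\<forall>\<omega>\<in>space M. hermitian_mat n (W \<omega>)) \<and>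
     prob_space.indep_vars M (\<lambda>_. borel) (\<lambda>p \<omega>. wigner_component (W \<omega>) p) ({..<n} \<times> {..<n}) \<and>
     (\<forall>p\<in>{..<n} \<times> {..<n}. distr M borel (\<lambda>\<omega>. wigner_component (W \<omega>) p) = \<mu>)"

definition wigner_law :: "real measure \<Rightarrow> real \<Rightarrow> bool" where
  "wigner_law \<mu> \<sigma> \<longleftrightarrow>
     real_distribution \<mu> \<and> symmetric_measure \<mu> \<and>
     integrable \<mu> (\<lambda>x. x) \<and> (\<integral>x. x \<partial>\<mu>) = 0 \<and>
     integrable \<mu> (\<lambda>x. x\<^sup>2) \<and> (\<integral>x. (x - (\<integral>y. y \<partial>\<mu>))\<^sup>2 \<partial>\<mu>) = \<sigma>\<^sup>2 \<and>
     poincare_inequality \<mu>"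

text \<open>
  The spikes \<open>\<theta> 1 > \<dots> > \<theta> J\<close> have multiplicities \<open>k 1, \<dots>, k J\<close>, and
  \<open>\<beta> N j\<close> for \<open>j < N - r\<close> are the remaining eigenvalues of \<open>A N\<close>. The model
  makes sense for matrix sizes \<open>N \<ge> max 1 r\<close> only, and nothing is assumed about
  \<open>A N\<close> for other \<open>N\<close>. If \<open>N = r\<close> there are no \<open>\<beta> N j\<close> and the value of
  \<open>Max {}\<close> is irrelevant for the limit.
\<close>
definition spiked_deformation ::
    "(nat \<Rightarrow> complex mat) \<Rightarrow> real measure \<Rightarrow> nat \<Rightarrow> nat \<Rightarrow> (nat \<Rightarrow> real) \<Rightarrow> (nat \<Rightarrow> nat) \<Rightarrow> bool" where
  "spiked_deformation A \<nu> r J \<theta> k \<longleftrightarrow>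
     (\<forall>N\<ge>max 1 r. hermitian_mat N (A N)) \<and>
     real_distribution \<nu> \<and> compact (measure_support \<nu>) \<and>
     weak_conv_m (\<lambda>N. spectral_measure (A N)) \<nu> \<and>
     (\<forall>i\<in>{1..J}. \<forall>j\<in>{1..J}. i < j \<longrightarrow> \<theta> j < \<theta> i) \<and>
     (\<forall>j\<in>{1..J}. \<theta> j \<notin> measure_support \<nu>) \<and>
     (\<forall>j\<in>{1..J}. 0 < k j) \<and> (\<Sum>j=1..J. k j) = r \<and>
     (\<forall>N\<ge>max 1 r. \<forall>j\<in>{1..J}. Polynomial.order (complex_of_real (\<theta> j)) (char_poly (A N)) = k j) \<and>
     (\<exists>\<beta> :: nat \<Rightarrow> nat \<Rightarrow> real.
        (\<forall>N\<ge>max 1 r. proots (char_poly (A N)) =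
            image_mset (\<lambda>j. complex_of_real (\<beta> N j)) (mset_set {..<N - r}) +
            (\<Sum>j=1..J. replicate_mset (k j) (complex_of_real (\<theta> j)))) \<and>
        (\<lambda>N. Max ((\<lambda>j. infdist (\<beta> N j) (measure_support \<nu>)) ` {..<N - r})) \<longlonglongrightarrow> 0)"

definition deformed_wigner :: "nat \<Rightarrow> complex mat \<Rightarrow> complex mat \<Rightarrow> complex mat" where
  "deformed_wigner n X A = complex_of_real (1 / sqrt (real n)) \<cdot>\<^sub>m X + A"

definition mean_resolvent_trace ::
    "nat \<Rightarrow> 'a measure \<Rightarrow> ('a \<Rightarrow> complex mat) \<Rightarrow> complex mat \<Rightarrow> complex \<Rightarrow> complex" where
  "mean_resolvent_trace n M W A z =
     (\<integral>\<omega>. 1 / of_nat n * mat_trace (resolvent (deformed_wigner n (W \<omega>) A) z) \<partial>M)"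

definition correction :: "real \<Rightarrow> nat \<Rightarrow> complex mat \<Rightarrow> complex \<Rightarrow> complex" where
  "correction \<kappa> n A w = complex_of_real \<kappa> / (2 * (of_nat n)\<^sup>2) *
     (\<Sum>i<n. \<Sum>l<n. (resolvent A w ^\<^sub>m 2) $$ (i, i) * resolvent A w $$ (i, i) *
        (resolvent A w $$ (l, l))\<^sup>2)"

text \<open>
  The error \<open>O(N\<^sup>-\<^sup>p)\<close> for \<open>N\<close>-dependent functions on the upper half-plane:
  the polynomial depends neither on \<open>N\<close> nor on \<open>z\<close>.
\<close>
definition error_order :: "nat \<Rightarrow> nat \<Rightarrow> (nat \<Rightarrow> complex \<Rightarrow> complex) \<Rightarrow> bool" where
  "error_order n0 p \<Delta> \<longleftrightarrow>
     (\<exists>P :: real poly. (\<forall>i. poly.coeff P i \<ge> 0) \<and>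
        (\<forall>N\<ge>n0. \<forall>z. Im z > 0 \<longrightarrow> norm (\<Delta> N z) \<le> poly P (inverse \<bar>Im z\<bar>) / real N ^ p))"

end

theory Submission
  imports Defs
begin

text \<open>
  Write \<open>G\<close> for the resolvent of the deformed Wigner matrix at \<open>z\<close> and \<open>B\<close> for the resolvent of
  \<open>A\<close> at \<open>w = z - \<sigma>\<^sup>2 g\<close>, where \<open>g\<close> is the mean of \<open>tr G / n\<close>. Expanding \<open>B (w - A) G\<close> gives, for every
  deterministic \<open>E\<close> and \<open>F = E B\<close>, an identity for \<open>tr (G E)\<close> that is linear in the matrix
  coordinates \<open>x\<^sub>p\<close>. Cumulant expansion in each coordinate replaces \<open>x\<^sub>p\<close> by first and third derivatives:
  the first derivatives cancel \<open>\<sigma>\<^sup>2 g tr (G F)\<close> up to a covariance, which the Poincare inequality for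
  the product law bounds, and the third derivatives give a sum of products of four diagonal entries. Taking
  \<open>E\<close> of rank one shows that entries of \<open>G\<close> and \<open>G B\<close> have bias and variance \<open>O(1/n)\<close>
  about those of \<open>B\<close> and \<open>B B\<close>, so that in the fourth order term \<open>G\<close> may be replaced by \<open>B\<close>;
  \<open>E = 1\<close> then gives the expansion of \<open>g\<close>.
\<close>

section \<open>Moments and cumulant expansion\<close>

text \<open>One constant, \<open>K = 1 / Im z\<close>, bounds every resolvent that occurs:
  \<open>g\<close> has nonpositive imaginary part, so \<open>w\<close> lies at least as high as
  \<open>z\<close> and \<open>B\<close> obeys the same bound as \<open>G\<close>. All errors then
  become polynomials in \<open>K\<close>. The obstacle is the order \<open>1/n^2\<close>. After
  division by \<open>n\<close> the fourth order term must be known up to \<open>O(1/n)\<close>,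
  whereas the variance bound \<open>O(1/n)\<close> lets an entry of \<open>G\<close> fluctuate by
  \<open>n^(-1/2)\<close>. Bias and mean square error are therefore tracked separately: in a product
  of approximated factors, terms linear in the fluctuations enter only through their means, and
  quadratic ones through the mean squares. The same identity serves entries and the full trace
  without circularity. For \<open>E\<close> of rank one, Cauchy-Schwarz already makes the fourth
  order term \<open>O(1/n)\<close>, so its value is irrelevant; for \<open>E = 1\<close> it is of
  order one and is evaluated with the estimates from the rank one case. The error terms also have to
  be summed over \<open>n^2\<close> coordinates. Bounds that only see the columns of
  \<open>F\<close> belonging to a coordinate keep these sums small enough.\<close>

lemma (in prob_space) integrable_of_sq_norm:
  fixes f :: "'a \<Rightarrow> complex"
  assumes "f \<in> borel_measurable M" "integrable M (\<lambda>x. (norm (f x))\<^sup>2)"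
  shows "integrable M f"
proof (rule Bochner_Integration.integrable_bound[where f = "\<lambda>x. 1 + (norm (f x))\<^sup>2"])
  show "AE x in M. norm (f x) \<le> norm (1 + (norm (f x))\<^sup>2)"
  proof (rule AE_I2)
    fix x
    have "0 \<le> (norm (f x) - 1)\<^sup>2 + (norm (f x))\<^sup>2" by simp
    then show "norm (f x) \<le> norm (1 + (norm (f x))\<^sup>2)" by (simp add: power2_eq_square algebra_simps)
  qed
qed (use assms in auto)

lemma cmod_diff_sq: "(norm (a - m))\<^sup>2 = (norm a)\<^sup>2 - 2 * Re (a * cnj m) + (norm (m::complex))\<^sup>2"
  unfolding cmod_power2 by (simp add: power2_eq_square algebra_simps)

lemma (in prob_space) variance_complex:
  fixes f :: "'a \<Rightarrow> complex"
  assumes "f \<in> borel_measurable M" "integrable M (\<lambda>x. (norm (f x))\<^sup>2)"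
  shows "(\<integral>x. (norm (f x - (\<integral>y. f y \<partial>M)))\<^sup>2 \<partial>M) = (\<integral>x. (norm (f x))\<^sup>2 \<partial>M) - (norm (\<integral>y. f y \<partial>M))\<^sup>2"
    and "integrable M (\<lambda>x. (norm (f x - (\<integral>y. f y \<partial>M)))\<^sup>2)"
proof -
  define m where "m = (\<integral>y. f y \<partial>M)"
  have i: "integrable M f" by (rule integrable_of_sq_norm[OF assms])
  have i1: "integrable M (\<lambda>x. f x * cnj m)" using i by simp
  have i2: "integrable M (\<lambda>x. Re (f x * cnj m))" using i1 by (rule integrable_Re)
  show "integrable M (\<lambda>x. (norm (f x - (\<integral>y. f y \<partial>M)))\<^sup>2)"
    unfolding cmod_diff_sq m_def[symmetric]
    by (intro Bochner_Integration.integrable_add Bochner_Integration.integrable_diff integrable_mult_right i2 assms(2)) simp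
  have "(\<integral>x. (norm (f x - m))\<^sup>2 \<partial>M) = (\<integral>x. (norm (f x))\<^sup>2 \<partial>M) - 2 * (\<integral>x. Re (f x * cnj m) \<partial>M) + (norm m)\<^sup>2"
    unfolding cmod_diff_sq using i2 assms(2) by (simp add: prob_space del: times_complex.sel)
  also have "(\<integral>x. Re (f x * cnj m) \<partial>M) = Re (\<integral>x. f x * cnj m \<partial>M)"
    using i1 by (rule integral_Re)
  also have "(\<integral>x. f x * cnj m \<partial>M) = m * cnj m" by (simp add: m_def)
  also have "Re (m * cnj m) = (norm m)\<^sup>2" unfolding cmod_power2 by (simp add: power2_eq_square)
  finally show "(\<integral>x. (norm (f x - (\<integral>y. f y \<partial>M)))\<^sup>2 \<partial>M) = (\<integral>x. (norm (f x))\<^sup>2 \<partial>M) - (norm (\<integral>y. f y \<partial>M))\<^sup>2"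
    by (simp add: m_def)
qed

text \<open>The constant is pulled out so that one \<open>C\<close> serves all coordinates. With the
  variance written as second moment minus squared mean, the intermediate term cancels when two
  partial variances are added.\<close>

definition variance_bound :: "real measure \<Rightarrow> real \<Rightarrow> bool" where
  "variance_bound \<mu> C \<longleftrightarrow> (\<forall>f f' :: real \<Rightarrow> complex.
     (\<forall>x. (f has_vector_derivative f' x) (at x)) \<longrightarrow> continuous_on UNIV f' \<longrightarrow>
     integrable \<mu> (\<lambda>x. (norm (f x))\<^sup>2) \<longrightarrow> integrable \<mu> (\<lambda>x. (norm (f' x))\<^sup>2) \<longrightarrow>
     (\<integral>x. (norm (f x))\<^sup>2 \<partial>\<mu>) - (norm (\<integral>x. f x \<partial>\<mu>))\<^sup>2 \<le> C * (\<integral>x. (norm (f' x))\<^sup>2 \<partial>\<mu>))"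

lemma variance_boundD:
  fixes f f' :: "real \<Rightarrow> complex"
  assumes "variance_bound \<mu> C" "\<And>x. (f has_vector_derivative f' x) (at x)" "continuous_on UNIV f'"
    and "integrable \<mu> (\<lambda>x. (norm (f x))\<^sup>2)" "integrable \<mu> (\<lambda>x. (norm (f' x))\<^sup>2)"
  shows "(\<integral>x. (norm (f x))\<^sup>2 \<partial>\<mu>) - (norm (\<integral>x. f x \<partial>\<mu>))\<^sup>2 \<le> C * (\<integral>x. (norm (f' x))\<^sup>2 \<partial>\<mu>)"
  using assms unfolding variance_bound_def by blast

lemma poincare_inequality_variance:
  assumes "real_distribution \<mu>" "poincare_inequality \<mu>"
  obtains C where "C > 0" "variance_bound \<mu> C"
proof -
  interpret real_distribution \<mu> by fact
  obtain C where C: "C > 0" "\<And>f f' :: real \<Rightarrow> complex. (\<forall>x. (f has_vector_derivative f' x) (at x)) \<and> continuous_on UNIV f' \<and>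
        integrable \<mu> (\<lambda>x. (norm (f x))\<^sup>2) \<and> integrable \<mu> (\<lambda>x. (norm (f' x))\<^sup>2) \<Longrightarrow>
        (\<integral>x. (norm (f x - (\<integral>y. f y \<partial>\<mu>)))\<^sup>2 \<partial>\<mu>) \<le> C * (\<integral>x. (norm (f' x))\<^sup>2 \<partial>\<mu>)"
    using assms(2) unfolding poincare_inequality_def by blast
  show ?thesis
  proof (rule that[OF C(1)], unfold variance_bound_def, intro allI impI)
    fix f f' :: "real \<Rightarrow> complex"
    assume a: "\<forall>x. (f has_vector_derivative f' x) (at x)" "continuous_on UNIV f'"
      "integrable \<mu> (\<lambda>x. (norm (f x))\<^sup>2)" "integrable \<mu> (\<lambda>x. (norm (f' x))\<^sup>2)"
    have "continuous_on UNIV f" using a(1)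
      by (meson continuous_at_imp_continuous_on has_vector_derivative_continuous)
    then have "f \<in> borel_measurable borel" by (rule borel_measurable_continuous_onI)
    then have m: "f \<in> borel_measurable \<mu>" by simp
    show "(\<integral>x. (norm (f x))\<^sup>2 \<partial>\<mu>) - (norm (\<integral>x. f x \<partial>\<mu>))\<^sup>2 \<le> C * (\<integral>x. (norm (f' x))\<^sup>2 \<partial>\<mu>)"
      using C(2)[of f f'] a variance_complex(1)[OF m a(3)] by simp
  qed
qed

text \<open>Fatou's lemma. It turns bounds on truncated powers that are uniform in the truncation
  into finiteness of a moment.\<close>

lemma integrable_of_bounded_approximation:
  fixes F :: "'a \<Rightarrow> real" and f :: "nat \<Rightarrow> 'a \<Rightarrow> real"
  assumes "\<And>n. integrable M (f n)" "\<And>n x. 0 \<le> f n x" "\<And>n. (\<integral>x. f n x \<partial>M) \<le> B"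
    "\<And>x. (\<lambda>n. f n x) \<longlonglongrightarrow> F x" "F \<in> borel_measurable M"
  shows "integrable M F"
proof (rule integrableI_bounded[OF assms(5)])
  have F0: "0 \<le> F x" for x using assms(2,4) by (meson LIMSEQ_le_const)
  have "(\<integral>\<^sup>+ x. ennreal (norm (F x)) \<partial>M) = (\<integral>\<^sup>+ x. liminf (\<lambda>n. ennreal (f n x)) \<partial>M)"
  proof (rule nn_integral_cong)
    fix x
    have "(\<lambda>n. ennreal (f n x)) \<longlonglongrightarrow> ennreal (F x)" using assms(4) by (rule tendsto_ennrealI)
    then show "ennreal (norm (F x)) = liminf (\<lambda>n. ennreal (f n x))"
      using F0[of x] by (simp add: lim_imp_Liminf)
  qed
  also have "\<dots> \<le> liminf (\<lambda>n. \<integral>\<^sup>+ x. ennreal (f n x) \<partial>M)"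
    using assms(1) by (intro nn_integral_liminf) auto
  also have "\<dots> \<le> liminf (\<lambda>n. ennreal B)"
    using assms by (intro Liminf_mono always_eventually allI) (simp add: nn_integral_eq_integral ennreal_leI)
  also have "\<dots> < \<infinity>" by (simp add: Liminf_const)
  finally show "(\<integral>\<^sup>+ x. ennreal (norm (F x)) \<partial>M) < \<infinity>" .
qed

lemma poincare_inequality_real:
  assumes "real_distribution \<mu>" "poincare_inequality \<mu>"
  obtains C where "C > 0" "\<And>f f' :: real \<Rightarrow> real. (\<And>x. (f has_real_derivative f' x) (at x)) \<Longrightarrow>
     continuous_on UNIV f' \<Longrightarrow> integrable \<mu> (\<lambda>x. (f x)\<^sup>2) \<Longrightarrow> integrable \<mu> (\<lambda>x. (f' x)\<^sup>2) \<Longrightarrow>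
     (\<integral>x. (f x)\<^sup>2 \<partial>\<mu>) - (\<integral>x. f x \<partial>\<mu>)\<^sup>2 \<le> C * (\<integral>x. (f' x)\<^sup>2 \<partial>\<mu>)"
proof -
  obtain C where C: "C > 0" "variance_bound \<mu> C"
    using poincare_inequality_variance[OF assms] by blast
  show ?thesis
  proof (rule that[OF C(1)])
    fix f f' :: "real \<Rightarrow> real"
    assume a: "\<And>x. (f has_real_derivative f' x) (at x)" "continuous_on UNIV f'"
      "integrable \<mu> (\<lambda>x. (f x)\<^sup>2)" "integrable \<mu> (\<lambda>x. (f' x)\<^sup>2)"
    have "((\<lambda>x. complex_of_real (f x)) has_vector_derivative complex_of_real (f' x)) (at x)" for x
      using a(1)[of x] by (intro has_vector_derivative_of_real)
    from variance_boundD[OF C(2) this] a show "(\<integral>x. (f x)\<^sup>2 \<partial>\<mu>) - (\<integral>x. f x \<partial>\<mu>)\<^sup>2 \<le> C * (\<integral>x. (f' x)\<^sup>2 \<partial>\<mu>)"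
      by (simp add: continuous_on_of_real)
  qed
qed

text \<open>The moments of order 4 and 6 are reached by applying the Poincare inequality to the truncations
  \<open>x\<^sup>2 / (1 + \<epsilon> x\<^sup>2)\<close> and \<open>x\<^sup>3 / (1 + \<epsilon> x\<^sup>2)\<close> and letting \<open>\<epsilon>\<close> tend to 0.\<close>

lemma poincare_integrable_double_power:
  fixes a :: nat
  assumes "real_distribution \<mu>" "poincare_inequality \<mu>" "a \<in> {2, 3}"
    and i2: "integrable \<mu> (\<lambda>x. x\<^sup>2)" and ia: "integrable \<mu> (\<lambda>x. x ^ (2 * (a - 1)))"
  shows "integrable \<mu> (\<lambda>x. x ^ (2 * a))"
proof -
  interpret real_distribution \<mu> by fact
  obtain C where C: "C > 0" "\<And>f f' :: real \<Rightarrow> real. (\<And>x. (f has_real_derivative f' x) (at x)) \<Longrightarrow>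
     continuous_on UNIV f' \<Longrightarrow> integrable \<mu> (\<lambda>x. (f x)\<^sup>2) \<Longrightarrow> integrable \<mu> (\<lambda>x. (f' x)\<^sup>2) \<Longrightarrow>
     (\<integral>x. (f x)\<^sup>2 \<partial>\<mu>) - (\<integral>x. f x \<partial>\<mu>)\<^sup>2 \<le> C * (\<integral>x. (f' x)\<^sup>2 \<partial>\<mu>)"
    using poincare_inequality_real[OF assms(1,2)] by blast
  have a: "a = 2 \<or> a = 3" using assms(3) by auto
  have m[measurable]: "(\<lambda>x. f x) \<in> borel_measurable \<mu>" if "f \<in> borel_measurable borel" for f :: "real \<Rightarrow> real"
    using that by simp
  \<comment> \<open>This bounds the mean of the truncations uniformly in \<open>n\<close>. For
    \<open>a = 3\<close> it interpolates between the orders 2 and 4.\<close>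
  have iabs: "integrable \<mu> (\<lambda>x. \<bar>x\<bar> ^ a)"
  proof (rule Bochner_Integration.integrable_bound[where f = "\<lambda>x. x\<^sup>2 + x ^ (2 * (a - 1))"])
    show "integrable \<mu> (\<lambda>x. x\<^sup>2 + x ^ (2 * (a - 1)))" using i2 ia by simp
    have "\<bar>x\<bar>^3 \<le> x^2 + x^4" for x :: real
    proof -
      define y where "y = \<bar>x\<bar>"
      have "0 \<le> y^2 * (y - 1)^2 + y^2 + y^4" by simp
      also have "\<dots> = 2 * (y^2 + y^4 - y^3)"
        by (simp add: power2_eq_square power4_eq_xxxx power3_eq_cube algebra_simps)
      finally have "y^3 \<le> y^2 + y^4" by simp
      then show ?thesis by (simp add: y_def)
    qed
    moreover have "x^2 + x^4 = \<bar>x^2 + x^4\<bar>" for x :: real by simp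
    ultimately have "\<bar>x\<bar>^3 \<le> \<bar>x^2 + x^4\<bar>" for x :: real by metis
    then show "AE x in \<mu>. norm (\<bar>x\<bar> ^ a) \<le> norm (x\<^sup>2 + x ^ (2 * (a - 1)))"
      using a by (intro AE_I2) (auto simp: numeral_eq_Suc)
  qed measurable
  define e where "e n = 1 / real (Suc n)" for n
  have e: "e n > 0" for n by (simp add: e_def)
  define f where "f n x = x ^ a / (1 + e n * x\<^sup>2)" for n and x :: real
  define f' where "f' n x = (real a * x ^ (a - 1) * (1 + e n * x\<^sup>2) - x ^ a * (2 * e n * x)) / (1 + e n * x\<^sup>2)\<^sup>2"
    for n and x :: real
  have den: "1 + e n * x\<^sup>2 \<ge> 1" for n and x :: real using e[of n] by simp
  have den1: "1 + e n * x\<^sup>2 > 0" for n and x :: real using den[of n x] by linarith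
  have den0: "1 + e n * x\<^sup>2 \<noteq> 0" for n and x :: real using den[of n x] by linarith
  have df: "(f n has_real_derivative f' n x) (at x)" for n x
    unfolding f_def f'_def using den0[of n x]
    by (auto intro!: derivative_eq_intros simp: power2_eq_square)
  have cf: "continuous_on UNIV (f' n)" for n
    unfolding f'_def using den0 by (intro continuous_intros) auto
  have fb: "\<bar>f n x\<bar> \<le> \<bar>x\<bar> ^ a" for n x
  proof -
    have "\<bar>x\<bar> ^ a / (1 + e n * x\<^sup>2) \<le> \<bar>x\<bar> ^ a / 1" using den[of n x] by (intro divide_left_mono) auto
    then show ?thesis unfolding f_def using den[of n x] by (simp add: abs_divide power_abs)
  qed
  \<comment> \<open>This bound degenerates as \<open>n\<close> grows, but since \<open>a - 2\<close>
    is at most 1 it makes \<open>f n\<close> square integrable from the second moment alone, which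
    the Poincare inequality asks for.\<close>
  have f1b: "\<bar>f n x\<bar> \<le> \<bar>x\<bar> ^ (a - 2) / e n" for n x
  proof -
    have "\<bar>x\<bar> ^ a = \<bar>x\<bar> ^ (a - 2) * x\<^sup>2" using a by (auto simp: numeral_eq_Suc abs_mult)
    moreover have "x\<^sup>2 * e n \<le> 1 + e n * x\<^sup>2" by simp
    ultimately have "\<bar>x\<bar> ^ a * e n \<le> \<bar>x\<bar> ^ (a - 2) * (1 + e n * x\<^sup>2)"
      by (simp add: mult_left_mono mult.assoc)
    then have "\<bar>x\<bar> ^ a / (1 + e n * x\<^sup>2) \<le> \<bar>x\<bar> ^ (a - 2) / e n"
      using e[of n] den1[of n x] by (simp add: divide_simps)
    then show ?thesis unfolding f_def using den[of n x] by (simp add: abs_divide power_abs)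
  qed
  have f1b2: "(f n x)\<^sup>2 \<le> (1 + x\<^sup>2) / (e n)\<^sup>2" for n x
  proof -
    have "(f n x)\<^sup>2 \<le> (\<bar>x\<bar> ^ (a - 2) / e n)\<^sup>2" using f1b[of n x] by (rule power2_le_iff_abs_le[THEN iffD2, rotated]) (use e[of n] in simp)
    also have "\<dots> \<le> (1 + x\<^sup>2) / (e n)\<^sup>2" using a by (auto simp: power_divide divide_right_mono)
    finally show ?thesis .
  qed
  have fi: "integrable \<mu> (\<lambda>x. (f n x)\<^sup>2)" for n
  proof (rule Bochner_Integration.integrable_bound[where f = "\<lambda>x. (1 + x\<^sup>2) / (e n)\<^sup>2"])
    show "integrable \<mu> (\<lambda>x. (1 + x\<^sup>2) / (e n)\<^sup>2)" using i2 by simp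
    show "(\<lambda>x. (f n x)\<^sup>2) \<in> borel_measurable \<mu>" unfolding f_def by measurable
    show "AE x in \<mu>. norm ((f n x)\<^sup>2) \<le> norm ((1 + x\<^sup>2) / (e n)\<^sup>2)"
      using f1b2[of n] by (intro AE_I2) simp
  qed
  \<comment> \<open>Unlike \<open>f1b\<close> this is uniform in \<open>n\<close>: the numerator is
    \<open>x ^ (a - 1)\<close> times a factor of modulus at most
    \<open>3 * (1 + e n * x\<^sup>2)\<close>.\<close>
  have f'b: "\<bar>f' n x\<bar> \<le> 3 * \<bar>x\<bar> ^ (a - 1)" for n x
  proof -
    let ?d = "1 + e n * x\<^sup>2"
    have "\<bar>real a * x ^ (a - 1) * ?d - x ^ a * (2 * e n * x)\<bar> = \<bar>x\<bar> ^ (a - 1) * \<bar>real a * ?d - 2 * (e n * x\<^sup>2)\<bar>"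
    proof -
      have "real a * x ^ (a - 1) * ?d - x ^ a * (2 * e n * x) = x ^ (a - 1) * (real a * ?d - 2 * (e n * x\<^sup>2))"
        using a by (auto simp: algebra_simps power_numeral_reduce)
      then show ?thesis by (simp add: abs_mult power_abs)
    qed
    also have "\<bar>real a * ?d - 2 * (e n * x\<^sup>2)\<bar> \<le> 3 * ?d"
      using a e[of n] by (auto simp: algebra_simps abs_le_iff)
    also have "3 * ?d \<le> 3 * ?d\<^sup>2"
      using self_le_power[OF den[of n x], of 2] by simp
    finally have "\<bar>real a * x ^ (a - 1) * ?d - x ^ a * (2 * e n * x)\<bar> \<le> \<bar>x\<bar> ^ (a - 1) * (3 * ?d\<^sup>2)"
      by (simp add: mult_left_mono)
    then show ?thesis unfolding f'_def using den[of n x] by (simp add: abs_divide divide_simps mult_ac)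
  qed
  have f'b2: "(f' n x)\<^sup>2 \<le> 9 * x ^ (2 * (a - 1))" for n x
  proof -
    have "(f' n x)\<^sup>2 \<le> (3 * \<bar>x\<bar> ^ (a - 1))\<^sup>2" using f'b[of n x] by (rule power2_le_iff_abs_le[THEN iffD2, rotated]) simp
    also have "\<dots> = 9 * x ^ (2 * (a - 1))" using a by (auto simp: power_mult_distrib power_numeral_reduce)
    finally show ?thesis .
  qed
  have f'i: "integrable \<mu> (\<lambda>x. (f' n x)\<^sup>2)" for n
  proof (rule Bochner_Integration.integrable_bound[where f = "\<lambda>x. 9 * x ^ (2 * (a - 1))"])
    show "integrable \<mu> (\<lambda>x. 9 * x ^ (2 * (a - 1)))" using ia by simp
    show "(\<lambda>x. (f' n x)\<^sup>2) \<in> borel_measurable \<mu>" unfolding f'_def by measurable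
    show "AE x in \<mu>. norm ((f' n x)\<^sup>2) \<le> norm (9 * x ^ (2 * (a - 1)))"
      using f'b2[of n] by (intro AE_I2) (metis abs_ge_self order_trans power2_abs real_norm_def abs_power2)
  qed
  have fi1: "\<bar>\<integral>x. f n x \<partial>\<mu>\<bar> \<le> (\<integral>x. \<bar>x\<bar> ^ a \<partial>\<mu>)" for n
  proof -
    have "norm (\<integral>x. f n x \<partial>\<mu>) \<le> (\<integral>x. \<bar>x\<bar> ^ a \<partial>\<mu>)"
      using fb by (intro order_trans[OF integral_norm_bound] integral_mono iabs Bochner_Integration.integrable_norm)
         (auto intro!: Bochner_Integration.integrable_bound[OF iabs] simp: f_def)
    then show ?thesis by simp
  qed
  define B where "B = C * (9 * (\<integral>x. x ^ (2 * (a - 1)) \<partial>\<mu>)) + (\<integral>x. \<bar>x\<bar> ^ a \<partial>\<mu>)\<^sup>2"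
  have "(\<integral>x. (f n x)\<^sup>2 \<partial>\<mu>) \<le> B" for n
  proof -
    have "(\<integral>x. (f n x)\<^sup>2 \<partial>\<mu>) \<le> C * (\<integral>x. (f' n x)\<^sup>2 \<partial>\<mu>) + (\<integral>x. f n x \<partial>\<mu>)\<^sup>2"
      using C(2)[of "f n" "f' n", OF df cf fi f'i] by simp
    also have "(\<integral>x. (f' n x)\<^sup>2 \<partial>\<mu>) \<le> (\<integral>x. 9 * x ^ (2 * (a - 1)) \<partial>\<mu>)"
      using ia f'b2 by (intro integral_mono f'i) auto
    also have "(\<integral>x. f n x \<partial>\<mu>)\<^sup>2 \<le> (\<integral>x. \<bar>x\<bar> ^ a \<partial>\<mu>)\<^sup>2"
      using fi1[of n] by (rule power2_le_iff_abs_le[THEN iffD2, rotated]) (auto intro!: integral_nonneg_AE)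
    finally show ?thesis using C(1) by (simp add: B_def)
  qed
  then show ?thesis
  proof (rule integrable_of_bounded_approximation[where f = "\<lambda>n x. (f n x)\<^sup>2", rotated 2])
    fix x :: real
    have "e \<longlonglongrightarrow> 0" unfolding e_def using LIMSEQ_inverse_real_of_nat by (simp add: inverse_eq_divide)
    then have "(\<lambda>n. (f n x)\<^sup>2) \<longlonglongrightarrow> (x ^ a / (1 + 0 * x\<^sup>2))\<^sup>2"
      unfolding f_def by (intro tendsto_intros) auto
    then show "(\<lambda>n. (f n x)\<^sup>2) \<longlonglongrightarrow> x ^ (2 * a)" by (simp add: power_mult[symmetric] mult.commute)
  qed (use fi in auto)
qed

text \<open>Order six is what the cumulant expansion consumes: a Taylor remainder of order five,
  multiplied by the variable itself.\<close>

lemma wigner_law_integrable_power: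
  assumes "wigner_law \<mu> \<sigma>" "k \<le> 6"
  shows "integrable \<mu> (\<lambda>x. x ^ k)"
proof -
  have law: "real_distribution \<mu>" "poincare_inequality \<mu>" "integrable \<mu> (\<lambda>x. x\<^sup>2)"
    using assms(1) by (auto simp: wigner_law_def)
  interpret real_distribution \<mu> by fact
  have i4: "integrable \<mu> (\<lambda>x. x ^ 4)"
    using poincare_integrable_double_power[OF law(1,2), of 2] law(3) by simp
  have i6: "integrable \<mu> (\<lambda>x. x ^ 6)"
    using poincare_integrable_double_power[OF law(1,2), of 3] law(3) i4 by simp
  show ?thesis
  proof (rule Bochner_Integration.integrable_bound[where f = "\<lambda>x. 1 + x ^ 6"])
    show "AE x in \<mu>. norm (x ^ k) \<le> norm (1 + x ^ 6)"
    proof (rule AE_I2)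
      fix x :: real
      have e: "1 + x ^ 6 = 1 + \<bar>x\<bar> ^ 6" by (simp add: power_even_abs)
      have "\<bar>x\<bar> ^ k \<le> 1 + \<bar>x\<bar> ^ 6"
      proof (cases "\<bar>x\<bar> \<le> 1")
        case True
        then have "\<bar>x\<bar> ^ k \<le> 1" by (simp add: power_le_one)
        moreover have "0 \<le> \<bar>x\<bar> ^ 6" by simp
        ultimately show ?thesis by linarith
      next
        case False
        then have "\<bar>x\<bar> ^ k \<le> \<bar>x\<bar> ^ 6" using assms(2) by (intro power_increasing) auto
        then show ?thesis by simp
      qed
      then show "norm (x ^ k) \<le> norm (1 + x ^ 6)" unfolding e by (simp add: power_abs)
    qed
  qed (use i6 in auto)
qed

lemma wigner_law_odd_moment:
  assumes "wigner_law \<mu> \<sigma>" "odd k"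
  shows "(\<integral>x. x ^ k \<partial>\<mu>) = 0"
proof -
  have law: "real_distribution \<mu>" "distr \<mu> borel uminus = \<mu>"
    using assms(1) by (auto simp: wigner_law_def symmetric_measure_def)
  interpret real_distribution \<mu> by fact
  have "(\<integral>x. x ^ k \<partial>\<mu>) = (\<integral>x. x ^ k \<partial>(distr \<mu> borel uminus))" by (simp add: law(2))
  also have "\<dots> = (\<integral>x. (- x) ^ k \<partial>\<mu>)" by (rule integral_distr) auto
  also have "\<dots> = - (\<integral>x. x ^ k \<partial>\<mu>)" using assms(2) by simp
  finally show ?thesis by simp
qed

lemma wigner_law_second_moment:
  assumes "wigner_law \<mu> \<sigma>"
  shows "(\<integral>x. x\<^sup>2 \<partial>\<mu>) = \<sigma>\<^sup>2"
  using assms unfolding wigner_law_def by auto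

text \<open>With vanishing odd moments the recursion leaves the fourth moment minus three times the
  square of the second.\<close>

lemma wigner_law_cumulant4:
  assumes "wigner_law \<mu> \<sigma>"
  shows "cumulant \<mu> 4 = (\<integral>x. x ^ 4 \<partial>\<mu>) - 3 * \<sigma> ^ 4"
proof -
  interpret real_distribution \<mu> using assms by (auto simp: wigner_law_def)
  have o: "moment \<mu> (Suc 0) = 0" "moment \<mu> 3 = 0"
    using wigner_law_odd_moment[OF assms, of 1] wigner_law_odd_moment[OF assms, of 3]
    by (auto simp: moment_def)
  have m2: "moment \<mu> 2 = \<sigma>\<^sup>2" using wigner_law_second_moment[OF assms] by (simp add: moment_def)
  have m0: "moment \<mu> 0 = 1" using prob_space by (simp add: moment_def)
  have sets: "{..<3::nat} = {0, 1, 2}" "{..<2::nat} = {0, 1}" "{..<1::nat} = {0}" by auto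
  have c1: "cumulant \<mu> (Suc 0) = 0"
    unfolding cumulant.simps(2)[of \<mu> 0] using o by (simp del: cumulant.simps)
  have c2: "cumulant \<mu> (Suc 1) = \<sigma>\<^sup>2"
    unfolding cumulant.simps(2)[of \<mu> 1] sets using m2 o c1
    by (simp add: numeral_2_eq_2 del: cumulant.simps)
  have c3: "cumulant \<mu> (Suc 2) = 0"
    unfolding cumulant.simps(2)[of \<mu> 2] sets using o c1 c2
    by (simp add: numeral_3_eq_3 del: cumulant.simps)
  have "cumulant \<mu> (Suc 3) = moment \<mu> 4 - 3 * \<sigma> ^ 4"
    unfolding cumulant.simps(2)[of \<mu> 3] sets using o m2 c1 c2 c3
    by (simp add: numeral_eq_Suc del: cumulant.simps)
  then have "cumulant \<mu> 4 = moment \<mu> 4 - 3 * \<sigma> ^ 4" by simp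
  then show ?thesis by (simp add: moment_def)
qed

text \<open>The factorial in the remainder is given up, as only the dependence on \<open>B\<close>
  matters later. The derivative of the remainder is the remainder of order \<open>m\<close> for
  \<open>t 1\<close>, so the induction hypothesis and the mean value inequality on the interval from
  \<open>- \<bar>s\<bar>\<close> to \<open>\<bar>s\<bar>\<close> suffice.\<close>

lemma vector_taylor_bound:
  fixes t :: "nat \<Rightarrow> real \<Rightarrow> complex"
  assumes "\<And>k s. k < m \<Longrightarrow> (t k has_vector_derivative t (Suc k) s) (at s)"
    and "\<And>s. norm (t m s) \<le> B"
  shows "norm (t 0 s - (\<Sum>k<m. (s ^ k / fact k) *\<^sub>R t k 0)) \<le> B * \<bar>s\<bar> ^ m"
  using assms
proof (induction m arbitrary: t s)
  case 0
  then show ?case by simp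
next
  case (Suc m)
  have B: "0 \<le> B" using Suc.prems(2)[of 0] norm_ge_zero order_trans by blast
  define R where "R u = t 0 u - (\<Sum>k<Suc m. (u ^ k / fact k) *\<^sub>R t k 0)" for u
  define R' where "R' u = t 1 u - (\<Sum>k<m. (u ^ k / fact k) *\<^sub>R t (Suc k) 0)" for u
  have R': "norm (R' u) \<le> B * \<bar>u\<bar> ^ m" for u
    using Suc.IH[of "\<lambda>k. t (Suc k)" u] Suc.prems by (simp add: R'_def)
  have dR: "(R has_vector_derivative R' u) (at u)" for u
  proof -
    have "((\<lambda>u. (u ^ Suc k / fact (Suc k)) *\<^sub>R t (Suc k) 0) has_vector_derivative (u ^ k / fact k) *\<^sub>R t (Suc k) 0) (at u)" for k
    proof -
      have "((\<lambda>u. u ^ Suc k / fact (Suc k)) has_real_derivative u ^ k / fact k) (at u)"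
        using DERIV_cdivide[OF DERIV_pow[of "Suc k" u], of "fact (Suc k)"]
        by (simp add: mult_divide_mult_cancel_left del: of_nat_Suc)
      then show ?thesis
        using has_vector_derivative_scaleR[OF _ has_vector_derivative_const] by fastforce
    qed
    then have "((\<lambda>u. \<Sum>k<m. (u ^ Suc k / fact (Suc k)) *\<^sub>R t (Suc k) 0) has_vector_derivative
        (\<Sum>k<m. (u ^ k / fact k) *\<^sub>R t (Suc k) 0)) (at u)"
      by (intro has_vector_derivative_sum)
    then have "((\<lambda>u. t 0 u - (t 0 0 + (\<Sum>k<m. (u ^ Suc k / fact (Suc k)) *\<^sub>R t (Suc k) 0))) has_vector_derivative
       R' u) (at u)"
      unfolding R'_def
      using has_vector_derivative_diff[OF Suc.prems(1)[of 0 u] has_vector_derivative_add[OF has_vector_derivative_const]]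
      by (simp del: fact_Suc power_Suc)
    moreover have "R = (\<lambda>u. t 0 u - (t 0 0 + (\<Sum>k<m. (u ^ Suc k / fact (Suc k)) *\<^sub>R t (Suc k) 0)))"
      unfolding R_def sum.lessThan_Suc_shift by (simp add: fun_eq_iff)
    ultimately show ?thesis by simp
  qed
  have "norm (R s - R 0) \<le> (B * \<bar>s\<bar> ^ m) * norm (s - 0)"
  proof (rule differentiable_bound[where S = "{- \<bar>s\<bar>..\<bar>s\<bar>}" and f' = "\<lambda>u h. h *\<^sub>R R' u"])
    fix u :: real assume u: "u \<in> {- \<bar>s\<bar>..\<bar>s\<bar>}"
    show "(R has_derivative (\<lambda>h. h *\<^sub>R R' u)) (at u within {- \<bar>s\<bar>..\<bar>s\<bar>})"
      using has_vector_derivative_at_within[OF dR[of u]] by (simp add: has_vector_derivative_def)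
    have "\<bar>u\<bar> \<le> \<bar>s\<bar>" using u by auto
    then have "B * \<bar>u\<bar> ^ m \<le> B * \<bar>s\<bar> ^ m" using B by (intro mult_left_mono power_mono) auto
    then have "norm (R' u) \<le> B * \<bar>s\<bar> ^ m" using R'[of u] by linarith
    then show "onorm (\<lambda>h. h *\<^sub>R R' u) \<le> B * \<bar>s\<bar> ^ m"
      by (intro onorm_le) (simp add: mult.commute mult_left_mono)
  qed auto
  moreover have "R 0 = 0" unfolding R_def sum.lessThan_Suc_shift by simp
  ultimately show ?case by (simp add: R_def mult_ac)
qed

text \<open>A non-integrable \<open>f\<close> has integral 0 by convention; \<open>0 \<le> b\<close>
  covers that case.\<close>

lemma (in prob_space) norm_integral_le_const:
  fixes f :: "'a \<Rightarrow> 'b::{banach, second_countable_topology}"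
  assumes "\<And>x. x \<in> space M \<Longrightarrow> norm (f x) \<le> b" "0 \<le> b"
  shows "norm (\<integral>x. f x \<partial>M) \<le> b"
proof (cases "integrable M f")
  case True
  have "norm (\<integral>x. f x \<partial>M) \<le> (\<integral>x. norm (f x) \<partial>M)" by (rule integral_norm_bound)
  also have "\<dots> \<le> (\<integral>x. b \<partial>M)" using True assms(1) by (intro integral_mono) auto
  finally show ?thesis by (simp add: prob_space)
next
  case False
  then show ?thesis using assms(2) by (simp add: not_integrable_integral_eq)
qed

text \<open>The three summands are the Taylor remainders of \<open>x * t 0\<close>,
  \<open>t 1\<close> and \<open>t 3\<close>, which involve the moments of order 6, 4 and 2; the
  factor 1/6 of the last one is dropped.\<close>

definition expansion_const :: "real measure \<Rightarrow> real \<Rightarrow> real" where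
  "expansion_const \<mu> \<sigma> = (\<integral>x. x ^ 6 \<partial>\<mu>) + \<sigma>\<^sup>2 * (\<integral>x. x ^ 4 \<partial>\<mu>) + \<bar>cumulant \<mu> 4\<bar> * \<sigma>\<^sup>2"

lemma expansion_const_nonneg: "0 \<le> expansion_const \<mu> \<sigma>"
  unfolding expansion_const_def by (intro add_nonneg_nonneg mult_nonneg_nonneg integral_nonneg) auto

text \<open>Both sides have the same expansion up to order 4 in terms of the values \<open>t k 0\<close>,
  because the odd moments vanish.\<close>

lemma wigner_law_cumulant_expansion:
  fixes t :: "nat \<Rightarrow> real \<Rightarrow> complex"
  assumes law: "wigner_law \<mu> \<sigma>"
    and d: "\<And>k s. k < 5 \<Longrightarrow> (t k has_vector_derivative t (Suc k) s) (at s)"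
    and bd: "\<And>s. norm (t 0 s) \<le> b" "\<And>s. norm (t 1 s) \<le> b" "\<And>s. norm (t 3 s) \<le> b"
    and B: "\<And>s. norm (t 5 s) \<le> B"
  shows "norm ((\<integral>x. x *\<^sub>R t 0 x \<partial>\<mu>) - (\<sigma>\<^sup>2 *\<^sub>R (\<integral>x. t 1 x \<partial>\<mu>) + (cumulant \<mu> 4 / 6) *\<^sub>R (\<integral>x. t 3 x \<partial>\<mu>)))
     \<le> expansion_const \<mu> \<sigma> * B"
proof -
  interpret real_distribution \<mu> using law by (auto simp: wigner_law_def)
  have B0: "0 \<le> B" using B[of 0] norm_ge_zero order_trans by blast
  note ip = wigner_law_integrable_power[OF law]
  define m where "m k = (\<integral>x. x ^ k \<partial>\<mu>)" for k
  have m_odd: "m k = 0" if "odd k" for k using wigner_law_odd_moment[OF law that] by (simp add: m_def)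
  have m0: "m 0 = 1" using prob_space by (simp add: m_def)
  have m2: "m 2 = \<sigma>\<^sup>2" using wigner_law_second_moment[OF law] by (simp add: m_def)
  have k4: "cumulant \<mu> 4 = m 4 - 3 * (m 2)\<^sup>2" using wigner_law_cumulant4[OF law] by (simp add: m_def[symmetric] m2)
  have cont: "continuous_on UNIV (t k)" if "k < 5" for k
    using d[OF that] by (meson continuous_at_imp_continuous_on has_vector_derivative_continuous)
  have meas: "t k \<in> borel_measurable \<mu>" if "k < 5" for k
    using borel_measurable_continuous_onI[OF cont[OF that]] by simp
  define p where "p j l x = (\<Sum>k<l. (x ^ k / fact k) *\<^sub>R t (k + j) 0)" for j l x
  have tay: "norm (t j x - p j (5 - j) x) \<le> B * \<bar>x\<bar> ^ (5 - j)" if "j < 5" for j x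
  proof -
    have "5 - j + j = 5" using that by simp
    then show ?thesis unfolding p_def
      using vector_taylor_bound[of "5 - j" "\<lambda>k. t (k + j)" B x] d B by (simp add: algebra_simps)
  qed
  \<comment> \<open>Used for the pairs \<open>(j, i)\<close> equal to \<open>(0, 1)\<close>,
    \<open>(1, 0)\<close> and \<open>(3, 0)\<close>. In each of them \<open>5 - j + i\<close> is
    even, so the absolute moment in the remainder is an ordinary moment.\<close>
  have key: "norm ((\<integral>x. x ^ i *\<^sub>R t j x \<partial>\<mu>) - (\<Sum>k<5 - j. (m (k + i) / fact k) *\<^sub>R t (k + j) 0)) \<le> B * m (5 - j + i)"
    if j: "j < 5" and i: "i \<le> 1" and e: "even (5 - j + i)" and b: "\<And>s. norm (t j s) \<le> b" for i j
  proof -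
    have i1: "integrable \<mu> (\<lambda>x. x ^ i *\<^sub>R t j x)"
    proof (rule Bochner_Integration.integrable_bound[where f = "\<lambda>x. b * x ^ i"])
      show "AE x in \<mu>. norm (x ^ i *\<^sub>R t j x) \<le> norm (b * x ^ i)"
      proof (rule AE_I2)
        fix x
        have "norm (t j x) * \<bar>x ^ i\<bar> \<le> \<bar>b\<bar> * \<bar>x ^ i\<bar>" using b[of x] by (intro mult_right_mono) auto
        then show "norm (x ^ i *\<^sub>R t j x) \<le> norm (b * x ^ i)" by (simp add: abs_mult mult.commute)
      qed
      show "integrable \<mu> (\<lambda>x. b * x ^ i)" using ip[of i] i by simp
      show "(\<lambda>x. x ^ i *\<^sub>R t j x) \<in> borel_measurable \<mu>" using meas[OF j] by simp
    qed
    have eq: "x ^ i *\<^sub>R p j (5 - j) x = (\<Sum>k<5 - j. (x ^ (k + i) / fact k) *\<^sub>R t (k + j) 0)" for x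
      by (simp add: p_def scaleR_sum_right power_add mult.commute)
    have ik: "integrable \<mu> (\<lambda>x. (x ^ (k + i) / fact k) *\<^sub>R t (k + j) 0)" if "k < 5 - j" for k
      using ip[of "k + i"] i that by (intro integrable_scaleR_left integrable_divide) auto
    have Ik: "(\<integral>x. (x ^ (k + i) / fact k) *\<^sub>R t (k + j) 0 \<partial>\<mu>) = (m (k + i) / fact k) *\<^sub>R t (k + j) 0"
      if "k < 5 - j" for k
      using ip[of "k + i"] i that by (subst integral_scaleR_left) (auto simp: m_def)
    have i2: "integrable \<mu> (\<lambda>x. x ^ i *\<^sub>R p j (5 - j) x)"
      unfolding eq using ik by (intro Bochner_Integration.integrable_sum) auto
    have I2: "(\<integral>x. x ^ i *\<^sub>R p j (5 - j) x \<partial>\<mu>) = (\<Sum>k<5 - j. (m (k + i) / fact k) *\<^sub>R t (k + j) 0)"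
      unfolding eq using ik Ik by (subst Bochner_Integration.integral_sum) auto
    have le: "norm (x ^ i *\<^sub>R t j x - x ^ i *\<^sub>R p j (5 - j) x) \<le> B * x ^ (5 - j + i)" for x
    proof -
      have "norm (x ^ i *\<^sub>R t j x - x ^ i *\<^sub>R p j (5 - j) x) = \<bar>x\<bar> ^ i * norm (t j x - p j (5 - j) x)"
        by (metis norm_scaleR power_abs scaleR_right_diff_distrib)
      also have "\<dots> \<le> \<bar>x\<bar> ^ i * (B * \<bar>x\<bar> ^ (5 - j))" by (intro mult_left_mono tay j) auto
      also have "\<dots> = B * \<bar>x\<bar> ^ (5 - j + i)" by (simp add: power_add)
      also have "\<dots> = B * x ^ (5 - j + i)" using e by (simp add: power_even_abs)
      finally show ?thesis .
    qed
    have "norm ((\<integral>x. x ^ i *\<^sub>R t j x \<partial>\<mu>) - (\<integral>x. x ^ i *\<^sub>R p j (5 - j) x \<partial>\<mu>))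
        = norm (\<integral>x. x ^ i *\<^sub>R t j x - x ^ i *\<^sub>R p j (5 - j) x \<partial>\<mu>)"
      by (subst Bochner_Integration.integral_diff[OF i1 i2]) rule
    also have "\<dots> \<le> (\<integral>x. norm (x ^ i *\<^sub>R t j x - x ^ i *\<^sub>R p j (5 - j) x) \<partial>\<mu>)" by (rule integral_norm_bound)
    also have "\<dots> \<le> (\<integral>x. B * x ^ (5 - j + i) \<partial>\<mu>)"
    proof (rule integral_mono[OF _ _ le])
      show "integrable \<mu> (\<lambda>x. norm (x ^ i *\<^sub>R t j x - x ^ i *\<^sub>R p j (5 - j) x))"
        by (intro Bochner_Integration.integrable_norm Bochner_Integration.integrable_diff i1 i2)
      show "integrable \<mu> (\<lambda>x. B * x ^ (5 - j + i))"
        using ip[of "5 - j + i"] i by simp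
    qed
    finally show ?thesis unfolding I2 by (simp add: m_def)
  qed
  have sets: "{..<5::nat} = {0, 1, 2, 3, 4}" "{..<4::nat} = {0, 1, 2, 3}" "{..<2::nat} = {0, 1}" by auto
  have k0: "norm ((\<integral>x. x *\<^sub>R t 0 x \<partial>\<mu>) - (m 2 *\<^sub>R t 1 0 + (m 4 / 6) *\<^sub>R t 3 0)) \<le> B * m 6"
  proof -
    have "(\<Sum>k<5. (m (k + 1) / fact k) *\<^sub>R t (k + 0) 0) = m 2 *\<^sub>R t 1 0 + (m 4 / 6) *\<^sub>R t 3 0"
      using m_odd[of 1] m_odd[of 3] m_odd[of 5]
      unfolding sets by (simp add: fact_numeral flip: numeral_2_eq_2)
    then show ?thesis using key[of 0 1] bd by simp
  qed
  have k1: "norm ((\<integral>x. t 1 x \<partial>\<mu>) - (t 1 0 + (m 2 / 2) *\<^sub>R t 3 0)) \<le> B * m 4"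
  proof -
    have "(\<Sum>k<4. (m (k + 0) / fact k) *\<^sub>R t (k + 1) 0) = t 1 0 + (m 2 / 2) *\<^sub>R t 3 0"
      using m_odd[of 1] m_odd[of 3] m0
      unfolding sets by (simp add: fact_numeral flip: numeral_2_eq_2)
    then show ?thesis using key[of 1 0] bd by simp
  qed
  have k3: "norm ((\<integral>x. t 3 x \<partial>\<mu>) - t 3 0) \<le> B * m 2"
  proof -
    have "(\<Sum>k<2. (m (k + 0) / fact k) *\<^sub>R t (k + 3) 0) = t 3 0"
      using m_odd[of 1] m0
      unfolding sets by simp
    then show ?thesis using key[of 3 0] bd by simp
  qed
  let ?X = "\<integral>x. x *\<^sub>R t 0 x \<partial>\<mu>" and ?Y = "\<integral>x. t 1 x \<partial>\<mu>" and ?Z = "\<integral>x. t 3 x \<partial>\<mu>"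
  let ?k = "cumulant \<mu> 4"
  \<comment> \<open>The coefficients of \<open>t 3 0\<close> cancel because
    \<open>m 2 * m 2 / 2 + cumulant \<mu> 4 / 6 = m 4 / 6\<close>. This is where the fourth cumulant
    replaces the fourth moment.\<close>
  have "?X - (m 2 *\<^sub>R ?Y + (?k / 6) *\<^sub>R ?Z) = (?X - (m 2 *\<^sub>R t 1 0 + (m 4 / 6) *\<^sub>R t 3 0))
      - (m 2 *\<^sub>R (?Y - (t 1 0 + (m 2 / 2) *\<^sub>R t 3 0)) + (?k / 6) *\<^sub>R (?Z - t 3 0))"
    unfolding k4 by (simp add: scaleR_conv_of_real field_simps power2_eq_square)
  also have "norm \<dots> \<le> B * m 6 + (m 2 * (B * m 4) + \<bar>?k\<bar> / 6 * (B * m 2))"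
  proof -
    have tri: "norm (u - (v + w)) \<le> a + (b + c)" if "norm u \<le> a" "norm v \<le> b" "norm w \<le> c"
      for u v w :: complex and a b c
      using that by (meson norm_triangle_ineq norm_triangle_ineq4 add_mono order_trans)
    show ?thesis
  proof (rule tri[OF k0])
    show "norm (m 2 *\<^sub>R (?Y - (t 1 0 + (m 2 / 2) *\<^sub>R t 3 0))) \<le> m 2 * (B * m 4)"
      using k1 m2 by (auto intro!: mult_left_mono)
    show "norm ((?k / 6) *\<^sub>R (?Z - t 3 0)) \<le> \<bar>?k\<bar> / 6 * (B * m 2)"
      using mult_left_mono[OF k3, of "\<bar>?k\<bar> / 6"] by simp
  qed
  qed
  also have "\<bar>?k\<bar> / 6 * (B * m 2) \<le> \<bar>?k\<bar> * (B * m 2)" using B0 m2 by (intro mult_right_mono) auto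
  finally show ?thesis unfolding m2 by (simp add: expansion_const_def m_def[symmetric] algebra_simps)
qed

section \<open>Poincare inequality for product measures\<close>

locale iid_product = prob_space \<mu> for \<mu> :: "'b measure" +
  fixes I :: "'i set"
  assumes finite_I: "finite I"
begin

abbreviation law where "law J \<equiv> Pi\<^sub>M J (\<lambda>_::'i. \<mu>)"

sublocale prod: product_sigma_finite "\<lambda>_::'i. \<mu>" by unfold_locales

lemma prob_space_law: "prob_space (law J)"
  by (intro prob_space_PiM prob_space_axioms)

lemma measurable_upd:
  assumes "p \<in> J"
  shows "(\<lambda>(x, y). x(p := y)) \<in> measurable (law J \<Otimes>\<^sub>M \<mu>) (law J)"
  using measurable_add_dim[of p J "\<lambda>_. \<mu>"] assms by (simp add: insert_absorb)

lemma measurable_upd_insert: "y \<in> space \<mu> \<Longrightarrow> (\<lambda>x. x(p := y)) \<in> measurable (law J) (law (insert p J))"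
proof -
  assume "y \<in> space \<mu>"
  then have "(\<lambda>x. (x, y)) \<in> measurable (law J) (law J \<Otimes>\<^sub>M \<mu>)" by simp
  from measurable_compose[OF this measurable_add_dim] show ?thesis by simp
qed

text \<open>Fubini with the new coordinate outermost, as needed when conditioning on it.
  Integrability of both partial integrals is recorded because the tensorization compares them under
  the outer integral.\<close>

lemma integral_insert_rev:
  fixes f :: "('i \<Rightarrow> 'b) \<Rightarrow> 'c::{banach, second_countable_topology}"
  assumes "finite J" "p \<notin> J" "integrable (law (insert p J)) f"
  shows "(\<integral>x. f x \<partial>law (insert p J)) = (\<integral>y. (\<integral>x. f (x(p := y)) \<partial>law J) \<partial>\<mu>)"
    and "integrable \<mu> (\<lambda>y. \<integral>x. f (x(p := y)) \<partial>law J)"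
    and "integrable (law J) (\<lambda>x. \<integral>y. f (x(p := y)) \<partial>\<mu>)"
proof -
  interpret J: prob_space "law J" by (rule prob_space_law)
  interpret pr: pair_prob_space "law J" \<mu> by unfold_locales
  have m: "f \<in> borel_measurable (law (insert p J))" using assms(3) by simp
  have i': "integrable (law J \<Otimes>\<^sub>M \<mu>) (\<lambda>(x, y). f (x(p := y)))"
  proof (rule integrableI_bounded)
    have mm: "(\<lambda>(x, y). f (x(p := y))) \<in> borel_measurable (law J \<Otimes>\<^sub>M \<mu>)"
      using measurable_compose[OF measurable_add_dim m] by (simp add: case_prod_beta)
    then show "(\<lambda>(x, y). f (x(p := y))) \<in> borel_measurable (law J \<Otimes>\<^sub>M \<mu>)" .
    have "(\<integral>\<^sup>+ z. ennreal (norm (case z of (x, y) \<Rightarrow> f (x(p := y)))) \<partial>(law J \<Otimes>\<^sub>M \<mu>))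
        = (\<integral>\<^sup>+ x. (\<integral>\<^sup>+ y. ennreal (norm (f (x(p := y)))) \<partial>\<mu>) \<partial>law J)"
      using nn_integral_fst[of "\<lambda>z. ennreal (norm (case z of (x, y) \<Rightarrow> f (x(p := y))))" "law J"] mm by simp
    also have "\<dots> = (\<integral>\<^sup>+ x. ennreal (norm (f x)) \<partial>law (insert p J))"
      using assms m by (subst prod.product_nn_integral_insert) auto
    also have "\<dots> < \<infinity>" using assms(3) by (simp add: integrable_iff_bounded)
    finally show "(\<integral>\<^sup>+ z. ennreal (norm (case z of (x, y) \<Rightarrow> f (x(p := y)))) \<partial>(law J \<Otimes>\<^sub>M \<mu>)) < \<infinity>" .
  qed
  have "(\<integral>x. f x \<partial>law (insert p J)) = (\<integral>x. (\<integral>y. f (x(p := y)) \<partial>\<mu>) \<partial>law J)"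
    by (rule prod.product_integral_insert) fact+
  also have "\<dots> = (\<integral>y. (\<integral>x. f (x(p := y)) \<partial>law J) \<partial>\<mu>)"
    by (rule pr.Fubini_integral[OF i', symmetric])
  finally show "(\<integral>x. f x \<partial>law (insert p J)) = (\<integral>y. (\<integral>x. f (x(p := y)) \<partial>law J) \<partial>\<mu>)" .
  show "integrable \<mu> (\<lambda>y. \<integral>x. f (x(p := y)) \<partial>law J)"
    using i' by (rule pr.integrable_snd)
  show "integrable (law J) (\<lambda>x. \<integral>y. f (x(p := y)) \<partial>\<mu>)"
    using i' by (rule pr.integrable_fst)
qed

text \<open>The inner integral overwrites coordinate \<open>p\<close>, hence factors through the
  restriction to the other coordinates, whose law is again a product. This allows a one-variable
  statement to be applied with all other coordinates frozen and then averaged.\<close>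

lemma integral_resample:
  fixes f :: "('i \<Rightarrow> 'b) \<Rightarrow> 'c::{banach, second_countable_topology}"
  assumes p: "p \<in> I" and f: "integrable (law I) f"
  shows "(\<integral>x. f x \<partial>law I) = (\<integral>x. (\<integral>y. f (x(p := y)) \<partial>\<mu>) \<partial>law I)"
    and "integrable (law I) (\<lambda>x. \<integral>y. f (x(p := y)) \<partial>\<mu>)"
proof -
  define J where "J = I - {p}"
  have J: "I = insert p J" "p \<notin> J" "finite J" "J \<subseteq> I" using p finite_I by (auto simp: J_def)
  let ?h = "\<lambda>x. \<integral>y. f (x(p := y)) \<partial>\<mu>"
  have h: "?h x = ?h (restrict x J)" if "x \<in> space (law I)" for x
  proof -
    have "x(p := y) = (restrict x J)(p := y)" for y
      using that J by (auto simp: space_PiM PiE_def extensional_def fun_eq_iff)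
    then show ?thesis by simp
  qed
  have ih: "integrable (law J) ?h"
    using integral_insert_rev(3)[of J p f] J f by simp
  have d: "law J = distr (law I) (law J) (\<lambda>x. restrict x J)"
  proof -
    interpret R: product_prob_space "\<lambda>_::'i. \<mu>" I by unfold_locales
    show ?thesis using R.distr_PiM_restrict_finite[of J] J by simp
  qed
  have m: "(\<lambda>x. restrict x J) \<in> measurable (law I) (law J)"
    using J by (intro measurable_restrict_subset) auto
  have "(\<integral>x. f x \<partial>law I) = (\<integral>x. ?h x \<partial>law J)"
    using prod.product_integral_insert[of J p f] J f by simp
  also have "\<dots> = (\<integral>x. ?h x \<partial>distr (law I) (law J) (\<lambda>x. restrict x J))" using d by simp
  also have "\<dots> = (\<integral>x. ?h (restrict x J) \<partial>law I)"
    using ih by (intro integral_distr m) auto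
  also have "\<dots> = (\<integral>x. ?h x \<partial>law I)" by (intro Bochner_Integration.integral_cong refl h[symmetric])
  finally show "(\<integral>x. f x \<partial>law I) = (\<integral>x. ?h x \<partial>law I)" .
  have "integrable (law I) (\<lambda>x. ?h (restrict x J))"
    by (rule integrable_distr[OF m]) (subst d[symmetric], rule ih)
  then show "integrable (law I) ?h"
    using Bochner_Integration.integrable_cong[OF refl h, of "law I"] by simp
qed

lemma integrable_law_bounded:
  fixes f :: "('i \<Rightarrow> 'b) \<Rightarrow> 'c::{banach, second_countable_topology}"
  assumes "f \<in> borel_measurable (law J)" "\<And>x. norm (f x) \<le> b"
  shows "integrable (law J) f"
proof -
  interpret J: prob_space "law J" by (rule prob_space_law)
  show ?thesis using assms by (intro J.integrable_const_bound[where B = b]) auto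
qed

end

lemma sq_norm_bound: "norm (x :: complex) \<le> b \<Longrightarrow> norm ((norm x)\<^sup>2) \<le> b\<^sup>2"
  by (simp add: power_mono)

lemma (in prob_space) sq_norm_integral_le:
  fixes f :: "'a \<Rightarrow> complex"
  assumes "f \<in> borel_measurable M" "integrable M (\<lambda>x. (norm (f x))\<^sup>2)"
  shows "(norm (\<integral>x. f x \<partial>M))\<^sup>2 \<le> (\<integral>x. (norm (f x))\<^sup>2 \<partial>M)"
proof -
  have "0 \<le> (\<integral>x. (norm (f x - (\<integral>y. f y \<partial>M)))\<^sup>2 \<partial>M)" by (intro Bochner_Integration.integral_nonneg) auto
  then show ?thesis using variance_complex(1)[OF assms] by simp
qed

text \<open>The variance of \<open>f\<close> splits into the mean of its variance in the variables of \<open>J\<close> and the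
  variance in the variable \<open>q\<close> of its mean over \<open>J\<close>; by Jensen's inequality the latter is at most
  the mean over \<open>J\<close> of the variance in \<open>q\<close>.\<close>

lemma poincare_product:
  fixes f :: "('i \<Rightarrow> real) \<Rightarrow> complex" and f' :: "'i \<Rightarrow> ('i \<Rightarrow> real) \<Rightarrow> complex"
  assumes \<mu>: "real_distribution \<mu>" and C: "variance_bound \<mu> C"
    and "finite J"
    and "f \<in> borel_measurable (Pi\<^sub>M J (\<lambda>_. \<mu>))" "\<And>p. p \<in> J \<Longrightarrow> f' p \<in> borel_measurable (Pi\<^sub>M J (\<lambda>_. \<mu>))"
    and "\<And>x. norm (f x) \<le> b" "\<And>p x. p \<in> J \<Longrightarrow> norm (f' p x) \<le> b"
    and "\<And>p x s. p \<in> J \<Longrightarrow> ((\<lambda>s. f (x(p := s))) has_vector_derivative f' p (x(p := s))) (at s)"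
    and "\<And>p x. p \<in> J \<Longrightarrow> continuous_on UNIV (\<lambda>s. f' p (x(p := s)))"
  shows "(\<integral>x. (norm (f x))\<^sup>2 \<partial>Pi\<^sub>M J (\<lambda>_. \<mu>)) - (norm (\<integral>x. f x \<partial>Pi\<^sub>M J (\<lambda>_. \<mu>)))\<^sup>2
     \<le> C * (\<Sum>p\<in>J. \<integral>x. (norm (f' p x))\<^sup>2 \<partial>Pi\<^sub>M J (\<lambda>_. \<mu>))"
  using assms(3-)
proof (induction J arbitrary: f f' rule: finite_induct)
  case empty
  interpret real_distribution \<mu> by fact
  interpret iid_product \<mu> "{}" by unfold_locales simp
  interpret L: prob_space "law {}" by (rule prob_space_law)
  have "(\<integral>x. (norm (f x))\<^sup>2 \<partial>law {}) = (norm (f (\<lambda>k. undefined)))\<^sup>2" "(\<integral>x. f x \<partial>law {}) = f (\<lambda>k. undefined)"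
    by (simp_all add: PiM_empty lebesgue_integral_count_space_finite)
  then show ?case by simp
next
  case (insert q J)
  interpret real_distribution \<mu> by fact
  interpret iid_product \<mu> "insert q J" using insert.hyps by unfold_locales simp
  let ?P = "law (insert q J)" and ?Q = "law J"
  interpret P: prob_space ?P by (rule prob_space_law)
  interpret Q: prob_space ?Q by (rule prob_space_law)
  note fm = insert.prems(1) and f'm = insert.prems(2)
    and fb = insert.prems(3) and f'b = insert.prems(4) and fd = insert.prems(5) and f'c = insert.prems(6)
  note J = insert.hyps(1,2)
  note ins = prod.product_integral_insert[OF J] integral_insert_rev[OF J]
  have b0: "0 \<le> b" using fb[of undefined] norm_ge_zero order_trans by blast
  have f2: "integrable ?P (\<lambda>x. (norm (f x))\<^sup>2)"
    using fm fb by (intro integrable_law_bounded[where b = "b\<^sup>2"] sq_norm_bound) auto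
  have f1: "integrable ?P f" using fm fb by (rule integrable_law_bounded)
  have f'2: "integrable ?P (\<lambda>x. (norm (f' p x))\<^sup>2)" if "p \<in> insert q J" for p
    using f'm[OF that] f'b[OF that] by (intro integrable_law_bounded[where b = "b\<^sup>2"] sq_norm_bound) auto
  have borel_mono: "g \<in> borel_measurable borel \<Longrightarrow> g \<in> borel_measurable \<mu>" for g :: "real \<Rightarrow> complex" by simp
  have upm: "(\<lambda>x. x(q := y)) \<in> measurable ?Q ?P" for y
    using measurable_upd_insert[of y q J] by simp
  define h where "h y = (\<integral>x. f (x(q := y)) \<partial>?Q)" for y
  define k where "k x = (\<integral>y. f (x(q := y)) \<partial>\<mu>)" for x :: "'i \<Rightarrow> real"
  have kq: "k (x(q := y)) = k x" for x y by (simp add: k_def)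
  have kb: "norm (k x) \<le> b" for x unfolding k_def by (rule norm_integral_le_const) (use fb b0 in auto)
  have hb: "norm (h x) \<le> b" for x unfolding h_def by (rule Q.norm_integral_le_const) (use fb b0 in auto)
  have mP: "(\<lambda>(x, y). f (x(q := y))) \<in> borel_measurable (?P \<Otimes>\<^sub>M \<mu>)"
    using measurable_compose[OF measurable_upd[of q "insert q J"] fm] unfolding case_prod_unfold by blast
  have km: "k \<in> borel_measurable ?P"
    unfolding k_def by (rule borel_measurable_lebesgue_integral) (rule mP)
  have i\<phi>: "integrable ?P (\<lambda>x. (norm (f x - k x))\<^sup>2)"
  proof (rule integrable_law_bounded[where b = "(b + b)\<^sup>2"], goal_cases)
    case (2 x)
    show ?case using norm_triangle_le_diff[OF add_mono[OF fb[of x] kb[of x]]] by (rule sq_norm_bound)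
  qed (use fm km in simp)
  have hm: "h \<in> borel_measurable \<mu>" using ins(3)[OF f1] by (simp add: h_def[abs_def])
  have hi: "integrable \<mu> (\<lambda>y. (norm (h y))\<^sup>2)"
    using hm hb by (intro integrable_const_bound[where B = "b\<^sup>2"]) (auto simp: sq_norm_bound power_mono)
  have IH: "(\<integral>x. (norm (f (x(q := y))))\<^sup>2 \<partial>?Q) - (norm (h y))\<^sup>2 \<le> C * (\<Sum>p\<in>J. \<integral>x. (norm (f' p (x(q := y))))\<^sup>2 \<partial>?Q)" for y
    unfolding h_def
  proof (rule insert.IH[of "\<lambda>x. f (x(q := y))" "\<lambda>p x. f' p (x(q := y))"])
    show "(\<lambda>x. f (x(q := y))) \<in> borel_measurable ?Q" using measurable_compose[OF upm fm] .
    fix p assume p: "p \<in> J"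
    then have pq: "p \<noteq> q" using J by auto
    have sw: "x(p := s, q := y) = x(q := y, p := s)" for x :: "'i \<Rightarrow> real" and s using pq by (rule fun_upd_twist)
    show "(\<lambda>x. f' p (x(q := y))) \<in> borel_measurable ?Q" by (rule measurable_compose[OF upm f'm[OF insertI2[OF p]]])
    show "norm (f' p (x(q := y))) \<le> b" for x using f'b p by simp
    show "((\<lambda>s. f (x(p := s, q := y))) has_vector_derivative f' p (x(p := s, q := y))) (at s)" for x s
      unfolding sw by (rule fd[OF insertI2[OF p]])
    show "continuous_on UNIV (\<lambda>s. f' p (x(p := s, q := y)))" for x
      unfolding sw by (rule f'c[OF insertI2[OF p]])
  qed (use fb in auto)
  have Var1: "(\<integral>x. (norm (f x))\<^sup>2 \<partial>?P) - (\<integral>y. (norm (h y))\<^sup>2 \<partial>\<mu>) \<le> C * (\<Sum>p\<in>J. \<integral>x. (norm (f' p x))\<^sup>2 \<partial>?P)"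
  proof -
    have i': "integrable \<mu> (\<lambda>y. \<integral>x. (norm (f' p (x(q := y))))\<^sup>2 \<partial>?Q)" if "p \<in> J" for p
      using ins(3)[OF f'2[of p]] that by simp
    have "(\<integral>x. (norm (f x))\<^sup>2 \<partial>?P) - (\<integral>y. (norm (h y))\<^sup>2 \<partial>\<mu>)
        = (\<integral>y. (\<integral>x. (norm (f (x(q := y))))\<^sup>2 \<partial>?Q) - (norm (h y))\<^sup>2 \<partial>\<mu>)"
      unfolding ins(2)[OF f2] using ins(3)[OF f2] hi by simp
    also have "\<dots> \<le> (\<integral>y. C * (\<Sum>p\<in>J. \<integral>x. (norm (f' p (x(q := y))))\<^sup>2 \<partial>?Q) \<partial>\<mu>)"
      using ins(3)[OF f2] hi i' IH
      by (intro integral_mono) (auto intro!: integrable_mult_right Bochner_Integration.integrable_sum)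
    also have "\<dots> = C * (\<Sum>p\<in>J. \<integral>y. (\<integral>x. (norm (f' p (x(q := y))))\<^sup>2 \<partial>?Q) \<partial>\<mu>)"
      using i' by (simp add: Bochner_Integration.integral_sum)
    also have "\<dots> = C * (\<Sum>p\<in>J. \<integral>x. (norm (f' p x))\<^sup>2 \<partial>?P)"
      using ins(2)[OF f'2] by (intro arg_cong[where f = "\<lambda>x. C * x"] sum.cong) auto
    finally show ?thesis .
  qed
  have hint: "(\<integral>y. h y \<partial>\<mu>) = (\<integral>x. f x \<partial>?P)" unfolding h_def using ins(2)[OF f1] by simp
  have kint: "(\<integral>x. k x \<partial>?Q) = (\<integral>x. f x \<partial>?P)" unfolding k_def using ins(1)[OF f1] by simp
  have ki: "integrable ?Q k" using ins(4)[OF f1] by (simp add: k_def[abs_def])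
  have fy: "integrable ?Q (\<lambda>x. f (x(q := y)))" for y
    using measurable_compose[OF upm fm] fb by (intro integrable_law_bounded)
  have Var2: "(\<integral>y. (norm (h y))\<^sup>2 \<partial>\<mu>) - (norm (\<integral>y. h y \<partial>\<mu>))\<^sup>2 \<le> C * (\<integral>x. (norm (f' q x))\<^sup>2 \<partial>?P)"
  proof -
    have "(\<integral>y. (norm (h y))\<^sup>2 \<partial>\<mu>) - (norm (\<integral>y. h y \<partial>\<mu>))\<^sup>2 = (\<integral>y. (norm (h y - (\<integral>y. h y \<partial>\<mu>)))\<^sup>2 \<partial>\<mu>)"
      using variance_complex(1)[OF hm hi] by simp
    also have "\<dots> \<le> (\<integral>y. (\<integral>x. (norm (f (x(q := y)) - k (x(q := y))))\<^sup>2 \<partial>?Q) \<partial>\<mu>)"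
    proof (rule integral_mono)
      show "integrable \<mu> (\<lambda>y. (norm (h y - (\<integral>y. h y \<partial>\<mu>)))\<^sup>2)" by (rule variance_complex(2)[OF hm hi])
      show "integrable \<mu> (\<lambda>y. \<integral>x. (norm (f (x(q := y)) - k (x(q := y))))\<^sup>2 \<partial>?Q)" by (rule ins(3)[OF i\<phi>])
      fix y
      \<comment> \<open>Averaging \<open>k\<close> over \<open>J\<close> gives the full mean of
        \<open>f\<close>, so the centred \<open>h\<close> is itself a mean over \<open>J\<close> and
        Jensen's inequality applies to it.\<close>
      have e: "h y - (\<integral>y. h y \<partial>\<mu>) = (\<integral>x. f (x(q := y)) - k (x(q := y)) \<partial>?Q)"
        unfolding kq using fy[of y] ki by (simp add: h_def kint hint[symmetric])
      show "(norm (h y - (\<integral>y. h y \<partial>\<mu>)))\<^sup>2 \<le> (\<integral>x. (norm (f (x(q := y)) - k (x(q := y))))\<^sup>2 \<partial>?Q)"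
        unfolding e
      proof (rule Q.sq_norm_integral_le)
        have "(\<lambda>x. f x - k x) \<in> borel_measurable ?P" using fm km by simp
        from measurable_compose[OF upm this]
        show m: "(\<lambda>x. f (x(q := y)) - k (x(q := y))) \<in> borel_measurable ?Q" .
        show "integrable ?Q (\<lambda>x. (norm (f (x(q := y)) - k (x(q := y))))\<^sup>2)"
        proof (rule integrable_law_bounded[where b = "(b + b)\<^sup>2"], goal_cases)
          case (2 x)
          show ?case using norm_triangle_le_diff[OF add_mono[OF fb[of "x(q := y)"] kb[of "x(q := y)"]]] by (rule sq_norm_bound)
        qed (use m in simp)
      qed
    qed
    also have "\<dots> = (\<integral>x. (\<integral>y. (norm (f (x(q := y)) - k (x(q := y))))\<^sup>2 \<partial>\<mu>) \<partial>?Q)"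
      using ins(1)[OF i\<phi>] ins(2)[OF i\<phi>] by simp
    also have "\<dots> \<le> (\<integral>x. C * (\<integral>y. (norm (f' q (x(q := y))))\<^sup>2 \<partial>\<mu>) \<partial>?Q)"
    proof (rule integral_mono)
      show "integrable ?Q (\<lambda>x. \<integral>y. (norm (f (x(q := y)) - k (x(q := y))))\<^sup>2 \<partial>\<mu>)" by (rule ins(4)[OF i\<phi>])
      show "integrable ?Q (\<lambda>x. C * (\<integral>y. (norm (f' q (x(q := y))))\<^sup>2 \<partial>\<mu>))"
        using ins(4)[OF f'2[of q]] by simp
      fix x
      have cf: "continuous_on UNIV (\<lambda>s. f (x(q := s)))"
        using fd[of q x] by (meson continuous_at_imp_continuous_on has_vector_derivative_continuous insertI1)
      have mf: "(\<lambda>s. f (x(q := s))) \<in> borel_measurable \<mu>"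
        by (rule borel_mono[OF borel_measurable_continuous_onI[OF cf]])
      have mf': "(\<lambda>s. f' q (x(q := s))) \<in> borel_measurable \<mu>"
        by (rule borel_mono[OF borel_measurable_continuous_onI[OF f'c[OF insertI1]]])
      have i1: "integrable \<mu> (\<lambda>s. (norm (f (x(q := s))))\<^sup>2)"
        using mf fb by (intro integrable_const_bound[where B = "b\<^sup>2"]) (auto simp: power_mono)
      have i2: "integrable \<mu> (\<lambda>s. (norm (f' q (x(q := s))))\<^sup>2)"
        using mf' f'b[of q] by (intro integrable_const_bound[where B = "b\<^sup>2"]) (auto simp: power_mono)
      have "(\<integral>y. (norm (f (x(q := y)) - k (x(q := y))))\<^sup>2 \<partial>\<mu>)
          = (\<integral>y. (norm (f (x(q := y))))\<^sup>2 \<partial>\<mu>) - (norm (k x))\<^sup>2"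
        unfolding kq using variance_complex(1)[OF mf i1] by (simp only: k_def)
      also have "\<dots> \<le> C * (\<integral>y. (norm (f' q (x(q := y))))\<^sup>2 \<partial>\<mu>)"
        unfolding k_def by (rule variance_boundD[OF C fd[OF insertI1] f'c[OF insertI1] i1 i2])
      finally show "(\<integral>y. (norm (f (x(q := y)) - k (x(q := y))))\<^sup>2 \<partial>\<mu>) \<le> C * (\<integral>y. (norm (f' q (x(q := y))))\<^sup>2 \<partial>\<mu>)" .
    qed
    also have "\<dots> = C * (\<integral>x. (norm (f' q x))\<^sup>2 \<partial>?P)"
      using ins(1)[OF f'2[of q]] by simp
    finally show ?thesis .
  qed
  show ?case using Var1 Var2 J unfolding hint by (simp add: distrib_left)
qed

section \<open>Resolvents of Hermitian matrices\<close>

text \<open>Matrices of size \<open>n\<close> are functions on all pairs of indices, of which only the values below \<open>n\<close>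
  matter; the product is then associative without any condition on carriers.\<close>

definition mm :: "nat \<Rightarrow> (nat \<Rightarrow> nat \<Rightarrow> complex) \<Rightarrow> (nat \<Rightarrow> nat \<Rightarrow> complex) \<Rightarrow> nat \<Rightarrow> nat \<Rightarrow> complex" where
  "mm n A B = (\<lambda>i j. \<Sum>k<n. A i k * B k j)"

definition tr :: "nat \<Rightarrow> (nat \<Rightarrow> nat \<Rightarrow> complex) \<Rightarrow> complex" where
  "tr n A = (\<Sum>i<n. A i i)"

definition vnorm :: "nat \<Rightarrow> (nat \<Rightarrow> complex) \<Rightarrow> real" where
  "vnorm n u = L2_set (\<lambda>i. norm (u i)) {..<n}"

text \<open>The form is bilinear, without conjugation. Since \<open>vnorm\<close> is invariant under
  conjugation this is the usual operator norm bound, and it passes to the transpose at once.\<close>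

definition op_bounded :: "nat \<Rightarrow> real \<Rightarrow> (nat \<Rightarrow> nat \<Rightarrow> complex) \<Rightarrow> bool" where
  "op_bounded n K A \<longleftrightarrow> (\<forall>u v. norm (\<Sum>i<n. \<Sum>j<n. v i * A i j * u j) \<le> K * vnorm n v * vnorm n u)"

definition herm :: "nat \<Rightarrow> (nat \<Rightarrow> nat \<Rightarrow> complex) \<Rightarrow> bool" where
  "herm n H \<longleftrightarrow> (\<forall>i<n. \<forall>j<n. H j i = cnj (H i j))"

definition shifted :: "nat \<Rightarrow> (nat \<Rightarrow> nat \<Rightarrow> complex) \<Rightarrow> complex \<Rightarrow> complex mat" where
  "shifted n H z = mat n n (\<lambda>(i, j). (if i = j then z else 0) - H i j)"

text \<open>Cramer's rule makes the measurability in \<open>H\<close> obvious. The value 0 outside the index range makes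
  identities between entries hold for all indices.\<close>

definition res :: "nat \<Rightarrow> (nat \<Rightarrow> nat \<Rightarrow> complex) \<Rightarrow> complex \<Rightarrow> nat \<Rightarrow> nat \<Rightarrow> complex" where
  "res n H z = (\<lambda>i j. if i < n \<and> j < n
     then adj_mat (shifted n H z) $$ (i, j) / det (shifted n H z) else 0)"

lemma mm_assoc: "mm n (mm n A B) C = mm n A (mm n B C)"
proof (intro ext)
  fix i j
  have "mm n (mm n A B) C i j = (\<Sum>k<n. \<Sum>l<n. A i l * B l k * C k j)"
    by (simp add: mm_def sum_distrib_right)
  also have "\<dots> = (\<Sum>l<n. \<Sum>k<n. A i l * B l k * C k j)" by (rule sum.swap)
  also have "\<dots> = mm n A (mm n B C) i j" by (simp add: mm_def sum_distrib_left mult.assoc)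
  finally show "mm n (mm n A B) C i j = mm n A (mm n B C) i j" .
qed

lemma tr_mm_commute: "tr n (mm n A B) = tr n (mm n B A)"
  unfolding tr_def mm_def by (subst sum.swap) (simp add: mult.commute)

lemma vnorm_nonneg [simp]: "0 \<le> vnorm n u"
  by (simp add: vnorm_def L2_set_nonneg)

lemma vnorm_sq: "(vnorm n u)\<^sup>2 = (\<Sum>i<n. (norm (u i))\<^sup>2)"
  by (simp add: vnorm_def L2_set_def sum_nonneg)

lemma vnorm_sq_complex: "complex_of_real ((vnorm n u)\<^sup>2) = (\<Sum>i<n. cnj (u i) * u i)"
  unfolding vnorm_sq of_real_sum complex_norm_square by (simp add: mult.commute)

lemma vnorm_cnj [simp]: "vnorm n (\<lambda>i. cnj (u i)) = vnorm n u"
  by (simp add: vnorm_def)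

lemma vnorm_cauchy_schwarz: "(\<Sum>i<n. norm (u i) * norm (v i)) \<le> vnorm n u * vnorm n v"
  using L2_set_mult_ineq[of "\<lambda>i. norm (u i)" "\<lambda>i. norm (v i)" "{..<n}"] by (simp add: vnorm_def)

lemma norm_sum_le_vnorm: "norm (\<Sum>i<n. u i * v i) \<le> vnorm n u * vnorm n v"
  using vnorm_cauchy_schwarz[of u v n] by (intro order_trans[OF norm_sum]) (simp add: norm_mult)

lemma norm_le_vnorm: "i < n \<Longrightarrow> norm (u i) \<le> vnorm n u"
  unfolding vnorm_def by (rule member_le_L2_set) auto

lemma vnorm_scale: "vnorm n (\<lambda>i. c * u i) = norm c * vnorm n u"
  unfolding vnorm_def by (simp add: norm_mult L2_set_right_distrib)

lemma vnorm_unit: "j < n \<Longrightarrow> vnorm n (\<lambda>i. if i = j then c else 0) = norm c"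
proof -
  assume "j < n"
  then have "(vnorm n (\<lambda>i. if i = j then c else 0))\<^sup>2 = (norm c)\<^sup>2"
    unfolding vnorm_sq by (simp add: if_distrib[of norm] if_distrib[of "\<lambda>x. x\<^sup>2"] cong: if_cong)
  then show ?thesis by (rule power2_eq_imp_eq) auto
qed

lemma op_boundedI:
  assumes "\<And>u. vnorm n (\<lambda>i. \<Sum>j<n. A i j * u j) \<le> K * vnorm n u"
  shows "op_bounded n K A"
  unfolding op_bounded_def
proof (intro allI)
  fix u v
  have "norm (\<Sum>i<n. \<Sum>j<n. v i * A i j * u j) = norm (\<Sum>i<n. v i * (\<Sum>j<n. A i j * u j))"
    by (simp add: sum_distrib_left mult.assoc)
  also have "\<dots> \<le> vnorm n v * vnorm n (\<lambda>i. \<Sum>j<n. A i j * u j)" by (rule norm_sum_le_vnorm)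
  also have "\<dots> \<le> vnorm n v * (K * vnorm n u)" using assms by (intro mult_left_mono) auto
  finally show "norm (\<Sum>i<n. \<Sum>j<n. v i * A i j * u j) \<le> K * vnorm n v * vnorm n u"
    by (simp add: mult_ac)
qed

lemma vnorm_le_of_sq:
  assumes "(vnorm n y)\<^sup>2 \<le> c * vnorm n y" "0 \<le> c"
  shows "vnorm n y \<le> c"
proof (cases "vnorm n y = 0")
  case False
  then have "vnorm n y > 0" using vnorm_nonneg[of n y] by linarith
  then show ?thesis using assms by (simp add: power2_eq_square)
qed (use assms in simp)

lemma op_boundedD: "op_bounded n K A \<Longrightarrow> norm (\<Sum>i<n. \<Sum>j<n. v i * A i j * u j) \<le> K * vnorm n v * vnorm n u"
  by (simp add: op_bounded_def)

text \<open>Test the bilinear form with the conjugate of \<open>A u\<close> and cancel one factor of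
  its norm.\<close>

lemma op_bounded_apply:
  assumes "op_bounded n K A" "0 \<le> K"
  shows "vnorm n (\<lambda>i. \<Sum>j<n. A i j * u j) \<le> K * vnorm n u"
proof (rule vnorm_le_of_sq)
  let ?y = "\<lambda>i. \<Sum>j<n. A i j * u j"
  have "complex_of_real ((vnorm n ?y)\<^sup>2) = (\<Sum>i<n. cnj (?y i) * ?y i)"
    by (rule vnorm_sq_complex)
  also have "\<dots> = (\<Sum>i<n. \<Sum>j<n. cnj (?y i) * A i j * u j)"
    by (simp add: sum_distrib_left mult.assoc)
  finally have "norm (complex_of_real ((vnorm n ?y)\<^sup>2)) = norm (\<Sum>i<n. \<Sum>j<n. cnj (?y i) * A i j * u j)"
    by (rule arg_cong)
  then have "(vnorm n ?y)\<^sup>2 = norm (\<Sum>i<n. \<Sum>j<n. cnj (?y i) * A i j * u j)"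
    unfolding norm_of_real abs_power2 .
  also have "\<dots> \<le> K * vnorm n (\<lambda>i. cnj (?y i)) * vnorm n u"
    by (rule op_boundedD[OF assms(1)])
  finally show "(vnorm n ?y)\<^sup>2 \<le> K * vnorm n u * vnorm n ?y" unfolding vnorm_cnj by (simp add: mult_ac)
qed (use assms in simp)

lemma op_bounded_transpose: "op_bounded n K A \<Longrightarrow> op_bounded n K (\<lambda>i j. A j i)"
  unfolding op_bounded_def
proof (intro allI)
  fix u v
  assume "\<forall>u v. norm (\<Sum>i<n. \<Sum>j<n. v i * A i j * u j) \<le> K * vnorm n v * vnorm n u"
  then have "norm (\<Sum>i<n. \<Sum>j<n. u i * A i j * v j) \<le> K * vnorm n u * vnorm n v" by blast
  moreover have "(\<Sum>i<n. \<Sum>j<n. u i * A i j * v j) = (\<Sum>i<n. \<Sum>j<n. v i * A j i * u j)"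
    by (subst sum.swap) (simp add: mult_ac)
  ultimately show "norm (\<Sum>i<n. \<Sum>j<n. v i * A j i * u j) \<le> K * vnorm n v * vnorm n u"
    by (simp add: mult_ac)
qed

lemma op_bounded_apply_left:
  assumes "op_bounded n K A" "0 \<le> K"
  shows "vnorm n (\<lambda>j. \<Sum>i<n. u i * A i j) \<le> K * vnorm n u"
  using op_bounded_apply[OF op_bounded_transpose[OF assms(1)] assms(2), of u] by (simp add: mult.commute)

lemma op_bounded_col:
  assumes "op_bounded n K A" "0 \<le> K" "j < n"
  shows "vnorm n (\<lambda>i. A i j) \<le> K"
proof -
  have "(\<lambda>i. \<Sum>k<n. A i k * (if k = j then 1 else 0)) = (\<lambda>i. A i j)"
    using assms(3) by (simp add: if_distrib[of "\<lambda>x. _ * x"] cong: if_cong)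
  then show ?thesis
    using op_bounded_apply[OF assms(1,2), of "\<lambda>i. if i = j then 1 else 0"] vnorm_unit[OF assms(3), of 1] by simp
qed

lemma op_bounded_row:
  assumes "op_bounded n K A" "0 \<le> K" "i < n"
  shows "vnorm n (\<lambda>j. A i j) \<le> K"
  using op_bounded_col[OF op_bounded_transpose[OF assms(1)] assms(2,3)] .

lemma op_bounded_entry:
  assumes "op_bounded n K A" "0 \<le> K" "i < n" "j < n"
  shows "norm (A i j) \<le> K"
  using order_trans[OF norm_le_vnorm[OF assms(3), of "\<lambda>i. A i j"] op_bounded_col[OF assms(1,2,4)]] .

section \<open>Invertibility of \<open>z - H\<close> and the norm of its inverse\<close>

lemma herm_cnj: "herm n H \<Longrightarrow> i < n \<Longrightarrow> j < n \<Longrightarrow> cnj (H i j) = H j i"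
  unfolding herm_def by metis

text \<open>The quadratic form of a Hermitian matrix is real, so only \<open>z\<close> contributes
  to the imaginary part. The resolvent bound and the sign of its diagonal both come from
  this.\<close>

lemma herm_quadratic_form:
  assumes "herm n H"
  shows "Im (\<Sum>i<n. cnj (y i) * (z * y i - (\<Sum>j<n. H i j * y j))) = Im z * (vnorm n y)\<^sup>2"
proof -
  let ?u = "\<lambda>i. z * y i - (\<Sum>j<n. H i j * y j)"
  define q where "q = (\<Sum>i<n. \<Sum>j<n. cnj (y i) * H i j * y j)"
  have "cnj q = (\<Sum>i<n. \<Sum>j<n. y i * H j i * cnj (y j))"
    unfolding q_def using herm_cnj[OF assms] by simp
  also have "\<dots> = q" unfolding q_def by (subst sum.swap) (simp add: mult_ac)
  finally have "cnj q = q" .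
  then have "Im q = 0" by (simp add: complex_eq_iff)
  have "(\<Sum>i<n. cnj (y i) * ?u i) = z * (\<Sum>i<n. cnj (y i) * y i) - q"
    unfolding q_def sum_distrib_left sum_subtractf[symmetric]
    by (simp add: right_diff_distrib sum_distrib_left mult.assoc mult.left_commute[of _ z])
  also have "(\<Sum>i<n. cnj (y i) * y i) = complex_of_real ((vnorm n y)\<^sup>2)"
    by (rule vnorm_sq_complex[symmetric])
  finally show ?thesis using \<open>Im q = 0\<close> by simp
qed

text \<open>Cauchy-Schwarz applied to the quadratic form. It yields both invertibility and the norm
  bound without diagonalizing \<open>H\<close>.\<close>

lemma herm_energy:
  assumes "herm n H" "Im z > 0"
  shows "Im z * vnorm n y \<le> vnorm n (\<lambda>i. z * y i - (\<Sum>j<n. H i j * y j))"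
proof -
  let ?u = "\<lambda>i. z * y i - (\<Sum>j<n. H i j * y j)"
  have "Im z * (vnorm n y)\<^sup>2 = Im (\<Sum>i<n. cnj (y i) * ?u i)"
    by (rule herm_quadratic_form[OF assms(1), symmetric])
  also have "\<dots> \<le> norm (\<Sum>i<n. cnj (y i) * ?u i)" by (rule order_trans[OF abs_ge_self abs_Im_le_cmod])
  also have "\<dots> \<le> vnorm n y * vnorm n ?u" using norm_sum_le_vnorm[of "\<lambda>i. cnj (y i)" ?u n] by simp
  finally have "(vnorm n y)\<^sup>2 \<le> (vnorm n ?u / Im z) * vnorm n y"
    using assms(2) by (simp add: field_simps)
  then have "vnorm n y \<le> vnorm n ?u / Im z" using assms(2) by (intro vnorm_le_of_sq) auto
  then show ?thesis using assms(2) by (simp add: field_simps)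
qed

lemma shifted_carrier [simp]: "shifted n H z \<in> carrier_mat n n"
  by (simp add: shifted_def)

lemma shifted_index: "i < n \<Longrightarrow> j < n \<Longrightarrow> shifted n H z $$ (i, j) = (if i = j then z else 0) - H i j"
  by (simp add: shifted_def)

lemma mat_mult_index:
  assumes "A \<in> carrier_mat n n" "B \<in> carrier_mat n n" "i < n" "j < n"
  shows "(A * B) $$ (i, j) = (\<Sum>k<n. A $$ (i, k) * B $$ (k, j))"
  using assms by (auto simp: scalar_prod_def lessThan_atLeast0)

lemma det_shifted_nonzero:
  assumes "herm n H" "Im z > 0"
  shows "det (shifted n H z) \<noteq> 0"
proof
  assume "det (shifted n H z) = 0"
  then obtain v where v: "v \<in> carrier_vec n" "v \<noteq> 0\<^sub>v n" "shifted n H z *\<^sub>v v = 0\<^sub>v n"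
    using det_0_iff_vec_prod_zero_field[OF shifted_carrier] by blast
  have "z * v $ i - (\<Sum>j<n. H i j * v $ j) = 0" if i: "i < n" for i
  proof -
    have "0 = (shifted n H z *\<^sub>v v) $ i" using v(3) i by simp
    also have "\<dots> = (\<Sum>j<n. ((if i = j then z else 0) - H i j) * v $ j)"
      using i v(1) by (auto simp: shifted_def scalar_prod_def lessThan_atLeast0)
    also have "\<dots> = z * v $ i - (\<Sum>j<n. H i j * v $ j)"
      using i by (simp add: left_diff_distrib sum_subtractf if_distrib[of "\<lambda>x. x * _"] cong: if_cong)
    finally show ?thesis by simp
  qed
  then have "vnorm n (\<lambda>i. z * v $ i - (\<Sum>j<n. H i j * v $ j)) = 0"
    by (simp add: vnorm_def L2_set_def)
  with herm_energy[OF assms, of "\<lambda>i. v $ i"] assms(2) have "vnorm n (\<lambda>i. v $ i) \<le> 0"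
    by (simp add: mult_le_0_iff)
  then have "v $ i = 0" if "i < n" for i
    using norm_le_vnorm[OF that, of "\<lambda>i. v $ i"] by (metis norm_le_zero_iff order_trans)
  then have "v = 0\<^sub>v n" using v(1) by auto
  with v(2) show False by contradiction
qed

lemma
  assumes "herm n H" "Im z > 0" "i < n" "j < n"
  shows res_right: "(\<Sum>k<n. ((if i = k then z else 0) - H i k) * res n H z k j) = (if i = j then 1 else 0)"
    and res_left: "(\<Sum>k<n. res n H z i k * ((if k = j then z else 0) - H k j)) = (if i = j then 1 else 0)"
proof -
  let ?Z = "shifted n H z"
  have d: "det ?Z \<noteq> 0" by (rule det_shifted_nonzero[OF assms(1,2)])
  note a = adj_mat[OF shifted_carrier, of n H z]
  have c: "adj_mat ?Z \<in> carrier_mat n n" by (rule a)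
  have "(?Z * adj_mat ?Z) $$ (i, j) = (det ?Z \<cdot>\<^sub>m 1\<^sub>m n) $$ (i, j)" using a by simp
  then have "(\<Sum>k<n. ((if i = k then z else 0) - H i k) * adj_mat ?Z $$ (k, j)) = det ?Z * (if i = j then 1 else 0)"
    unfolding mat_mult_index[OF shifted_carrier c assms(3,4)] using assms(3,4) by (simp add: shifted_index)
  then have "(\<Sum>k<n. ((if i = k then z else 0) - H i k) * adj_mat ?Z $$ (k, j)) / det ?Z = (if i = j then 1 else 0)"
    using d by simp
  then show "(\<Sum>k<n. ((if i = k then z else 0) - H i k) * res n H z k j) = (if i = j then 1 else 0)"
    using assms(4) by (simp add: res_def sum_divide_distrib)
  have "(adj_mat ?Z * ?Z) $$ (i, j) = (det ?Z \<cdot>\<^sub>m 1\<^sub>m n) $$ (i, j)" using a by simp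
  then have "(\<Sum>k<n. adj_mat ?Z $$ (i, k) * ((if k = j then z else 0) - H k j)) = det ?Z * (if i = j then 1 else 0)"
    unfolding mat_mult_index[OF c shifted_carrier assms(3,4)] using assms(3,4) by (simp add: shifted_index)
  then have "(\<Sum>k<n. adj_mat ?Z $$ (i, k) * ((if k = j then z else 0) - H k j)) / det ?Z = (if i = j then 1 else 0)"
    using d by simp
  then show "(\<Sum>k<n. res n H z i k * ((if k = j then z else 0) - H k j)) = (if i = j then 1 else 0)"
    using assms(3) by (simp add: res_def sum_divide_distrib)
qed

lemma res_outside: "\<not> (i < n \<and> j < n) \<Longrightarrow> res n H z i j = 0"
  by (auto simp: res_def)

lemma
  assumes "herm n H" "Im z > 0" "i < n" "j < n"
  shows res_eq_right: "z * res n H z i j = (if i = j then 1 else 0) + mm n H (res n H z) i j"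
    and res_eq_left: "z * res n H z i j = (if i = j then 1 else 0) + mm n (res n H z) H i j"
proof -
  let ?G = "res n H z"
  have "(\<Sum>k<n. ((if i = k then z else 0) - H i k) * ?G k j) = z * ?G i j - mm n H ?G i j"
    using assms(3) by (simp add: mm_def left_diff_distrib sum_subtractf if_distrib[of "\<lambda>x. x * _"] cong: if_cong)
  then show "z * ?G i j = (if i = j then 1 else 0) + mm n H ?G i j"
    using res_right[OF assms] by (simp add: algebra_simps split: if_splits)
  have "(\<Sum>k<n. ?G i k * ((if k = j then z else 0) - H k j)) = z * ?G i j - mm n ?G H i j"
    using assms(4) by (simp add: mm_def right_diff_distrib sum_subtractf if_distrib[of "\<lambda>x. _ * x"] cong: if_cong)
  then show "z * ?G i j = (if i = j then 1 else 0) + mm n ?G H i j"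
    using res_left[OF assms] by (simp add: algebra_simps split: if_splits)
qed

text \<open>The vector \<open>y = G u\<close> solves \<open>(z - H) y = u\<close>, so
  \<open>herm_energy\<close> bounds it by \<open>u\<close>.\<close>

lemma op_bounded_res:
  assumes "herm n H" "Im z > 0"
  shows "op_bounded n (1 / Im z) (res n H z)"
proof (rule op_boundedI)
  fix u
  let ?y = "\<lambda>i. \<Sum>j<n. res n H z i j * u j"
  have "z * ?y i - (\<Sum>j<n. H i j * ?y j) = u i" if i: "i < n" for i
  proof -
    have "z * ?y i = (\<Sum>j<n. (z * res n H z i j) * u j)" by (simp add: sum_distrib_left mult.assoc)
    also have "\<dots> = (\<Sum>j<n. ((if i = j then 1 else 0) + mm n H (res n H z) i j) * u j)"
      using res_eq_right[OF assms i] by (intro sum.cong) auto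
    also have "\<dots> = u i + (\<Sum>j<n. mm n H (res n H z) i j * u j)"
      using i by (simp add: distrib_right sum.distrib if_distrib[of "\<lambda>x. x * _"] cong: if_cong)
    also have "(\<Sum>j<n. mm n H (res n H z) i j * u j) = (\<Sum>j<n. H i j * ?y j)"
      using fun_cong[OF fun_cong[OF mm_assoc[of n H "res n H z" "\<lambda>i _. u i"]], of i 0] by (simp add: mm_def)
    finally show ?thesis by simp
  qed
  then have "vnorm n (\<lambda>i. z * ?y i - (\<Sum>j<n. H i j * ?y j)) = vnorm n u"
    unfolding vnorm_def by (intro L2_set_cong) auto
  with herm_energy[OF assms, of ?y] assms(2) show "vnorm n ?y \<le> 1 / Im z * vnorm n u"
    by (simp add: field_simps)
qed

text \<open>Multiply out the right side with \<open>G H = z G - 1\<close> and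
  \<open>H' G' = z G' - 1\<close>. Outside the index range both sides are 0, which gives the
  identity for all \<open>i\<close> and \<open>j\<close>.\<close>

lemma resolvent_identity:
  assumes "herm n H" "herm n H'" "Im z > 0"
  shows "res n H z i j - res n H' z i j = mm n (mm n (res n H z) (\<lambda>i j. H i j - H' i j)) (res n H' z) i j"
proof (cases "i < n \<and> j < n")
  case True
  let ?G = "res n H z" and ?G' = "res n H' z"
  have "mm n (mm n ?G (\<lambda>i j. H i j - H' i j)) ?G' i j
      = mm n (mm n ?G H) ?G' i j - mm n ?G (mm n H' ?G') i j"
    by (simp add: mm_assoc[symmetric]) (simp add: mm_def sum_subtractf algebra_simps)
  also have "mm n (mm n ?G H) ?G' i j = (\<Sum>k<n. (z * ?G i k - (if i = k then 1 else 0)) * ?G' k j)"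
    using res_eq_left[OF assms(1,3)] True by (auto simp: mm_def[of n "mm n ?G H"] intro!: sum.cong)
  also have "\<dots> = (\<Sum>k<n. z * ?G i k * ?G' k j) - ?G' i j"
    using True by (simp add: left_diff_distrib sum_subtractf if_distrib[of "\<lambda>x. x * _"] cong: if_cong)
  also have "mm n ?G (mm n H' ?G') i j = (\<Sum>k<n. ?G i k * (z * ?G' k j - (if k = j then 1 else 0)))"
    using res_eq_right[OF assms(2,3)] True by (auto simp: mm_def[of n ?G] intro!: sum.cong)
  also have "\<dots> = (\<Sum>k<n. z * ?G i k * ?G' k j) - ?G i j"
    using True by (simp add: right_diff_distrib sum_subtractf if_distrib[of "\<lambda>x. _ * x"] mult.assoc mult.left_commute[of _ z] cong: if_cong)
  finally show ?thesis by simp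
next
  case False
  then show ?thesis by (auto simp: res_outside mm_def)
qed

section \<open>Measurability of the resolvent\<close>

lemma borel_measurable_det:
  fixes A :: "'a \<Rightarrow> complex mat"
  assumes "\<And>x. A x \<in> carrier_mat n n"
    and "\<And>i j. i < n \<Longrightarrow> j < n \<Longrightarrow> (\<lambda>x. A x $$ (i, j)) \<in> borel_measurable M"
  shows "(\<lambda>x. det (A x)) \<in> borel_measurable M"
  unfolding det_def'[OF assms(1)]
proof (intro borel_measurable_sum borel_measurable_times borel_measurable_prod borel_measurable_const)
  fix p i assume "p \<in> {p. p permutes {0..<n}}" "i \<in> {0..<n}"
  then show "(\<lambda>x. A x $$ (i, p i)) \<in> borel_measurable M"
    using assms(2)[of i "p i"] permutes_in_image[of p "{0..<n}" i] by auto
qed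

lemma shifted_dim [simp]: "dim_row (shifted n H z) = n" "dim_col (shifted n H z) = n"
  by (simp_all add: shifted_def)

lemma borel_measurable_res:
  fixes H :: "'a \<Rightarrow> nat \<Rightarrow> nat \<Rightarrow> complex"
  assumes H: "\<And>i j. (\<lambda>x. H x i j) \<in> borel_measurable M"
  shows "(\<lambda>x. res n (H x) z i j) \<in> borel_measurable M"
proof (cases "i < n \<and> j < n")
  case True
  have e: "(\<lambda>x. shifted n (H x) z $$ (i, j)) \<in> borel_measurable M" if "i < n" "j < n" for i j
    using H that by (simp add: shifted_index borel_measurable_diff)
  have a: "adj_mat (shifted n (H x) z) $$ (i, j) = (-1) ^ (j + i) * det (mat_delete (shifted n (H x) z) j i)" for x
    using True by (simp add: adj_mat_def cofactor_def)
  have d: "(\<lambda>x. det (mat_delete (shifted n (H x) z) j i)) \<in> borel_measurable M"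
  proof (rule borel_measurable_det[where n = "n - 1"])
    show "mat_delete (shifted n (H x) z) j i \<in> carrier_mat (n - 1) (n - 1)" for x
      by (rule mat_delete_carrier) simp
    fix k l assume kl: "k < n - 1" "l < n - 1"
    define k' l' where "k' = (if k < j then k else Suc k)" and "l' = (if l < i then l else Suc l)"
    have kl': "k' < n" "l' < n" using kl by (auto simp: k'_def l'_def)
    have "mat_delete (shifted n (H x) z) j i $$ (k, l)
        = shifted n (H x) z $$ (k', l')" for x
      using kl by (simp add: mat_delete_def k'_def l'_def)
    then show "(\<lambda>x. mat_delete (shifted n (H x) z) j i $$ (k, l)) \<in> borel_measurable M"
      using e[OF kl'] by simp
  qed
  have "(\<lambda>x. det (shifted n (H x) z)) \<in> borel_measurable M"
    by (rule borel_measurable_det[where n = n]) (use e in auto)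
  then show ?thesis using d True by (simp add: res_def a borel_measurable_divide)
next
  case False
  then show ?thesis by (simp add: res_outside)
qed

section \<open>Passage between the matrix type and functions of two indices\<close>

lemma hermitian_mat_index:
  assumes "hermitian_mat n A" "i < n" "j < n"
  shows "A $$ (j, i) = cnj (A $$ (i, j))"
proof -
  have A: "A \<in> carrier_mat n n" "mat_adjoint A = A" using assms(1) by (auto simp: hermitian_mat_def)
  have "mat_adjoint A $$ (j, i) = cnj (A $$ (i, j))"
    using A(1) assms(2,3) by (simp add: mat_adjoint_def mat_of_rows_def)
  then show ?thesis using A(2) by simp
qed

lemma herm_of_hermitian_mat: "hermitian_mat n A \<Longrightarrow> herm n (\<lambda>i j. A $$ (i, j))"
  unfolding herm_def using hermitian_mat_index by blast

lemma shifted_eq: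
  assumes "A \<in> carrier_mat n n"
  shows "z \<cdot>\<^sub>m 1\<^sub>m n - A = shifted n (\<lambda>i j. A $$ (i, j)) z"
  using assms by (intro eq_matI) (auto simp: shifted_index)

text \<open>A left inverse \<open>B\<close> and a right inverse \<open>R\<close> of the same matrix
  coincide; the first comes from \<open>mat_inverse\<close>, the second from Cramer's rule.\<close>

lemma resolvent_eq_res:
  assumes A: "hermitian_mat n A" and z: "Im z > 0"
  shows "resolvent A z \<in> carrier_mat n n"
    and "i < n \<Longrightarrow> j < n \<Longrightarrow> resolvent A z $$ (i, j) = res n (\<lambda>i j. A $$ (i, j)) z i j"
proof -
  have cA: "A \<in> carrier_mat n n" using A by (simp add: hermitian_mat_def)
  let ?H = "\<lambda>i j. A $$ (i, j)"
  let ?Z = "shifted n ?H z"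
  have h: "herm n ?H" by (rule herm_of_hermitian_mat[OF A])
  have "?Z \<in> Units (ring_mat TYPE(complex) n ())"
    by (rule det_non_zero_imp_unit[OF shifted_carrier det_shifted_nonzero[OF h z]])
  then obtain B where B: "mat_inverse ?Z = Some B"
    using mat_inverse(1)[OF shifted_carrier, of n ?H z "()"] by (cases "mat_inverse ?Z") auto
  have BZ: "B * ?Z = 1\<^sub>m n" and cB: "B \<in> carrier_mat n n"
    using mat_inverse(2)[OF shifted_carrier B] by auto
  have r: "resolvent A z = B" unfolding resolvent_def using cA B shifted_eq[OF cA] by simp
  then show "resolvent A z \<in> carrier_mat n n" using cB by simp
  define R where "R = mat n n (\<lambda>(i, j). res n ?H z i j)"
  have cR: "R \<in> carrier_mat n n" by (simp add: R_def)
  have "?Z * R = 1\<^sub>m n"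
  proof (rule eq_matI)
    fix i j assume "i < dim_row (1\<^sub>m n :: complex mat)" "j < dim_col (1\<^sub>m n :: complex mat)"
    then have ij: "i < n" "j < n" by auto
    show "(?Z * R) $$ (i, j) = 1\<^sub>m n $$ (i, j)"
      unfolding mat_mult_index[OF shifted_carrier cR ij]
      using res_right[OF h z ij] ij by (simp add: shifted_index R_def)
  qed (use cR shifted_carrier[of n ?H z] in auto)
  then have "B = B * (?Z * R)" using right_mult_one_mat[OF cB] by simp
  also have "\<dots> = (B * ?Z) * R" using assoc_mult_mat[OF cB shifted_carrier cR, of ?H z] by simp
  also have "\<dots> = R" using BZ cR by simp
  finally have "B = R" .
  then show "i < n \<Longrightarrow> j < n \<Longrightarrow> resolvent A z $$ (i, j) = res n ?H z i j"
    using r by (simp add: R_def)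
qed

lemma res_cong:
  assumes "\<And>i j. i < n \<Longrightarrow> j < n \<Longrightarrow> H i j = H' i j"
  shows "res n H z = res n H' z"
proof -
  have "shifted n H z = shifted n H' z" using assms by (intro eq_matI) (auto simp: shifted_def)
  then show ?thesis unfolding res_def by presburger
qed

section \<open>Coordinates of Wigner matrices\<close>

text \<open>The coefficient of coordinate \<open>p\<close> in the entry at position
  \<open>p\<close>, with its conjugate at the transposed position. On the diagonal the two positions
  coincide, and the halves add up to 1. Below the diagonal the coordinate is the imaginary part of
  the transposed entry, hence the minus sign.\<close>

definition dcoef :: "nat \<times> nat \<Rightarrow> complex" where
  "dcoef = (\<lambda>(a, b). if a = b then 1 / 2 else if a < b then 1 / sqrt 2 else - \<i> / sqrt 2)"

text \<open>The derivative of the deformed Wigner matrix with respect to the coordinate \<open>p\<close>.\<close>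

definition dmat :: "nat \<Rightarrow> nat \<times> nat \<Rightarrow> nat \<Rightarrow> nat \<Rightarrow> complex" where
  "dmat n p k l = ((if p = (k, l) then dcoef p else 0) + (if p = (l, k) then cnj (dcoef p) else 0)) / sqrt n"

definition hmat :: "nat \<Rightarrow> (nat \<Rightarrow> nat \<Rightarrow> complex) \<Rightarrow> (nat \<times> nat \<Rightarrow> real) \<Rightarrow> nat \<Rightarrow> nat \<Rightarrow> complex" where
  "hmat n A x k l = A k l + (\<Sum>p\<in>{..<n} \<times> {..<n}. x p * dmat n p k l)"

lemma norm_dcoef_le: "norm (dcoef p) \<le> 1 / sqrt 2"
proof -
  have "sqrt 2 \<le> 2" by (rule real_le_lsqrt) auto
  then show ?thesis by (cases p) (auto simp: dcoef_def norm_divide divide_simps)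
qed

lemma norm_dcoef: "fst p \<noteq> snd p \<Longrightarrow> dcoef p * cnj (dcoef p) = 1 / 2"
proof -
  assume "fst p \<noteq> snd p"
  then have "norm (dcoef p) = 1 / sqrt 2" by (cases p) (auto simp: dcoef_def norm_divide)
  then show ?thesis unfolding complex_norm_square[symmetric] by (simp add: power_divide)
qed

lemma dmat_herm: "herm n (dmat n p)"
  unfolding herm_def
proof (intro allI impI)
  fix i j
  show "dmat n p j i = cnj (dmat n p i j)"
  proof -
    define P Q where "P \<longleftrightarrow> p = (i, j)" and "Q \<longleftrightarrow> p = (j, i)"
    show ?thesis unfolding dmat_def P_def[symmetric] Q_def[symmetric]
      by (cases P; cases Q) (simp_all add: add.commute)
  qed
qed

lemma hmat_herm: "herm n A \<Longrightarrow> herm n (hmat n A x)"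
  unfolding herm_def[of n "hmat n A x"] by (simp add: hmat_def herm_cnj herm_cnj[OF dmat_herm])

lemma hmat_upd_diff:
  assumes "p \<in> {..<n} \<times> {..<n}"
  shows "hmat n A (x(p := s)) i j - hmat n A (x(p := t)) i j = (s - t) * dmat n p i j"
proof -
  have e: "(\<Sum>q\<in>{..<n} \<times> {..<n}. (x(p := s)) q * dmat n q i j)
      = s * dmat n p i j + (\<Sum>q\<in>{..<n} \<times> {..<n} - {p}. x q * dmat n q i j)" for s
    using assms by (subst sum.remove[of _ p]) auto
  show ?thesis unfolding hmat_def e by (simp add: left_diff_distrib)
qed

lemma sum_dmat:
  assumes "k < n" "l < n"
  shows "(\<Sum>p\<in>{..<n} \<times> {..<n}. f p * dmat n p k l) =
    (f (k, l) * dcoef (k, l) + f (l, k) * cnj (dcoef (l, k))) / sqrt n"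
proof -
  have "(\<Sum>p\<in>{..<n} \<times> {..<n}. f p * dmat n p k l)
    = (\<Sum>p\<in>{..<n} \<times> {..<n}. (if p = (k, l) then f p * dcoef p else 0) / sqrt n) +
      (\<Sum>p\<in>{..<n} \<times> {..<n}. (if p = (l, k) then f p * cnj (dcoef p) else 0) / sqrt n)"
    unfolding sum.distrib[symmetric]
  proof (intro sum.cong refl)
    fix p
    define P Q where "P \<longleftrightarrow> p = (k, l)" and "Q \<longleftrightarrow> p = (l, k)"
    show "f p * dmat n p k l = (if p = (k, l) then f p * dcoef p else 0) / sqrt n +
        (if p = (l, k) then f p * cnj (dcoef p) else 0) / sqrt n"
      unfolding dmat_def P_def[symmetric] Q_def[symmetric]
      by (cases P; cases Q) (simp_all add: add_divide_distrib distrib_left)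
  qed
  also have "\<dots> = (f (k, l) * dcoef (k, l) + f (l, k) * cnj (dcoef (l, k))) / sqrt n"
    using assms unfolding sum_divide_distrib[symmetric] by (simp add: add_divide_distrib)
  finally show ?thesis .
qed

text \<open>\<open>hmat\<close> reassembles the matrix from its real coordinates: the entry
  \<open>(k, l)\<close> only sees the coordinates \<open>(k, l)\<close> and
  \<open>(l, k)\<close>.\<close>

lemma hmat_wigner_component:
  assumes W: "hermitian_mat n W" and kl: "k < n" "l < n"
  shows "hmat n A (wigner_component W) k l = W $$ (k, l) / sqrt n + A k l"
proof -
  let ?x = "wigner_component W"
  have "?x (k, l) * dcoef (k, l) + ?x (l, k) * cnj (dcoef (l, k)) = W $$ (k, l)"
  proof -
    have w: "W $$ (l, k) = cnj (W $$ (k, l))" by (rule hermitian_mat_index[OF W kl])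
    consider "k = l" | "k < l" | "l < k" by linarith
    then show ?thesis
    proof cases
      case 1
      then have "Im (W $$ (k, l)) = 0" using w by (auto simp: complex_eq_iff)
      then show ?thesis using 1 by (simp add: wigner_component_def dcoef_def complex_eq_iff)
    next
      case 2
      then show ?thesis by (simp add: wigner_component_def dcoef_def complex_eq_iff)
    next
      case 3
      then show ?thesis using w by (simp add: wigner_component_def dcoef_def complex_eq_iff)
    qed
  qed
  then show ?thesis unfolding hmat_def sum_dmat[OF kl] by simp
qed

text \<open>With \<open>c = dcoef (a, b)\<close> and standard basis vectors \<open>e\<close>, the
  matrix \<open>dmat n (a, b)\<close> is \<open>c\<close> times \<open>e_a e_b^T\<close> plus
  \<open>cnj c\<close> times \<open>e_b e_a^T\<close>, over \<open>sqrt n\<close>. Its rank is at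
  most two, so words in it only involve the indices \<open>a\<close> and \<open>b\<close>.\<close>

lemma mm_dmat:
  assumes "a < n" "b < n"
  shows "mm n (mm n G (dmat n (a, b))) M i j =
    (dcoef (a, b) * G i a * M b j + cnj (dcoef (a, b)) * G i b * M a j) / sqrt n"
proof -
  let ?c = "dcoef (a, b)"
  have 1: "mm n G (dmat n (a, b)) i k =
      ((if k = b then ?c * G i a else 0) + (if k = a then cnj ?c * G i b else 0)) / sqrt n" for k
  proof -
    have "mm n G (dmat n (a, b)) i k = (\<Sum>l<n. ((if l = a then (if k = b then ?c * G i a else 0) else 0) +
        (if l = b then (if k = a then cnj ?c * G i b else 0) else 0)) / sqrt n)"
      unfolding mm_def by (intro sum.cong refl) (auto simp: dmat_def distrib_left)
    then show ?thesis
      unfolding sum_divide_distrib[symmetric] sum.distrib using assms by simp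
  qed
  have "mm n (mm n G (dmat n (a, b))) M i j = (\<Sum>k<n. ((if k = b then ?c * G i a * M b j else 0) +
      (if k = a then cnj ?c * G i b * M a j else 0)) / sqrt n)"
    unfolding mm_def[of n "mm n G (dmat n (a, b))"] 1 by (intro sum.cong refl) (auto simp: distrib_right)
  then show ?thesis
    unfolding sum_divide_distrib[symmetric] sum.distrib using assms by simp
qed

lemma tr_dmat:
  assumes "a < n" "b < n"
  shows "tr n (mm n (dmat n (a, b)) M) =
    (dcoef (a, b) * M b a + cnj (dcoef (a, b)) * M a b) / sqrt n"
proof -
  define E :: "nat \<Rightarrow> nat \<Rightarrow> complex" where "E i j = (if i = j then 1 else 0)" for i j
  let ?c = "dcoef (a, b)"
  have "mm n E X i j = X i j" if "i < n" for X i j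
    using that by (simp add: mm_def E_def if_distrib[of "\<lambda>x. x * _"] cong: if_cong)
  then have "tr n (mm n (dmat n (a, b)) M) = tr n (mm n (mm n E (dmat n (a, b))) M)"
    unfolding mm_assoc by (simp add: tr_def)
  also have "\<dots> = (\<Sum>i<n. ((if i = a then ?c * M b a else 0) + (if i = b then cnj ?c * M a b else 0)) / sqrt n)"
    unfolding tr_def mm_dmat[OF assms] by (intro sum.cong refl) (auto simp: E_def)
  also have "\<dots> = (?c * M b a + cnj ?c * M a b) / sqrt n"
    unfolding sum_divide_distrib[symmetric] sum.distrib using assms by simp
  finally show ?thesis .
qed

lemma norm_dcoef_comb:
  "norm (dcoef p * x + cnj (dcoef p) * y) \<le> (norm x + norm y) / sqrt 2"
proof -
  have "norm (dcoef p * x + cnj (dcoef p) * y) \<le> norm (dcoef p) * norm x + norm (dcoef p) * norm y"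
    using norm_triangle_ineq[of "dcoef p * x" "cnj (dcoef p) * y"] by (simp add: norm_mult)
  also have "\<dots> = norm (dcoef p) * (norm x + norm y)" by (simp add: distrib_left)
  also have "\<dots> \<le> 1 / sqrt 2 * (norm x + norm y)" by (intro mult_right_mono norm_dcoef_le) auto
  finally show ?thesis by simp
qed

text \<open>The matrix \<open>(G D)^k M\<close>. For a resolvent \<open>G\<close> and
  \<open>M = G F\<close> it is the \<open>k\<close>-th derivative of \<open>G F\<close> in the
  direction \<open>D\<close>, divided by \<open>k!\<close>.\<close>

fun word :: "nat \<Rightarrow> (nat \<Rightarrow> nat \<Rightarrow> complex) \<Rightarrow> (nat \<Rightarrow> nat \<Rightarrow> complex) \<Rightarrow> (nat \<Rightarrow> nat \<Rightarrow> complex) \<Rightarrow> nat \<Rightarrow> nat \<Rightarrow> nat \<Rightarrow> complex" where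
  "word n G D M 0 = M"
| "word n G D M (Suc k) = mm n (mm n G D) (word n G D M k)"

text \<open>Multiplication by \<open>G D\<close> reads only the rows \<open>a\<close> and
  \<open>b\<close>, so the sum over these two rows obeys a closed recursion. Each new entry gains
  \<open>K / sqrt 2 / sqrt n\<close>, and two rows make \<open>sqrt 2 * K / sqrt n\<close>.\<close>

lemma norm_word_le:
  assumes ab: "a < n" "b < n" and G: "\<And>i j. i < n \<Longrightarrow> j < n \<Longrightarrow> norm (G i j) \<le> K" and "0 \<le> K"
  shows "norm (word n G (dmat n (a, b)) M k a j) + norm (word n G (dmat n (a, b)) M k b j)
    \<le> (sqrt 2 * K / sqrt n) ^ k * (norm (M a j) + norm (M b j))"
proof (induction k)
  case 0
  then show ?case by simp
next
  case (Suc k)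
  let ?w = "word n G (dmat n (a, b)) M k"
  have st: "norm (word n G (dmat n (a, b)) M (Suc k) i j) \<le> (K / sqrt 2 / sqrt n) * (norm (?w a j) + norm (?w b j))"
    if i: "i < n" for i
  proof -
    have "norm (word n G (dmat n (a, b)) M (Suc k) i j)
        = norm (dcoef (a, b) * (G i a * ?w b j) + cnj (dcoef (a, b)) * (G i b * ?w a j)) / sqrt n"
      using mm_dmat[OF ab, of G ?w i j] by (simp add: norm_divide mult.assoc)
    also have "\<dots> \<le> (norm (G i a * ?w b j) + norm (G i b * ?w a j)) / sqrt 2 / sqrt n"
      by (intro divide_right_mono norm_dcoef_comb) auto
    also have "\<dots> \<le> (K * norm (?w b j) + K * norm (?w a j)) / sqrt 2 / sqrt n"
      using G[OF i] ab by (intro divide_right_mono add_mono) (auto simp: norm_mult intro!: mult_right_mono)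
    finally show ?thesis by (simp add: algebra_simps add_divide_distrib)
  qed
  have "norm (word n G (dmat n (a, b)) M (Suc k) a j) + norm (word n G (dmat n (a, b)) M (Suc k) b j)
      \<le> 2 * ((K / sqrt 2 / sqrt n) * (norm (?w a j) + norm (?w b j)))"
    using st[OF ab(1)] st[OF ab(2)] by simp
  also have "\<dots> = (sqrt 2 * K / sqrt n) * (norm (?w a j) + norm (?w b j))"
  proof -
    have "2 * (K / sqrt 2) = sqrt 2 * K" by (simp add: field_simps)
    then show ?thesis by (metis times_divide_eq_right mult.assoc)
  qed
  also have "\<dots> \<le> (sqrt 2 * K / sqrt n) * ((sqrt 2 * K / sqrt n) ^ k * (norm (M a j) + norm (M b j)))"
    using assms(4) by (intro mult_left_mono Suc) auto
  finally show ?case by (simp add: mult.assoc)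
qed

text \<open>The trace against \<open>D\<close> reads two entries of the word, so only the columns
  \<open>a\<close> and \<open>b\<close> of \<open>F\<close> enter. The sum over all coordinates is
  thereby controlled by \<open>n\<close> times the sum of column norms.\<close>

lemma norm_tr_word_le:
  assumes ab: "a < n" "b < n" and G: "op_bounded n K G" and K: "0 \<le> K"
  shows "norm (tr n (mm n (dmat n (a, b)) (word n G (dmat n (a, b)) (mm n G F) k)))
    \<le> (sqrt 2 * K / sqrt n) ^ k / sqrt (2 * n) * (2 * K * (vnorm n (\<lambda>i. F i a) + vnorm n (\<lambda>i. F i b)))"
proof -
  let ?w = "word n G (dmat n (a, b)) (mm n G F) k"
  have GF: "norm (mm n G F i j) \<le> K * vnorm n (\<lambda>i. F i j)" if "i < n" for i j
    unfolding mm_def using norm_sum_le_vnorm[of "\<lambda>k. G i k" "\<lambda>k. F k j" n] op_bounded_row[OF G K that]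
    by (meson mult_right_mono order_trans vnorm_nonneg)
  have "norm (tr n (mm n (dmat n (a, b)) ?w)) \<le> (norm (?w b a) + norm (?w a b)) / sqrt 2 / sqrt n"
  proof -
    have e: "norm (complex_of_real (sqrt n)) = sqrt n" by simp
    show ?thesis unfolding tr_dmat[OF ab] norm_divide e
      by (intro divide_right_mono norm_dcoef_comb) simp
  qed
  also have "norm (?w b a) + norm (?w a b) \<le> (norm (?w a a) + norm (?w b a)) + (norm (?w a b) + norm (?w b b))"
    by simp
  also have "\<dots> \<le> (sqrt 2 * K / sqrt n) ^ k * (norm (mm n G F a a) + norm (mm n G F b a)) +
     (sqrt 2 * K / sqrt n) ^ k * (norm (mm n G F a b) + norm (mm n G F b b))"
    using op_bounded_entry[OF G K] by (intro add_mono norm_word_le[OF ab _ K])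
  also have "\<dots> = (sqrt 2 * K / sqrt n) ^ k * (norm (mm n G F a a) + norm (mm n G F b a) + norm (mm n G F a b) + norm (mm n G F b b))"
    by (simp add: distrib_left)
  also have "\<dots> \<le> (sqrt 2 * K / sqrt n) ^ k * (2 * K * (vnorm n (\<lambda>i. F i a) + vnorm n (\<lambda>i. F i b)))"
  proof (intro mult_left_mono)
    show "norm (mm n G F a a) + norm (mm n G F b a) + norm (mm n G F a b) + norm (mm n G F b b)
      \<le> 2 * K * (vnorm n (\<lambda>i. F i a) + vnorm n (\<lambda>i. F i b))"
      using GF[OF ab(1), of a] GF[OF ab(1), of b] GF[OF ab(2), of a] GF[OF ab(2), of b]
      by (simp add: distrib_left)
  qed (use K in simp)
  finally show ?thesis by (simp add: real_sqrt_mult divide_right_mono mult.commute)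
qed

section \<open>Derivatives of resolvents and of words in them\<close>

lemma has_vector_derivative_mm:
  assumes "\<And>i j. ((\<lambda>s. X s i j) has_vector_derivative X' i j) (at t)"
    and "\<And>i j. ((\<lambda>s. Y s i j) has_vector_derivative Y' i j) (at t)"
  shows "((\<lambda>s. mm n (X s) (Y s) i j) has_vector_derivative mm n X' (Y t) i j + mm n (X t) Y' i j) (at t)"
  unfolding mm_def sum.distrib[symmetric]
proof (intro has_vector_derivative_sum)
  fix k
  have "((\<lambda>s. X s i k * Y s k j) has_vector_derivative X t i k * Y' k j + X' i k * Y t k j) (at t)"
    by (rule has_vector_derivative_mult[OF assms])
  then show "((\<lambda>s. X s i k * Y s k j) has_vector_derivative X' i k * Y t k j + X t i k * Y' k j) (at t)"
    by (simp add: add.commute)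
qed

lemma has_vector_derivative_tr:
  assumes "\<And>i j. ((\<lambda>s. X s i j) has_vector_derivative X' i j) (at t)"
  shows "((\<lambda>s. tr n (X s)) has_vector_derivative tr n X') (at t)"
  unfolding tr_def by (intro has_vector_derivative_sum assms)

text \<open>The resolvent identity makes the difference quotient equal to \<open>G s D G t\<close>
  exactly. Uniform boundedness of the entries makes this expression bounded, hence \<open>G\<close>
  continuous, and continuity gives the limit of the quotient.\<close>

lemma has_vector_derivative_res:
  assumes herm: "\<And>s. herm n (H s)" and z: "Im z > 0"
    and H: "\<And>s t i j. H s i j - H t i j = complex_of_real (s - t) * D i j"
  shows "((\<lambda>s. res n (H s) z i j) has_vector_derivative mm n (mm n (res n (H t) z) D) (res n (H t) z) i j) (at t)"
proof -
  define G where "G s = res n (H s) z" for s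
  define q where "q i j s = mm n (mm n (G s) D) (G t) i j" for i j s
  have id: "G s i j - G t i j = complex_of_real (s - t) * q i j s" for s i j
  proof -
    have "G s i j - G t i j = mm n (mm n (G s) (\<lambda>i j. complex_of_real (s - t) * D i j)) (G t) i j"
      unfolding G_def resolvent_identity[OF herm herm z] H ..
    also have "\<dots> = complex_of_real (s - t) * q i j s"
      unfolding q_def mm_def by (simp add: sum_distrib_left sum_distrib_right mult_ac)
    finally show ?thesis .
  qed
  have ob: "op_bounded n (1 / Im z) (G s)" for s unfolding G_def by (rule op_bounded_res[OF herm z])
  have bd: "norm (G s i j) \<le> 1 / Im z" for s i j
  proof (cases "i < n \<and> j < n")
    case True
    then show ?thesis using op_bounded_entry[OF ob, of i j] z by simp
  next
    case False
    then show ?thesis using z by (simp add: G_def res_outside)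
  qed
  have cont: "((\<lambda>s. G s i j) \<longlongrightarrow> G t i j) (at t)" for i j
  proof -
    define B where "B = (\<Sum>k<n. (\<Sum>l<n. 1 / Im z * norm (D l k)) * (1 / Im z))"
    have qB: "norm (q i j s) \<le> B" for s
      unfolding q_def mm_def B_def
    proof (intro sum_norm_le)
      fix k
      have "norm (\<Sum>l<n. G s i l * D l k) \<le> (\<Sum>l<n. 1 / Im z * norm (D l k))"
        by (intro sum_norm_le) (simp only: norm_mult, intro mult_right_mono bd norm_ge_zero)
      then show "norm ((\<Sum>l<n. G s i l * D l k) * G t k j) \<le> (\<Sum>l<n. 1 / Im z * norm (D l k)) * (1 / Im z)"
        unfolding norm_mult using bd z by (intro mult_mono) (auto intro!: sum_nonneg)
    qed
    have "((\<lambda>s. \<bar>s - t\<bar> * B) \<longlongrightarrow> \<bar>t - t\<bar> * B) (at t)" by (intro tendsto_intros)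
    then have l: "((\<lambda>s. \<bar>s - t\<bar> * B) \<longlongrightarrow> 0) (at t)" by simp
    have "((\<lambda>s. G s i j - G t i j) \<longlongrightarrow> 0) (at t)"
    proof (rule Lim_null_comparison[OF _ l], intro always_eventually allI)
      fix s
      show "norm (G s i j - G t i j) \<le> \<bar>s - t\<bar> * B"
        unfolding id norm_mult norm_of_real by (intro mult_left_mono qB) auto
    qed
    then show ?thesis by (simp add: LIM_zero_iff)
  qed
  have ql: "(q i j \<longlongrightarrow> q i j t) (at t)"
    unfolding q_def mm_def by (intro tendsto_intros cont)
  have "((\<lambda>s. G s i j) has_vector_derivative q i j t) (at t)"
    unfolding has_vector_derivative_def has_derivative_at
  proof (intro conjI)
    show "bounded_linear (\<lambda>x. x *\<^sub>R q i j t)" by (rule bounded_linear_scaleR_left)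
    have "(\<lambda>h. norm (q i j (t + h) - q i j t)) \<midarrow>0\<rightarrow> 0"
      using LIM_offset_zero[OF ql] by (simp add: tendsto_norm_zero LIM_zero)
    then show "(\<lambda>h. norm (G (t + h) i j - G t i j - h *\<^sub>R q i j t) / norm h) \<midarrow>0\<rightarrow> 0"
    proof (rule LIM_equal[THEN iffD1, rotated], intro allI impI)
      fix h :: real assume h: "h \<noteq> 0"
      have "G (t + h) i j - G t i j - h *\<^sub>R q i j t = complex_of_real h * (q i j (t + h) - q i j t)"
        unfolding id by (simp add: scaleR_conv_of_real right_diff_distrib)
      then show "norm (q i j (t + h) - q i j t) = norm (G (t + h) i j - G t i j - h *\<^sub>R q i j t) / norm h"
        using h by (simp add: norm_mult)
    qed
  qed
  then show ?thesis by (simp add: G_def q_def)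
qed

text \<open>The square of the Hilbert-Schmidt norm, not the norm itself.\<close>

definition hs :: "nat \<Rightarrow> (nat \<Rightarrow> nat \<Rightarrow> complex) \<Rightarrow> real" where
  "hs n F = (\<Sum>i<n. \<Sum>j<n. (norm (F i j))\<^sup>2)"

lemma hs_nonneg: "0 \<le> hs n F"
  by (simp add: hs_def sum_nonneg)

lemma hs_cols: "hs n F = (\<Sum>j<n. (vnorm n (\<lambda>i. F i j))\<^sup>2)"
  unfolding hs_def vnorm_sq by (rule sum.swap)

lemma hs_rows: "hs n F = (\<Sum>i<n. (vnorm n (\<lambda>j. F i j))\<^sup>2)"
  unfolding hs_def vnorm_sq ..

lemma hs_mm_left:
  assumes "op_bounded n K G" "0 \<le> K"
  shows "hs n (mm n G F) \<le> K\<^sup>2 * hs n F"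
  unfolding hs_cols sum_distrib_left mm_def power_mult_distrib[symmetric]
  by (intro sum_mono power_mono op_bounded_apply[OF assms]) auto

lemma hs_mm_right:
  assumes "op_bounded n K G" "0 \<le> K"
  shows "hs n (mm n F G) \<le> K\<^sup>2 * hs n F"
  unfolding hs_rows sum_distrib_left mm_def power_mult_distrib[symmetric]
  by (intro sum_mono power_mono op_bounded_apply_left[OF assms]) auto

text \<open>Differentiating any of the \<open>k + 1\<close> factors \<open>G\<close> replaces it by
  \<open>G E G\<close>, and each replacement yields the same longer word.\<close>

lemma has_vector_derivative_word:
  fixes g :: "real \<Rightarrow> nat \<Rightarrow> nat \<Rightarrow> complex"
  assumes g: "\<And>i j. ((\<lambda>s. g s i j) has_vector_derivative mm n (mm n (g t) E) (g t) i j) (at t)"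
  shows "((\<lambda>s. word n (g s) E (mm n (g s) F) k i j) has_vector_derivative
     of_nat (Suc k) * word n (g t) E (mm n (g t) F) (Suc k) i j) (at t)"
proof (induction k arbitrary: i j)
  case 0
  have "((\<lambda>s. mm n (g s) F i j) has_vector_derivative
      mm n (mm n (mm n (g t) E) (g t)) F i j + mm n (g t) (\<lambda>i j. 0) i j) (at t)"
    by (intro has_vector_derivative_mm g has_vector_derivative_const)
  then show ?case by (simp add: mm_assoc) (simp add: mm_def)
next
  case (Suc k)
  let ?w = "\<lambda>s. word n (g s) E (mm n (g s) F)"
  have "((\<lambda>s. mm n (g s) E i j) has_vector_derivative
      mm n (mm n (mm n (g t) E) (g t)) E i j) (at t)" for i j
  proof -
    have "((\<lambda>s. mm n (g s) E i j) has_vector_derivative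
        mm n (mm n (mm n (g t) E) (g t)) E i j + mm n (g t) (\<lambda>i j. 0) i j) (at t)"
      by (intro has_vector_derivative_mm g has_vector_derivative_const)
    then show ?thesis by (simp add: mm_def[of n "g t" "\<lambda>i j. 0"])
  qed
  from has_vector_derivative_mm[OF this Suc]
  have "((\<lambda>s. ?w s (Suc k) i j) has_vector_derivative
      mm n (mm n (mm n (mm n (g t) E) (g t)) E) (?w t k) i j +
      mm n (mm n (g t) E) (\<lambda>i j. of_nat (Suc k) * ?w t (Suc k) i j) i j) (at t)"
    by simp
  moreover have "mm n (mm n (mm n (mm n (g t) E) (g t)) E) (?w t k) = ?w t (Suc (Suc k))"
    by (simp add: mm_assoc)
  moreover have "mm n (mm n (g t) E) (\<lambda>i j. of_nat (Suc k) * ?w t (Suc k) i j) i j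
      = of_nat (Suc k) * ?w t (Suc (Suc k)) i j"
    unfolding word.simps(2)[of n "g t" E _ "Suc k"] mm_def[of n "mm n (g t) E"]
    by (simp add: sum_distrib_left mult_ac)
  ultimately show ?case by (simp add: distrib_right add.commute)
qed

section \<open>The resolvent as a function of the real coordinates\<close>

locale deformed_resolvent =
  fixes n :: nat and A :: "nat \<Rightarrow> nat \<Rightarrow> complex" and z :: complex
  assumes n_pos: "n > 0" and herm_A: "herm n A" and Im_z: "Im z > 0"
begin

definition K where "K = 1 / Im z"
abbreviation I where "I \<equiv> {..<n} \<times> {..<n}"
definition G where "G x = res n (hmat n A x) z"
abbreviation D where "D \<equiv> dmat n"

lemma K_pos: "K > 0" using Im_z by (simp add: K_def)
lemma K_nonneg: "K \<ge> 0" using K_pos by simp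

lemma op_bounded_G: "op_bounded n K (G x)"
  unfolding G_def K_def by (intro op_bounded_res hmat_herm herm_A Im_z)

lemmas G_entry = op_bounded_entry[OF op_bounded_G K_nonneg]

lemma has_vector_derivative_G:
  assumes "p \<in> I"
  shows "((\<lambda>s. G (x(p := s)) i j) has_vector_derivative
     mm n (mm n (G (x(p := t))) (D p)) (G (x(p := t))) i j) (at t)"
proof -
  have "hmat n A (x(p := s)) i j - hmat n A (x(p := t)) i j = complex_of_real (s - t) * D p i j" for s t i j
    using hmat_upd_diff[OF assms] by simp
  then show ?thesis
    unfolding G_def by (intro has_vector_derivative_res hmat_herm herm_A Im_z)
qed

lemma continuous_G:
  assumes "p \<in> I"
  shows "continuous_on UNIV (\<lambda>s. G (x(p := s)) i j)"
  using has_vector_derivative_G[OF assms]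
  by (meson continuous_at_imp_continuous_on has_vector_derivative_continuous)

text \<open>The \<open>k\<close>-th derivative in coordinate \<open>p\<close> of
  \<open>tr (D p * G * F)\<close>, the function that multiplies \<open>x p\<close> in the linear
  identity; \<open>fact k\<close> undoes the normalization of \<open>word\<close>.\<close>

definition tword where
  "tword F p k x = fact k * tr n (mm n (D p) (word n (G x) (D p) (mm n (G x) F) k))"

lemma has_vector_derivative_tword:
  assumes p: "p \<in> I"
  shows "((\<lambda>s. tword F p k (x(p := s))) has_vector_derivative tword F p (Suc k) (x(p := t))) (at t)"
proof -
  let ?w = "\<lambda>s. word n (G (x(p := s))) (D p) (mm n (G (x(p := s))) F)"
  have "((\<lambda>s. mm n (D p) (?w s k) i j) has_vector_derivative
      mm n (\<lambda>i j. 0) (?w t k) i j + mm n (D p) (\<lambda>i j. of_nat (Suc k) * ?w t (Suc k) i j) i j) (at t)" for i j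
    by (intro has_vector_derivative_mm has_vector_derivative_const has_vector_derivative_word has_vector_derivative_G p)
  moreover have "mm n (\<lambda>i j. 0) (?w t k) i j + mm n (D p) (\<lambda>i j. of_nat (Suc k) * ?w t (Suc k) i j) i j
      = of_nat (Suc k) * mm n (D p) (?w t (Suc k)) i j" for i j
    unfolding mm_def[of n "D p"] mm_def[of n "\<lambda>i j. 0"] sum_distrib_left
    by (simp only: mult_zero_left sum.neutral_const add_0_left mult.left_commute[of _ "of_nat (Suc k)"])
  ultimately have d: "((\<lambda>s. mm n (D p) (?w s k) i j) has_vector_derivative
      of_nat (Suc k) * mm n (D p) (?w t (Suc k)) i j) (at t)" for i j
    by (simp only:)
  have "((\<lambda>s. fact k * tr n (mm n (D p) (?w s k))) has_vector_derivative
      fact k * tr n (\<lambda>i j. of_nat (Suc k) * mm n (D p) (?w t (Suc k)) i j)) (at t)"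
    by (intro has_vector_derivative_mult_right has_vector_derivative_tr d)
  moreover have "fact k * tr n (\<lambda>i j. of_nat (Suc k) * mm n (D p) (?w t (Suc k)) i j) = tword F p (Suc k) (x(p := t))"
    unfolding tword_def tr_def sum_distrib_left[symmetric] fact_Suc by (simp only: mult_ac of_nat_mult)
  ultimately show ?thesis unfolding tword_def[of F p k] by (simp only:)
qed

definition fcol where "fcol F p = vnorm n (\<lambda>i. F i (fst p)) + vnorm n (\<lambda>i. F i (snd p))"

lemma fcol_nonneg: "0 \<le> fcol F p"
  by (simp add: fcol_def)

lemma sum_fcol: "(\<Sum>p\<in>I. fcol F p) = 2 * real n * (\<Sum>i<n. vnorm n (\<lambda>k. F k i))"
proof -
  let ?f = "\<lambda>i. vnorm n (\<lambda>k. F k i)"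
  have "(\<Sum>p\<in>I. ?f (fst p)) = (\<Sum>i<n. \<Sum>j<n. ?f i)" "(\<Sum>p\<in>I. ?f (snd p)) = (\<Sum>i<n. \<Sum>j<n. ?f j)"
    unfolding sum.cartesian_product by (simp_all add: case_prod_unfold)
  then show ?thesis unfolding fcol_def sum.distrib by (simp add: sum_distrib_left mult.assoc)
qed

lemma norm_tword_le:
  assumes p: "p \<in> I"
  shows "norm (tword F p k x) \<le> fact k * ((sqrt 2 * K / sqrt n) ^ k / sqrt (2 * n) * (2 * K * fcol F p))"
proof -
  obtain a b where ab: "p = (a, b)" "a < n" "b < n" using p by auto
  have f: "norm (fact k :: complex) = fact k" by simp
  show ?thesis
    unfolding tword_def ab(1) fcol_def norm_mult f fst_conv snd_conv
    by (intro mult_left_mono norm_tr_word_le[OF ab(2,3) op_bounded_G K_nonneg]) simp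
qed

text \<open>Six factors \<open>1 / sqrt n\<close> make \<open>1 / n^3\<close>, and
  \<open>960 = 5! * 4 * 2\<close>, where 4 is what remains of the powers of
  \<open>sqrt 2\<close>.\<close>

lemma norm_tword5_le:
  assumes p: "p \<in> I"
  shows "norm (tword F p 5 x) \<le> 960 * K ^ 6 / real n ^ 3 * fcol F p"
proof -
  have s2: "sqrt 2 ^ 5 = 4 * sqrt 2" "sqrt n ^ 5 * sqrt n = real n ^ 3"
    by (simp_all add: power_numeral_reduce)
  have "(sqrt 2 * K / sqrt n) ^ 5 / sqrt (2 * n) = (sqrt 2 ^ 5 / sqrt 2) * K ^ 5 / (sqrt n ^ 5 * sqrt n)"
    by (simp add: power_divide power_mult_distrib real_sqrt_mult)
  also have "\<dots> = 4 * K ^ 5 / real n ^ 3" unfolding s2 by simp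
  finally have e: "(sqrt 2 * K / sqrt n) ^ 5 / sqrt (2 * n) = 4 * K ^ 5 / real n ^ 3" .
  have f: "fact 5 = (120 :: real)" by (simp add: fact_numeral)
  show ?thesis using norm_tword_le[OF p, of F 5 x] unfolding e f by (simp add: power_numeral_reduce)
qed

lemma sum_tword0:
  "(\<Sum>p\<in>I. complex_of_real (x p) * tword F p 0 x) = tr n (mm n (\<lambda>i j. \<Sum>p\<in>I. x p * D p i j) (mm n (G x) F))"
proof -
  have "tr n (mm n (\<lambda>i j. \<Sum>p\<in>I. x p * D p i j) (mm n (G x) F))
    = (\<Sum>i<n. \<Sum>k<n. \<Sum>p\<in>I. x p * D p i k * mm n (G x) F k i)"
    unfolding tr_def mm_def[of n "\<lambda>i j. \<Sum>p\<in>I. x p * D p i j"] by (simp add: sum_distrib_right)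
  also have "\<dots> = (\<Sum>i<n. \<Sum>p\<in>I. \<Sum>k<n. x p * D p i k * mm n (G x) F k i)"
    by (intro sum.cong refl sum.swap)
  also have "\<dots> = (\<Sum>p\<in>I. \<Sum>i<n. \<Sum>k<n. x p * D p i k * mm n (G x) F k i)" by (rule sum.swap)
  also have "\<dots> = (\<Sum>p\<in>I. complex_of_real (x p) * tword F p 0 x)"
    unfolding tword_def tr_def mm_def[of n "D _"] by (simp add: sum_distrib_left mult.assoc)
  finally show ?thesis by simp
qed

text \<open>The covariance structure is that of the GUE: \<open>\<Sum>p. D p * X * D p = (tr X / n) * 1\<close>.\<close>

lemma sum_tword1: "(\<Sum>p\<in>I. tword F p 1 x) = tr n (G x) / n * tr n (mm n (G x) F)"
proof -
  let ?M = "mm n (G x) F"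
  have e: "tword F (a, b) 1 x = ((dcoef (a, b))\<^sup>2 * G x b a * ?M b a + (dcoef (a, b) * cnj (dcoef (a, b))) * G x b b * ?M a a
     + (dcoef (a, b) * cnj (dcoef (a, b))) * G x a a * ?M b b + (cnj (dcoef (a, b)))\<^sup>2 * G x a b * ?M a b) / n"
    if "a < n" "b < n" for a b
  proof -
    have n2: "complex_of_real (sqrt n) * complex_of_real (sqrt n) = of_nat n"
      by (simp flip: of_real_mult)
    have "tword F (a, b) 1 x = (dcoef (a, b) * ((dcoef (a, b) * G x b a * ?M b a + cnj (dcoef (a, b)) * G x b b * ?M a a) / sqrt n) +
      cnj (dcoef (a, b)) * ((dcoef (a, b) * G x a a * ?M b b + cnj (dcoef (a, b)) * G x a b * ?M a b) / sqrt n)) / sqrt n"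
      unfolding tword_def by (simp add: tr_dmat[OF that] mm_dmat[OF that])
    also have "\<dots> = (dcoef (a, b) * (dcoef (a, b) * G x b a * ?M b a + cnj (dcoef (a, b)) * G x b b * ?M a a) +
      cnj (dcoef (a, b)) * (dcoef (a, b) * G x a a * ?M b b + cnj (dcoef (a, b)) * G x a b * ?M a b)) / n"
      by (simp add: add_divide_distrib[symmetric] n2)
    finally show ?thesis by (simp add: algebra_simps power2_eq_square)
  qed
  \<comment> \<open>The real and the imaginary coordinate of an entry have \<open>dcoef\<close>
    squared equal to 1/2 and -1/2, so the terms with \<open>G x b a\<close> and
    \<open>G x a b\<close> cancel; the products of diagonal entries add up.\<close>
  have pair: "tword F (a, b) 1 x + tword F (b, a) 1 x = (G x a a * ?M b b + G x b b * ?M a a) / n"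
    if "a < n" "b < n" "a < b" for a b
  proof -
    have d: "dcoef (a, b) * cnj (dcoef (a, b)) = 1 / 2" "dcoef (b, a) * cnj (dcoef (b, a)) = 1 / 2"
      using norm_dcoef[of "(a, b)"] norm_dcoef[of "(b, a)"] that by simp_all
    have s: "complex_of_real (sqrt 2) * complex_of_real (sqrt 2) = 2" by (simp flip: of_real_mult)
    have q: "(dcoef (a, b))\<^sup>2 = 1 / 2" "(cnj (dcoef (a, b)))\<^sup>2 = 1 / 2"
        "(dcoef (b, a))\<^sup>2 = - 1 / 2" "(cnj (dcoef (b, a)))\<^sup>2 = - 1 / 2"
      using that by (simp_all add: dcoef_def power2_eq_square s)
    show ?thesis unfolding e[OF that(1,2)] e[OF that(2,1)] d q add_divide_distrib[symmetric]
      by (intro arg_cong2[where f = "(/)"] refl) (simp add: field_simps)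
  qed
  have diag: "tword F (a, a) 1 x = G x a a * ?M a a / n" if "a < n" for a
    unfolding e[OF that that] by (simp add: dcoef_def power2_eq_square)
  \<comment> \<open>Doubling the sum pairs every coordinate with its transpose, and the diagonal
    then fits the same formula.\<close>
  have sym: "2 * (\<Sum>p\<in>I. tword F p 1 x) = (\<Sum>a<n. \<Sum>b<n. tword F (a, b) 1 x + tword F (b, a) 1 x)"
  proof -
    have "(\<Sum>p\<in>I. tword F p 1 x) = (\<Sum>a<n. \<Sum>b<n. tword F (a, b) 1 x)"
      by (simp add: sum.cartesian_product)
    moreover have "(\<Sum>a<n. \<Sum>b<n. tword F (a, b) 1 x) = (\<Sum>a<n. \<Sum>b<n. tword F (b, a) 1 x)" by (rule sum.swap)
    ultimately show ?thesis by (simp add: sum.distrib)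
  qed
  also have "\<dots> = (\<Sum>a<n. \<Sum>b<n. (G x a a * ?M b b + G x b b * ?M a a) / n)"
  proof (intro sum.cong refl)
    fix a b assume ab: "a \<in> {..<n}" "b \<in> {..<n}"
    consider "a = b" | "a < b" | "b < a" by linarith
    then show "tword F (a, b) 1 x + tword F (b, a) 1 x = (G x a a * ?M b b + G x b b * ?M a a) / n"
    proof cases
      case 1
      then show ?thesis using diag[of a] ab by (simp add: add_divide_distrib)
    next
      case 2
      then show ?thesis using pair[of a b] ab by simp
    next
      case 3
      then show ?thesis using pair[of b a] ab by (simp add: add.commute)
    qed
  qed
  also have "\<dots> = 2 * (tr n (G x) / n * tr n ?M)"
  proof -
    have "(\<Sum>a<n. \<Sum>b<n. (G x a a * ?M b b + G x b b * ?M a a) / n)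
      = ((\<Sum>a<n. \<Sum>b<n. G x a a * ?M b b) + (\<Sum>a<n. \<Sum>b<n. ?M a a * G x b b)) / n"
      by (simp add: sum.distrib sum_divide_distrib[symmetric] add_divide_distrib mult.commute)
    then show ?thesis unfolding sum_product[symmetric] tr_def by (simp add: mult.commute)
  qed
  finally show ?thesis by (rule mult_left_cancel[THEN iffD1, rotated]) simp
qed

end

lemma (in deformed_resolvent) norm_GF_le: "i < n \<Longrightarrow> norm (mm n (G x) F i j) \<le> K * vnorm n (\<lambda>i. F i j)"
  unfolding mm_def using norm_sum_le_vnorm[of "\<lambda>k. G x i k" "\<lambda>k. F k j" n] op_bounded_row[OF op_bounded_G K_nonneg, of i x]
  by (meson mult_right_mono order_trans vnorm_nonneg)

section \<open>Fluctuations under the law of the coordinates\<close>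

locale deformed_wigner_law = deformed_resolvent +
  fixes \<mu> :: "real measure" and \<sigma> C :: real
  assumes law: "wigner_law \<mu> \<sigma>" and C_pos: "C > 0"
    and poincare: "variance_bound \<mu> C"
begin

lemma real_distribution_\<mu>: "real_distribution \<mu>"
  using law by (simp add: wigner_law_def)

sublocale \<mu>: real_distribution \<mu> by (rule real_distribution_\<mu>)

sublocale iid: iid_product \<mu> "{..<n} \<times> {..<n} :: (nat \<times> nat) set"
  by unfold_locales simp

abbreviation P where "P \<equiv> Pi\<^sub>M I (\<lambda>_. \<mu>)"

sublocale P: prob_space P by (rule iid.prob_space_law)

lemma measurable_G [measurable]: "(\<lambda>x. G x i j) \<in> borel_measurable P"
  unfolding G_def
proof (rule borel_measurable_res)
  have "(\<lambda>x. x p) \<in> borel_measurable P" if "p \<in> I" for p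
    using measurable_component_singleton[OF that, of "\<lambda>_. \<mu>"] measurable_cong_sets[OF refl \<mu>.events_eq_borel, of P]
    by blast
  then show "(\<lambda>x. hmat n A x i j) \<in> borel_measurable P" for i j
    unfolding hmat_def by (intro borel_measurable_add borel_measurable_const borel_measurable_sum borel_measurable_times
      borel_measurable_of_real) auto
qed

lemma measurable_mm:
  assumes "\<And>i j. (\<lambda>x. X x i j) \<in> borel_measurable P" "\<And>i j. (\<lambda>x. Y x i j) \<in> borel_measurable P"
  shows "(\<lambda>x. mm n (X x) (Y x) i j) \<in> borel_measurable P"
  unfolding mm_def by (intro borel_measurable_sum borel_measurable_times assms)

lemma measurable_tr:
  assumes "\<And>i j. (\<lambda>x. X x i j) \<in> borel_measurable P"
  shows "(\<lambda>x. tr n (X x)) \<in> borel_measurable P"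
  unfolding tr_def by (intro borel_measurable_sum assms)

lemma measurable_word:
  "(\<lambda>x. word n (G x) E (mm n (G x) F) k i j) \<in> borel_measurable P"
  by (induction k arbitrary: i j) (auto intro!: measurable_mm)

lemma measurable_tword: "tword F p k \<in> borel_measurable P"
  unfolding tword_def by (intro borel_measurable_times borel_measurable_const measurable_tr measurable_mm measurable_word)

lemma norm_tr_GF_le: "norm (tr n (mm n (G x) F)) \<le> K * (\<Sum>i<n. vnorm n (\<lambda>k. F k i))"
  unfolding tr_def sum_distrib_left using norm_GF_le by (intro sum_norm_le) auto

text \<open>By cyclicity \<open>tr (G D G F) = tr (D G (F G))\<close>, so the gradient of a
  resolvent trace is again of the form \<open>tword\<close>.\<close>

lemma tr_slice_derivative:
  assumes p: "p \<in> I"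
  shows "((\<lambda>s. tr n (mm n (G (x(p := s))) F)) has_vector_derivative tword (mm n F (G (x(p := t)))) p 0 (x(p := t))) (at t)"
proof -
  have "((\<lambda>s. mm n (G (x(p := s))) F i j) has_vector_derivative
      mm n (mm n (mm n (G (x(p := t))) (D p)) (G (x(p := t)))) F i j + mm n (G (x(p := t))) (\<lambda>i j. 0) i j) (at t)" for i j
    by (intro has_vector_derivative_mm has_vector_derivative_G p has_vector_derivative_const)
  then have "((\<lambda>s. tr n (mm n (G (x(p := s))) F)) has_vector_derivative
      tr n (\<lambda>i j. mm n (mm n (mm n (G (x(p := t))) (D p)) (G (x(p := t)))) F i j + mm n (G (x(p := t))) (\<lambda>i j. 0) i j)) (at t)"
    by (rule has_vector_derivative_tr)
  moreover have "tr n (\<lambda>i j. mm n (mm n (mm n g E) g) F i j + mm n g (\<lambda>i j. 0) i j) = tr n (mm n E (mm n g (mm n F g)))" for g E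
  proof -
    have "tr n (\<lambda>i j. mm n (mm n (mm n g E) g) F i j + mm n g (\<lambda>i j. 0) i j) = tr n (mm n (mm n (mm n g E) g) F)"
      by (simp add: tr_def mm_def[of n g "\<lambda>i j. 0"])
    also have "\<dots> = tr n (mm n g (mm n E (mm n g F)))" by (simp add: mm_assoc)
    also have "\<dots> = tr n (mm n (mm n E (mm n g F)) g)" by (rule tr_mm_commute)
    finally show ?thesis by (simp add: mm_assoc)
  qed
  ultimately show ?thesis by (simp only: tword_def word.simps fact_0 mult_1_left)
qed

text \<open>Bounds the squared gradient. Each entry of \<open>G X\<close> is read only by the
  coordinates at its position and at the transposed one, so the sum over all coordinates collapses
  to one Hilbert-Schmidt norm.\<close>

lemma sum_tword0_sq_le:
  "(\<Sum>p\<in>I. (norm (tword X p 0 x))\<^sup>2) \<le> 2 / n * hs n (mm n (G x) X)"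
proof -
  let ?N = "mm n (G x) X"
  have "(norm (tword X (a, b) 0 x))\<^sup>2 \<le> ((norm (?N b a))\<^sup>2 + (norm (?N a b))\<^sup>2) / n" if "a < n" "b < n" for a b
  proof -
    have e: "norm (complex_of_real (sqrt n)) = sqrt n" by simp
    have "norm (tword X (a, b) 0 x) = norm (dcoef (a, b) * ?N b a + cnj (dcoef (a, b)) * ?N a b) / sqrt n"
      unfolding tword_def using tr_dmat[OF that, of ?N] by (simp add: norm_divide)
    also have "\<dots> \<le> (norm (?N b a) + norm (?N a b)) / sqrt 2 / sqrt n"
      by (intro divide_right_mono norm_dcoef_comb) simp
    finally have "(norm (tword X (a, b) 0 x))\<^sup>2 \<le> ((norm (?N b a) + norm (?N a b)) / sqrt 2 / sqrt n)\<^sup>2"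
      by (intro power_mono) auto
    also have "\<dots> = (norm (?N b a) + norm (?N a b))\<^sup>2 / 2 / n" by (simp add: power_divide power_mult_distrib)
    also have "\<dots> \<le> (2 * ((norm (?N b a))\<^sup>2 + (norm (?N a b))\<^sup>2)) / 2 / n"
    proof (intro divide_right_mono)
      have "0 \<le> (norm (?N b a) - norm (?N a b))\<^sup>2" by simp
      then show "(norm (?N b a) + norm (?N a b))\<^sup>2 \<le> 2 * ((norm (?N b a))\<^sup>2 + (norm (?N a b))\<^sup>2)"
        by (simp add: power2_eq_square algebra_simps)
    qed auto
    also have "\<dots> = ((norm (?N b a))\<^sup>2 + (norm (?N a b))\<^sup>2) / n"
      by (subst nonzero_mult_div_cancel_left) auto
    finally show ?thesis .
  qed
  then have "(\<Sum>a<n. \<Sum>b<n. (norm (tword X (a, b) 0 x))\<^sup>2)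
      \<le> (\<Sum>a<n. \<Sum>b<n. ((norm (?N b a))\<^sup>2 + (norm (?N a b))\<^sup>2) / n)"
    by (intro sum_mono) auto
  also have "\<dots> = ((\<Sum>a<n. \<Sum>b<n. (norm (?N b a))\<^sup>2) + hs n ?N) / n"
    by (simp add: sum.distrib sum_divide_distrib[symmetric] hs_def)
  also have "(\<Sum>a<n. \<Sum>b<n. (norm (?N b a))\<^sup>2) = hs n ?N" unfolding hs_def by (rule sum.swap)
  finally show ?thesis by (simp add: sum.cartesian_product case_prod_unfold)
qed

text \<open>The squared gradient is at most \<open>2 / n * (K ^ 4 * hs n F)\<close> everywhere: the
  two factors \<open>G\<close> around \<open>F\<close> cost \<open>K\<^sup>2\<close> each. For
  \<open>F = 1\<close> the variance of the trace stays bounded, for bounded rank one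
  \<open>F\<close> it is \<open>O(1/n)\<close>.\<close>

lemma variance_tr_GF:
  "(\<integral>x. (norm (tr n (mm n (G x) F)))\<^sup>2 \<partial>P) - (norm (\<integral>x. tr n (mm n (G x) F) \<partial>P))\<^sup>2 \<le> 2 * C / n * K ^ 4 * hs n F"
proof -
  define f where "f x = tr n (mm n (G x) F)" for x
  define f' where "f' p x = tword (mm n F (G x)) p 0 x" for p x
  define S where "S = 2 / n * (K ^ 4 * hs n F)"
  have sum_le: "(\<Sum>p\<in>I. (norm (f' p x))\<^sup>2) \<le> S" for x
  proof -
    have "hs n (mm n (G x) (mm n F (G x))) \<le> K\<^sup>2 * hs n (mm n F (G x))"
      by (rule hs_mm_left[OF op_bounded_G K_nonneg])
    also have "\<dots> \<le> K\<^sup>2 * (K\<^sup>2 * hs n F)"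
      by (intro mult_left_mono hs_mm_right[OF op_bounded_G K_nonneg]) simp
    also have "\<dots> = K ^ 4 * hs n F" by (simp add: power_numeral_reduce)
    finally have "2 / n * hs n (mm n (G x) (mm n F (G x))) \<le> S"
      unfolding S_def by (intro mult_left_mono) auto
    then show ?thesis unfolding f'_def using sum_tword0_sq_le[of "mm n F (G x)" x] by linarith
  qed
  \<comment> \<open>Serves the boundedness hypothesis of \<open>poincare_product\<close>; the
    estimate itself uses the sum over all coordinates.\<close>
  have f'_le: "norm (f' p x) \<le> sqrt S" if "p \<in> I" for p x
  proof (rule real_le_rsqrt)
    have "(norm (f' p x))\<^sup>2 \<le> (\<Sum>p\<in>I. (norm (f' p x))\<^sup>2)"
      using that by (intro member_le_sum) auto
    then show "(norm (f' p x))\<^sup>2 \<le> S" using sum_le[of x] by linarith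
  qed
  define b where "b = K * (\<Sum>i<n. vnorm n (\<lambda>k. F k i)) + sqrt S"
  have S0: "0 \<le> S" unfolding S_def using hs_nonneg[of n F] by simp
  have B0: "0 \<le> K * (\<Sum>i<n. vnorm n (\<lambda>k. F k i))" using K_nonneg by (simp add: sum_nonneg)
  have f'm: "f' p \<in> borel_measurable P" for p
    unfolding f'_def tword_def word.simps
    by (intro borel_measurable_times borel_measurable_const measurable_tr measurable_mm measurable_G)
  have f'b: "norm (f' p x) \<le> b" if "p \<in> I" for p x
    unfolding b_def using f'_le[OF that, of x] B0 by linarith
  have "(\<integral>x. (norm (f x))\<^sup>2 \<partial>P) - (norm (\<integral>x. f x \<partial>P))\<^sup>2 \<le> C * (\<Sum>p\<in>I. \<integral>x. (norm (f' p x))\<^sup>2 \<partial>P)"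
  proof (rule poincare_product[OF real_distribution_\<mu> poincare])
    show "f \<in> borel_measurable P" unfolding f_def
      by (intro measurable_tr measurable_mm measurable_G borel_measurable_const)
    show "norm (f x) \<le> b" for x
      unfolding f_def b_def using norm_tr_GF_le[of x F] S0 real_sqrt_ge_zero[of S] by linarith
    show "((\<lambda>s. f (x(p := s))) has_vector_derivative f' p (x(p := s))) (at s)" if "p \<in> I" for p x s
      unfolding f_def f'_def by (rule tr_slice_derivative[OF that])
    show "continuous_on UNIV (\<lambda>s. f' p (x(p := s)))" if "p \<in> I" for p x
      unfolding f'_def tword_def word.simps tr_def mm_def
      by (intro continuous_intros continuous_G that)
  qed (use f'm f'b in auto)
  also have "(\<Sum>p\<in>I. \<integral>x. (norm (f' p x))\<^sup>2 \<partial>P) = (\<integral>x. (\<Sum>p\<in>I. (norm (f' p x))\<^sup>2) \<partial>P)"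
  proof (rule Bochner_Integration.integral_sum[symmetric])
    fix p assume p: "p \<in> I"
    show "integrable P (\<lambda>x. (norm (f' p x))\<^sup>2)"
      using f'm f'b[OF p] by (intro iid.integrable_law_bounded[where b = "b\<^sup>2"] sq_norm_bound) auto
  qed
  also have "\<dots> \<le> S"
  proof -
    have "norm (\<integral>x. (\<Sum>p\<in>I. (norm (f' p x))\<^sup>2) \<partial>P) \<le> S"
      using sum_le S0 by (intro P.norm_integral_le_const) (auto simp: sum_nonneg)
    then show ?thesis by simp
  qed
  finally show ?thesis using C_pos by (simp add: f_def S_def mult_ac)
qed

end

section \<open>The fourth order term\<close>

lemma norm_mult_le: "norm (x :: complex) \<le> a \<Longrightarrow> norm y \<le> b \<Longrightarrow> norm (x * y) \<le> a * b"
  unfolding norm_mult by (rule mult_mono') auto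

lemma norm_add_le: "norm (x :: complex) \<le> a \<Longrightarrow> norm y \<le> b \<Longrightarrow> norm (x + y) \<le> a + b"
  by (rule norm_triangle_mono)

text \<open>The trace of \<open>(D G)\<^sup>3 D M\<close> for the matrices \<open>D = [[0, \<alpha>], [\<beta>, 0]]\<close>, \<open>G = [[X, U], [V, Y]]\<close> and
  \<open>M = [[P, R], [S, Q]]\<close>. Up to a matrix whose entries are divisible by \<open>U\<close> or \<open>V\<close>, \<open>(D G)\<^sup>2\<close> is the
  scalar matrix \<open>\<alpha> \<beta> X Y\<close>.\<close>

lemma quartic_word_bound:
  fixes \<alpha> \<beta> X Y U V P Q R S :: complex
  assumes ab: "norm \<alpha> \<le> 1" "norm \<beta> \<le> 1"
    and K: "norm X \<le> K" "norm Y \<le> K" "norm U \<le> K" "norm V \<le> K"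
  defines "step \<equiv> \<lambda>(p, q, r, s). (\<alpha> * X * s + \<beta> * U * p, \<alpha> * V * q + \<beta> * Y * r, \<alpha> * X * q + \<beta> * U * r, \<alpha> * V * s + \<beta> * Y * p)"
  shows "norm ((case step (step (step (P, Q, R, S))) of (p, q, r, s) \<Rightarrow> \<alpha> * s + \<beta> * r)
      - (\<alpha> * \<beta>)\<^sup>2 * (X * Y * (Y * P + X * Q)))
    \<le> 3 * K\<^sup>2 * ((norm U + norm V) * (norm R + norm S)) + 2 * K * ((norm U + norm V)\<^sup>2 * (norm P + norm Q))"
proof -
  \<comment> \<open>The trace of \<open>D G\<close>. By Cayley-Hamilton
    \<open>(D G)^2 = w D G + \<alpha> \<beta> (X Y - U V)\<close>, and \<open>w\<close> is as small
    as the off-diagonal entries of \<open>G\<close>.\<close>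
  define w where "w = \<alpha> * V + \<beta> * U"
  define g where "g = norm U + norm V"
  have g: "norm U \<le> g" "norm V \<le> g" by (auto simp: g_def)
  have w: "norm w \<le> g"
  proof -
    have "norm w \<le> 1 * norm V + 1 * norm U"
      unfolding w_def by (intro norm_add_le norm_mult_le ab order_refl)
    then show ?thesis by (simp add: g_def)
  qed
  \<comment> \<open>The first two summands are what the scalar
    \<open>\<alpha> * \<beta> * X * Y\<close> contributes beyond the main term. The other four are
    the trace of the remainder of \<open>(D G)^2\<close>, with rows
    \<open>(\<alpha> \<alpha> V V, \<alpha> Y w)\<close> and
    \<open>(\<beta> X w, \<beta> \<beta> U U)\<close>, against \<open>D G D M\<close>.\<close>
  have eq: "(case step (step (step (P, Q, R, S))) of (p, q, r, s) \<Rightarrow> \<alpha> * s + \<beta> * r)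
      - (\<alpha> * \<beta>)\<^sup>2 * (X * Y * (Y * P + X * Q))
    = (\<alpha> * \<beta> * X * Y) * (\<alpha> * \<alpha> * V * S) + (\<alpha> * \<beta> * X * Y) * (\<beta> * \<beta> * U * R)
      + (\<alpha> * \<alpha> * V * V * \<alpha> * V + \<alpha> * Y * w * \<beta> * X) * (\<alpha> * S)
      + (\<alpha> * \<alpha> * V * V * \<alpha> * Y + \<alpha> * Y * w * \<beta> * U) * (\<beta> * P)
      + (\<beta> * X * w * \<alpha> * V + \<beta> * \<beta> * U * U * \<beta> * X) * (\<alpha> * Q)
      + (\<beta> * X * w * \<alpha> * Y + \<beta> * \<beta> * U * U * \<beta> * U) * (\<beta> * R)"
    unfolding step_def w_def by (simp add: power2_eq_square algebra_simps)
  have "norm ((case step (step (step (P, Q, R, S))) of (p, q, r, s) \<Rightarrow> \<alpha> * s + \<beta> * r)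
      - (\<alpha> * \<beta>)\<^sup>2 * (X * Y * (Y * P + X * Q)))
    \<le> (1 * 1 * K * K) * (1 * 1 * g * norm S) + (1 * 1 * K * K) * (1 * 1 * g * norm R)
      + (1 * 1 * K * K * 1 * g + 1 * K * g * 1 * K) * (1 * norm S)
      + (1 * 1 * g * g * 1 * K + 1 * K * g * 1 * g) * (1 * norm P)
      + (1 * K * g * 1 * g + 1 * 1 * g * g * 1 * K) * (1 * norm Q)
      + (1 * K * g * 1 * K + 1 * 1 * K * K * 1 * g) * (1 * norm R)"
    unfolding eq by (intro norm_add_le norm_mult_le ab K g w order_refl)
  also have "\<dots> = 3 * K\<^sup>2 * (g * (norm R + norm S)) + 2 * K * (g\<^sup>2 * (norm P + norm Q))"
    by (simp add: power2_eq_square algebra_simps)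
  finally show ?thesis unfolding g_def .
qed

context deformed_resolvent
begin

text \<open>Off the diagonal the phase of \<open>dcoef\<close> drops out, since only the square of
  \<open>\<alpha> * \<beta> = 1/2\<close> enters the main term; real and imaginary coordinates
  contribute equally, in contrast to second order. Division by 6 removes the \<open>3!\<close> in
  \<open>tword\<close>.\<close>

lemma tword3_bound:
  fixes F :: "nat \<Rightarrow> nat \<Rightarrow> complex"
  assumes ab: "a < n" "b < n"
  defines "M \<equiv> \<lambda>x. mm n (G x) F"
  shows "norm ((real n)\<^sup>2 * tword F (a, b) 3 x / 6
       - (G x b b)\<^sup>2 * G x a a * M x a a / 4 - (G x a a)\<^sup>2 * G x b b * M x b b / 4)
    \<le> 3 * K\<^sup>2 * ((norm (G x a b) + norm (G x b a)) * (norm (M x a b) + norm (M x b a)))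
      + 2 * K * ((norm (G x a b) + norm (G x b a))\<^sup>2 * (norm (M x a a) + norm (M x b b)))
      + (if a = b then K ^ 3 * norm (M x a a) else 0)"
proof -
  let ?\<alpha> = "dcoef (a, b)" and ?\<beta> = "cnj (dcoef (a, b))"
  let ?X = "G x a a" and ?Y = "G x b b" and ?U = "G x a b" and ?V = "G x b a"
  define step where "step = (\<lambda>(p, q, r, s). (?\<alpha> * ?X * s + ?\<beta> * ?U * p, ?\<alpha> * ?V * q + ?\<beta> * ?Y * r,
     ?\<alpha> * ?X * q + ?\<beta> * ?U * r, ?\<alpha> * ?V * s + ?\<beta> * ?Y * p))"
  define entries where "entries N = (N a a, N b b, N a b, N b a)" for N :: "nat \<Rightarrow> nat \<Rightarrow> complex"
  define rt where "rt = complex_of_real (sqrt n)"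
  have rt: "rt * rt = of_nat n" unfolding rt_def by (simp flip: of_real_mult)
  have rt0: "rt \<noteq> 0" using n_pos by (simp add: rt_def)
  define scale where "scale = (\<lambda>(c :: complex) (p, q, r, s). (p / c, q / c, r / c, s / c :: complex))"
  have st: "entries (mm n (mm n (G x) (D (a, b))) N) = scale rt (step (entries N))" for N
    unfolding entries_def step_def scale_def mm_dmat[OF ab] by (simp add: rt_def)
  have ss: "step (scale c t) = scale c (step t)" for c t
    by (cases t) (simp add: step_def scale_def add_divide_distrib)
  have sc: "scale c (scale c' t) = scale (c * c') t" for c c' t
    by (cases t) (simp add: scale_def divide_divide_eq_left mult.commute)
  let ?w = "word n (G x) (D (a, b)) (M x)"
  have w3: "entries (?w 3) = scale (rt * (rt * rt)) (step (step (step (entries (M x)))))"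
    by (simp add: numeral_3_eq_3 st ss sc mult.assoc)
  define q where "q = (case step (step (step (entries (M x)))) of (p, q, r, s) \<Rightarrow> ?\<alpha> * s + ?\<beta> * r)"
  have "tr n (mm n (D (a, b)) (?w 3)) = (?\<alpha> * ?w 3 b a + ?\<beta> * ?w 3 a b) / rt"
    unfolding tr_dmat[OF ab] rt_def ..
  also have "?\<alpha> * ?w 3 b a + ?\<beta> * ?w 3 a b = (case entries (?w 3) of (p, q, r, s) \<Rightarrow> ?\<alpha> * s + ?\<beta> * r)"
    by (simp add: entries_def)
  also have "\<dots> = q / (rt * (rt * rt))"
    unfolding w3 q_def by (cases "step (step (step (entries (M x))))") (simp add: scale_def add_divide_distrib)
  finally have "tr n (mm n (D (a, b)) (?w 3)) = q / (of_nat n)\<^sup>2"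
    by (simp add: power2_eq_square mult.assoc flip: rt)
  then have tw: "(real n)\<^sup>2 * tword F (a, b) 3 x / 6 = q"
    using n_pos unfolding tword_def M_def by (simp add: fact_numeral)
  have K': "norm ?X \<le> K" "norm ?Y \<le> K" "norm ?U \<le> K" "norm ?V \<le> K" using G_entry ab by auto
  have d1: "norm ?\<alpha> \<le> 1" using norm_dcoef_le[of "(a, b)"] by (rule order_trans) simp
  then have d2: "norm ?\<beta> \<le> 1" by simp
  note bound = quartic_word_bound[OF d1 d2 K', of "M x a a" "M x b b" "M x a b" "M x b a",
    folded step_def, folded entries_def, folded q_def]
  show ?thesis
  proof (cases "a = b")
    case False
    have c: "?\<alpha> * ?\<beta> = 1 / 2" using norm_dcoef[of "(a, b)"] False by simp
    have "(?\<alpha> * ?\<beta>)\<^sup>2 * (?X * ?Y * (?Y * M x a a + ?X * M x b b))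
        = ?Y\<^sup>2 * ?X * M x a a / 4 + ?X\<^sup>2 * ?Y * M x b b / 4"
      unfolding c by (simp add: power2_eq_square algebra_simps)
    then show ?thesis using bound False unfolding tw by (simp add: diff_diff_eq)
  next
    case True
    \<comment> \<open>For \<open>a = b\<close> the two halves of \<open>dmat\<close> coincide, so
      the word is exact. The two quarter terms account for one half of it, and the last summand of
      the bound pays for the rest.\<close>
    have "q = ?X ^ 3 * M x a a"
      unfolding q_def step_def entries_def True by (simp add: dcoef_def power_numeral_reduce field_simps)
    then have "q - ?Y\<^sup>2 * ?X * M x a a / 4 - ?X\<^sup>2 * ?Y * M x b b / 4 = (1 / 2) * (?X ^ 3 * M x a a)"
      unfolding True by (simp add: power_numeral_reduce field_simps)
    also have "norm \<dots> \<le> 1 * (K ^ 3 * norm (M x a a))"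
      unfolding norm_mult norm_power using K'(1) K_nonneg by (intro mult_mono power_mono) auto
    finally have f: "norm (q - ?Y\<^sup>2 * ?X * M x a a / 4 - ?X\<^sup>2 * ?Y * M x b b / 4) \<le> 1 * (K ^ 3 * norm (M x a a))" .
    have "0 \<le> 3 * K\<^sup>2 * ((norm ?U + norm ?V) * (norm (M x a b) + norm (M x b a)))"
      "0 \<le> 2 * K * ((norm ?U + norm ?V)\<^sup>2 * (norm (M x a a) + norm (M x b b)))"
      using K_nonneg by (intro mult_nonneg_nonneg add_nonneg_nonneg; simp)+
    with f show ?thesis unfolding tw if_P[OF True] by linarith
  qed
qed

text \<open>The main terms of \<open>tword3_bound\<close> summed over all coordinates: each ordered
  product occurs twice with weight 1/4, hence the factor 1/2.\<close>

definition quart where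
  "quart F x = (\<Sum>i<n. \<Sum>j<n. (G x j j)\<^sup>2 * G x i i * mm n (G x) F i i) / (2 * (of_nat n)\<^sup>2)"

lemma vnorm_GF_col_le: "vnorm n (\<lambda>i. mm n (G x) F i j) \<le> K * vnorm n (\<lambda>i. F i j)"
  unfolding mm_def by (rule op_bounded_apply[OF op_bounded_G K_nonneg])

text \<open>Cauchy-Schwarz along each column uses that rows and columns of \<open>G\<close> have
  norm at most \<open>K\<close>. Entrywise bounds would lose a factor growing with
  \<open>n\<close>.\<close>

lemma sum_offdiag_le:
  "(\<Sum>a<n. \<Sum>b<n. (norm (G x a b) + norm (G x b a)) * (norm (mm n (G x) F a b) + norm (mm n (G x) F b a)))
    \<le> 4 * K\<^sup>2 * (\<Sum>i<n. vnorm n (\<lambda>k. F k i))"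
proof -
  let ?M = "mm n (G x) F"
  let ?h = "\<lambda>a b. (norm (G x a b) + norm (G x b a)) * norm (?M a b)"
  have "(\<Sum>a<n. \<Sum>b<n. (norm (G x a b) + norm (G x b a)) * (norm (?M a b) + norm (?M b a)))
      = (\<Sum>a<n. \<Sum>b<n. ?h a b) + (\<Sum>a<n. \<Sum>b<n. ?h b a)"
    by (simp add: distrib_left add.commute sum.distrib)
  also have "\<dots> = 2 * (\<Sum>b<n. \<Sum>a<n. ?h a b)"
    using sum.swap[of ?h "{..<n}" "{..<n}"] by simp
  also have "\<dots> \<le> 2 * (\<Sum>b<n. 2 * K\<^sup>2 * vnorm n (\<lambda>k. F k b))"
  proof (intro mult_left_mono)
    show "(\<Sum>b<n. \<Sum>a<n. ?h a b) \<le> (\<Sum>b<n. 2 * K\<^sup>2 * vnorm n (\<lambda>k. F k b))"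
  proof (intro sum_mono)
    fix b assume "b \<in> {..<n}"
    then have b: "b < n" by simp
    have "(\<Sum>a<n. ?h a b) = (\<Sum>a<n. norm (G x a b) * norm (?M a b)) + (\<Sum>a<n. norm (G x b a) * norm (?M a b))"
      by (simp add: distrib_right sum.distrib)
    also have "\<dots> \<le> vnorm n (\<lambda>a. G x a b) * vnorm n (\<lambda>a. ?M a b) + vnorm n (\<lambda>a. G x b a) * vnorm n (\<lambda>a. ?M a b)"
      by (intro add_mono vnorm_cauchy_schwarz)
    also have "\<dots> \<le> K * (K * vnorm n (\<lambda>k. F k b)) + K * (K * vnorm n (\<lambda>k. F k b))"
      using K_nonneg by (intro add_mono mult_mono op_bounded_col[OF op_bounded_G K_nonneg b]
        op_bounded_row[OF op_bounded_G K_nonneg b] vnorm_GF_col_le) auto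
    finally show "(\<Sum>a<n. ?h a b) \<le> 2 * K\<^sup>2 * vnorm n (\<lambda>k. F k b)" by (simp add: power2_eq_square mult.assoc)
  qed
  qed simp
  finally show ?thesis unfolding sum_distrib_left[symmetric] by simp
qed

text \<open>For fixed \<open>a\<close>, the squares of the entries in row and column
  \<open>a\<close> of \<open>G\<close> sum to at most \<open>2 * K\<^sup>2\<close>, independently of
  \<open>n\<close>.\<close>

lemma sum_diag_le:
  "(\<Sum>a<n. \<Sum>b<n. (norm (G x a b) + norm (G x b a))\<^sup>2 * (norm (mm n (G x) F a a) + norm (mm n (G x) F b b)))
    \<le> 8 * K ^ 3 * (\<Sum>i<n. vnorm n (\<lambda>k. F k i))"
proof -
  let ?M = "mm n (G x) F"
  let ?g = "\<lambda>a b. (norm (G x a b) + norm (G x b a))\<^sup>2"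
  have "(\<Sum>a<n. \<Sum>b<n. ?g a b * (norm (?M a a) + norm (?M b b)))
      = (\<Sum>a<n. \<Sum>b<n. ?g a b * norm (?M a a)) + (\<Sum>a<n. \<Sum>b<n. ?g b a * norm (?M b b))"
    by (simp add: distrib_left add.commute sum.distrib)
  also have "\<dots> = 2 * (\<Sum>a<n. \<Sum>b<n. ?g a b * norm (?M a a))"
    using sum.swap[of "\<lambda>a b. ?g a b * norm (?M a a)" "{..<n}" "{..<n}"] by simp
  also have "\<dots> \<le> 2 * (\<Sum>a<n. 4 * K\<^sup>2 * (K * vnorm n (\<lambda>k. F k a)))"
  proof (intro mult_left_mono)
    show "(\<Sum>a<n. \<Sum>b<n. ?g a b * norm (?M a a)) \<le> (\<Sum>a<n. 4 * K\<^sup>2 * (K * vnorm n (\<lambda>k. F k a)))"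
  proof (intro sum_mono)
    fix a assume "a \<in> {..<n}"
    then have a: "a < n" by simp
    have "(\<Sum>b<n. ?g a b) \<le> (\<Sum>b<n. 2 * (norm (G x a b))\<^sup>2 + 2 * (norm (G x b a))\<^sup>2)"
    proof (intro sum_mono)
      fix b
      have "0 \<le> (norm (G x a b) - norm (G x b a))\<^sup>2" by simp
      then show "?g a b \<le> 2 * (norm (G x a b))\<^sup>2 + 2 * (norm (G x b a))\<^sup>2"
        by (simp add: power2_eq_square algebra_simps)
    qed
    also have "\<dots> = 2 * (vnorm n (\<lambda>b. G x a b))\<^sup>2 + 2 * (vnorm n (\<lambda>b. G x b a))\<^sup>2"
      by (simp add: sum.distrib vnorm_sq sum_distrib_left)
    also have "\<dots> \<le> 2 * K\<^sup>2 + 2 * K\<^sup>2"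
      using a by (intro add_mono mult_left_mono power_mono op_bounded_col[OF op_bounded_G K_nonneg]
        op_bounded_row[OF op_bounded_G K_nonneg]) auto
    finally have "(\<Sum>b<n. ?g a b) * norm (?M a a) \<le> 4 * K\<^sup>2 * (K * vnorm n (\<lambda>k. F k a))"
      using norm_GF_le[OF a] by (intro mult_mono) auto
    then show "(\<Sum>b<n. ?g a b * norm (?M a a)) \<le> 4 * K\<^sup>2 * (K * vnorm n (\<lambda>k. F k a))"
      by (simp add: sum_distrib_right)
  qed
  qed simp
  finally show ?thesis unfolding sum_distrib_left[symmetric] by (simp add: power_numeral_reduce mult.assoc)
qed

text \<open>The constant is \<open>29 = 3 * 4 + 2 * 8 + 1\<close>, from the off-diagonal terms, the
  squared off-diagonal terms and the coordinates with \<open>a = b\<close>.\<close>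

lemma sum_tword3_bound:
  "norm ((\<Sum>p\<in>I. tword F p 3 x) / 6 - quart F x) \<le> 29 * K ^ 4 / (real n)\<^sup>2 * (\<Sum>i<n. vnorm n (\<lambda>k. F k i))"
proof -
  let ?M = "mm n (G x) F" and ?\<Phi> = "\<Sum>i<n. vnorm n (\<lambda>k. F k i)"
  let ?q = "\<lambda>i j. (G x j j)\<^sup>2 * G x i i * ?M i i"
  let ?d = "\<lambda>a b. (real n)\<^sup>2 * tword F (a, b) 3 x / 6 - ?q a b / 4 - ?q b a / 4"
  have q: "(real n)\<^sup>2 * quart F x = (\<Sum>a<n. \<Sum>b<n. ?q a b / 4 + ?q b a / 4)"
  proof -
    have "(\<Sum>a<n. \<Sum>b<n. ?q b a / 4) = (\<Sum>a<n. \<Sum>b<n. ?q a b / 4)" by (rule sum.swap)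
    then have "(\<Sum>a<n. \<Sum>b<n. ?q a b / 4 + ?q b a / 4) = (\<Sum>a<n. \<Sum>b<n. ?q a b) / 2"
      by (simp add: sum.distrib sum_divide_distrib[symmetric])
    then show ?thesis using n_pos by (simp add: quart_def)
  qed
  have t: "(real n)\<^sup>2 * ((\<Sum>p\<in>I. tword F p 3 x) / 6) = (\<Sum>a<n. \<Sum>b<n. (real n)\<^sup>2 * tword F (a, b) 3 x / 6)"
    unfolding sum.cartesian_product by (simp add: sum_distrib_left sum_divide_distrib case_prod_unfold)
  have "(real n)\<^sup>2 * ((\<Sum>p\<in>I. tword F p 3 x) / 6 - quart F x) = (\<Sum>a<n. \<Sum>b<n. ?d a b)"
    unfolding right_diff_distrib q t sum_subtractf[symmetric] by (simp add: diff_diff_eq)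
  then have "norm (complex_of_real ((real n)\<^sup>2) * ((\<Sum>p\<in>I. tword F p 3 x) / 6 - quart F x)) = norm (\<Sum>a<n. \<Sum>b<n. ?d a b)"
    by (rule arg_cong)
  then have "(real n)\<^sup>2 * norm ((\<Sum>p\<in>I. tword F p 3 x) / 6 - quart F x) = norm (\<Sum>a<n. \<Sum>b<n. ?d a b)"
    unfolding norm_mult norm_of_real abs_power2 .
  also have "\<dots> \<le> (\<Sum>a<n. \<Sum>b<n. 3 * K\<^sup>2 * ((norm (G x a b) + norm (G x b a)) * (norm (?M a b) + norm (?M b a)))
      + 2 * K * ((norm (G x a b) + norm (G x b a))\<^sup>2 * (norm (?M a a) + norm (?M b b)))
      + (if a = b then K ^ 3 * norm (?M a a) else 0))"
    using tword3_bound by (intro sum_norm_le) auto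
  also have "\<dots> = 3 * K\<^sup>2 * (\<Sum>a<n. \<Sum>b<n. (norm (G x a b) + norm (G x b a)) * (norm (?M a b) + norm (?M b a)))
      + 2 * K * (\<Sum>a<n. \<Sum>b<n. (norm (G x a b) + norm (G x b a))\<^sup>2 * (norm (?M a a) + norm (?M b b)))
      + (\<Sum>a<n. K ^ 3 * norm (?M a a))"
    unfolding sum.distrib sum_distrib_left by simp
  also have "\<dots> \<le> 3 * K\<^sup>2 * (4 * K\<^sup>2 * ?\<Phi>) + 2 * K * (8 * K ^ 3 * ?\<Phi>) + (\<Sum>a<n. K ^ 3 * (K * vnorm n (\<lambda>k. F k a)))"
    using K_nonneg by (intro add_mono mult_left_mono sum_offdiag_le sum_diag_le sum_mono norm_GF_le) auto
  also have "\<dots> = 29 * K ^ 4 * ?\<Phi>"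
    unfolding sum_distrib_left[symmetric] by (simp add: power_numeral_reduce mult.assoc)
  finally show ?thesis using n_pos by (simp add: field_simps)
qed

end

section \<open>Expansion of the mean resolvent trace\<close>

text \<open>For \<open>y\<close> the column \<open>j\<close> of the resolvent,
  \<open>(z - H) y\<close> is a unit vector, so the quadratic form at \<open>y\<close> is the
  conjugate of the diagonal entry.\<close>

lemma Im_res_diag_nonpos:
  assumes "herm n H" "Im z > 0" "j < n"
  shows "Im (res n H z j j) \<le> 0"
proof -
  let ?y = "\<lambda>i. res n H z i j"
  have "z * ?y i - (\<Sum>k<n. H i k * ?y k) = (if i = j then 1 else 0)" if "i < n" for i
    using res_eq_right[OF assms(1,2) that assms(3)] by (simp add: mm_def)
  then have "(\<Sum>i<n. cnj (?y i) * (z * ?y i - (\<Sum>k<n. H i k * ?y k))) = (\<Sum>i<n. cnj (?y i) * (if i = j then 1 else 0))"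
    by (intro sum.cong refl) auto
  also have "\<dots> = cnj (?y j)" using assms(3) by (simp add: if_distrib[of "\<lambda>x. _ * x"] cong: if_cong)
  finally have "Im (cnj (?y j)) = Im z * (vnorm n ?y)\<^sup>2"
    using herm_quadratic_form[OF assms(1), of ?y z] by simp
  moreover have "0 \<le> Im z * (vnorm n ?y)\<^sup>2" using assms(2) by simp
  ultimately show ?thesis by simp
qed

text \<open>The weighted inequality \<open>2 u v \<le> r u^2 + v^2 / r\<close> replaces
  Cauchy-Schwarz: it avoids square roots, and \<open>r\<close> balances two variances of different
  orders in \<open>n\<close>.\<close>

lemma (in prob_space) norm_covariance_le:
  fixes X Y :: "'a \<Rightarrow> complex"
  assumes X: "X \<in> borel_measurable M" "\<And>x. norm (X x) \<le> b" and Y: "Y \<in> borel_measurable M" "\<And>x. norm (Y x) \<le> c"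
    and r: "r > 0"
  shows "norm ((\<integral>x. X x * Y x \<partial>M) - (\<integral>x. X x \<partial>M) * (\<integral>x. Y x \<partial>M))
    \<le> (r * ((\<integral>x. (norm (X x))\<^sup>2 \<partial>M) - (norm (\<integral>x. X x \<partial>M))\<^sup>2) + ((\<integral>x. (norm (Y x))\<^sup>2 \<partial>M) - (norm (\<integral>x. Y x \<partial>M))\<^sup>2) / r) / 2"
proof -
  define m where "m = (\<integral>x. X x \<partial>M)"
  define k where "k = (\<integral>x. Y x \<partial>M)"
  have b0: "0 \<le> b" "0 \<le> c" using X(2) Y(2) norm_ge_zero order_trans by blast+
  have iX: "integrable M X" using X by (intro integrable_const_bound[where B = b]) auto
  have iY: "integrable M Y" using Y by (intro integrable_const_bound[where B = c]) auto
  have iXY: "integrable M (\<lambda>x. X x * Y x)"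
    using X Y b0 by (intro integrable_const_bound[where B = "b * c"]) (auto simp: norm_mult intro!: mult_mono)
  have iX2: "integrable M (\<lambda>x. (norm (X x))\<^sup>2)"
    using X by (intro integrable_const_bound[where B = "b\<^sup>2"]) (auto simp: power_mono)
  have iY2: "integrable M (\<lambda>x. (norm (Y x))\<^sup>2)"
    using Y by (intro integrable_const_bound[where B = "c\<^sup>2"]) (auto simp: power_mono)
  note vX = variance_complex[OF X(1) iX2, folded m_def]
  note vY = variance_complex[OF Y(1) iY2, folded k_def]
  have eq: "(X x - m) * (Y x - k) = X x * Y x - m * Y x - k * X x + m * k" for x
    by (simp add: algebra_simps)
  have i: "integrable M (\<lambda>x. (X x - m) * (Y x - k))"
    unfolding eq using iX iY iXY by simp
  have "(\<integral>x. (X x - m) * (Y x - k) \<partial>M) = (\<integral>x. X x * Y x \<partial>M) - m * k"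
    unfolding eq using iX iY iXY prob_space by (simp add: m_def[symmetric] k_def[symmetric])
  then have "norm ((\<integral>x. X x * Y x \<partial>M) - m * k) \<le> (\<integral>x. norm ((X x - m) * (Y x - k)) \<partial>M)"
    by (metis integral_norm_bound)
  also have "\<dots> \<le> (\<integral>x. (r * (norm (X x - m))\<^sup>2 + (norm (Y x - k))\<^sup>2 / r) / 2 \<partial>M)"
  proof (rule integral_mono)
    show "integrable M (\<lambda>x. norm ((X x - m) * (Y x - k)))" using i by (rule Bochner_Integration.integrable_norm)
    show "integrable M (\<lambda>x. (r * (norm (X x - m))\<^sup>2 + (norm (Y x - k))\<^sup>2 / r) / 2)"
      using vX(2) vY(2) by simp
    fix x
    define u v where "u = norm (X x - m)" and "v = norm (Y x - k)"
    have "0 \<le> (r * u - v)\<^sup>2 / r" using r by simp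
    also have "\<dots> = r * u\<^sup>2 + v\<^sup>2 / r - 2 * (u * v)"
      using r by (simp add: power2_eq_square field_simps)
    finally show "norm ((X x - m) * (Y x - k)) \<le> (r * (norm (X x - m))\<^sup>2 + (norm (Y x - k))\<^sup>2 / r) / 2"
      unfolding norm_mult u_def v_def by simp
  qed
  also have "\<dots> = (r * (\<integral>x. (norm (X x - m))\<^sup>2 \<partial>M) + (\<integral>x. (norm (Y x - k))\<^sup>2 \<partial>M) / r) / 2"
    using vX(2) vY(2) by simp
  finally show ?thesis unfolding vX(1) vY(1) unfolding m_def k_def .
qed

section \<open>The comparison resolvent \<open>B\<close> and the linear identity\<close>

context deformed_wigner_law
begin

definition g where "g = (\<integral>x. tr n (G x) \<partial>P) / n"
definition w where "w = z - \<sigma>\<^sup>2 * g"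
definition B where "B = res n A w"
abbreviation \<kappa> where "\<kappa> \<equiv> cumulant \<mu> 4"

lemma norm_tr_G_le: "norm (tr n (G x)) \<le> n * K"
  unfolding tr_def using sum_norm_le[of "{..<n}" "\<lambda>i. G x i i" "\<lambda>_. K"] G_entry by simp

lemma integrable_tr_G: "integrable P (\<lambda>x. tr n (G x))"
  using norm_tr_G_le by (intro iid.integrable_law_bounded measurable_tr measurable_G)

lemma measurable_tr_GF: "(\<lambda>x. tr n (mm n (G x) F)) \<in> borel_measurable P"
  by (intro measurable_tr measurable_mm measurable_G borel_measurable_const)

lemma integrable_tr_GF: "integrable P (\<lambda>x. tr n (mm n (G x) F))"
  using norm_tr_GF_le by (intro iid.integrable_law_bounded measurable_tr_GF)

text \<open>A mean of diagonal resolvent entries has nonpositive imaginary part, so subtracting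
  \<open>\<sigma>\<^sup>2 * g\<close> raises \<open>z\<close>.\<close>

lemma Im_w: "Im w \<ge> Im z"
proof -
  have "Im (tr n (G x)) \<le> 0" for x
    unfolding tr_def G_def Im_sum using Im_res_diag_nonpos[OF hmat_herm[OF herm_A] Im_z] by (intro sum_nonpos) auto
  then have "(\<integral>x. Im (tr n (G x)) \<partial>P) \<le> (\<integral>x. 0 \<partial>P)"
    using integrable_tr_G by (intro integral_mono) auto
  then have "Im (\<integral>x. tr n (G x) \<partial>P) \<le> 0" using integral_Im[OF integrable_tr_G] by simp
  then have "Im g \<le> 0" by (simp add: g_def divide_nonpos_nonneg)
  then have "\<sigma>\<^sup>2 * Im g \<le> 0" by (simp add: mult_nonneg_nonpos)
  moreover have "Im w = Im z - \<sigma>\<^sup>2 * Im g" by (simp add: w_def flip: of_real_power)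
  ultimately show ?thesis by linarith
qed

lemma Im_w_pos: "Im w > 0" using Im_w Im_z by linarith

lemma op_bounded_B: "op_bounded n K B"
  unfolding op_bounded_def
proof (intro allI)
  fix u v
  have "op_bounded n (1 / Im w) B" unfolding B_def by (rule op_bounded_res[OF herm_A Im_w_pos])
  then have "norm (\<Sum>i<n. \<Sum>j<n. v i * B i j * u j) \<le> 1 / Im w * vnorm n v * vnorm n u" by (rule op_boundedD)
  also have "\<dots> \<le> K * vnorm n v * vnorm n u"
    unfolding K_def using Im_w Im_z by (intro mult_right_mono divide_left_mono) auto
  finally show "norm (\<Sum>i<n. \<Sum>j<n. v i * B i j * u j) \<le> K * vnorm n v * vnorm n u" .
qed

text \<open>Evaluate \<open>B (w - A) G\<close> twice: it is \<open>G\<close> because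
  \<open>B (w - A) = 1\<close>, and it is \<open>B\<close> plus corrections because
  \<open>(z - A - \<Delta>) G = 1\<close> and \<open>z - w = \<sigma>\<^sup>2 * g\<close>.\<close>

lemma G_expand:
  assumes "i < n" "j < n"
  defines "\<Delta> \<equiv> \<lambda>x i j. \<Sum>p\<in>I. complex_of_real (x p) * D p i j"
  shows "G x i j = B i j + mm n B (mm n (\<Delta> x) (G x)) i j - \<sigma>\<^sup>2 * g * mm n B (G x) i j"
proof -
  have l: "w * B i k = (if i = k then 1 else 0) + mm n B A i k" if "k < n" for k
    unfolding B_def by (rule res_eq_left[OF herm_A Im_w_pos assms(1) that])
  have r: "z * G x k j = (if k = j then 1 else 0) + mm n A (G x) k j + mm n (\<Delta> x) (G x) k j" if "k < n" for k
  proof -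
    have "z * G x k j = (if k = j then 1 else 0) + mm n (hmat n A x) (G x) k j"
      unfolding G_def by (rule res_eq_right[OF hmat_herm[OF herm_A] Im_z that assms(2)])
    also have "mm n (hmat n A x) (G x) k j = mm n A (G x) k j + mm n (\<Delta> x) (G x) k j"
      by (simp add: mm_def hmat_def \<Delta>_def distrib_right sum.distrib)
    finally show ?thesis by (simp add: add.assoc)
  qed
  have "(\<Sum>k<n. (w * B i k) * G x k j) = (\<Sum>k<n. (if i = k then 1 else 0) * G x k j + mm n B A i k * G x k j)"
    using l by (intro sum.cong refl) (simp add: distrib_right)
  also have "\<dots> = G x i j + mm n (mm n B A) (G x) i j"
    using assms(1) by (simp add: sum.distrib mm_def[of n "mm n B A"] if_distrib[of "\<lambda>x. x * _"] cong: if_cong)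
  finally have 1: "w * mm n B (G x) i j = G x i j + mm n (mm n B A) (G x) i j"
    by (simp add: mm_def[of n B "G x"] sum_distrib_left mult.assoc)
  have "(\<Sum>k<n. B i k * (z * G x k j)) = (\<Sum>k<n. B i k * (if k = j then 1 else 0) + B i k * mm n A (G x) k j + B i k * mm n (\<Delta> x) (G x) k j)"
    using r by (intro sum.cong refl) (simp add: distrib_left)
  also have "\<dots> = B i j + mm n B (mm n A (G x)) i j + mm n B (mm n (\<Delta> x) (G x)) i j"
    using assms(2) by (simp add: sum.distrib mm_def[of n B] if_distrib[of "\<lambda>x. _ * x"] cong: if_cong)
  finally have 2: "z * mm n B (G x) i j = B i j + mm n B (mm n A (G x)) i j + mm n B (mm n (\<Delta> x) (G x)) i j"
    by (simp add: mm_def[of n B "G x"] sum_distrib_left mult.left_commute)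
  have "w * mm n B (G x) i j = z * mm n B (G x) i j - \<sigma>\<^sup>2 * g * mm n B (G x) i j"
    by (simp add: w_def left_diff_distrib)
  then show ?thesis using 1 2 by (simp add: mm_assoc algebra_simps)
qed

lemma tr_expand:
  fixes E :: "nat \<Rightarrow> nat \<Rightarrow> complex"
  defines "F \<equiv> mm n E B"
  shows "tr n (mm n (G x) E) = tr n F + (\<Sum>p\<in>I. complex_of_real (x p) * tword F p 0 x) - \<sigma>\<^sup>2 * g * tr n (mm n (G x) F)"
proof -
  define \<Delta> where "\<Delta> = (\<lambda>i j. \<Sum>p\<in>I. complex_of_real (x p) * D p i j)"
  have "tr n (mm n E (G x)) = (\<Sum>i<n. \<Sum>k<n. E i k * (B k i + mm n B (mm n \<Delta> (G x)) k i - \<sigma>\<^sup>2 * g * mm n B (G x) k i))"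
    unfolding tr_def mm_def[of n E] \<Delta>_def using G_expand by (intro sum.cong refl arg_cong2[where f = "(*)"]) auto
  also have "\<dots> = tr n (mm n E B) + tr n (mm n E (mm n B (mm n \<Delta> (G x)))) - \<sigma>\<^sup>2 * g * tr n (mm n E (mm n B (G x)))"
    by (simp add: tr_def mm_def[of n E] distrib_left right_diff_distrib sum.distrib sum_subtractf sum_distrib_left mult.left_commute)
  also have "tr n (mm n E (mm n B (mm n \<Delta> (G x)))) = tr n (mm n \<Delta> (mm n (G x) F))"
  proof -
    have "mm n E (mm n B (mm n \<Delta> (G x))) = mm n F (mm n \<Delta> (G x))" by (simp add: F_def mm_assoc)
    then show ?thesis by (simp add: tr_mm_commute[of n F] mm_assoc)
  qed
  also have "tr n (mm n E (mm n B (G x))) = tr n (mm n (G x) F)"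
    using tr_mm_commute[of n "mm n E B" "G x"] by (simp add: F_def mm_assoc)
  finally show ?thesis
    unfolding tr_mm_commute[of n "G x" E] sum_tword0 F_def \<Delta>_def .
qed

lemma norm_tword_bounded: "p \<in> I \<Longrightarrow> \<exists>b. \<forall>x. norm (tword F p k x) \<le> b"
  using norm_tword_le by blast

lemma integrable_tword: "p \<in> I \<Longrightarrow> integrable P (tword F p k)"
  using norm_tword_bounded[of p F k] iid.integrable_law_bounded[OF measurable_tword] by metis

lemma integrable_coord_tword:
  assumes p: "p \<in> I"
  shows "integrable P (\<lambda>x. complex_of_real (x p) * tword F p 0 x)"
proof -
  obtain b where b: "\<And>x. norm (tword F p 0 x) \<le> b" using norm_tword_bounded[OF p] by blast
  have m: "(\<lambda>x. x p) \<in> measurable P \<mu>" by (rule measurable_component_singleton[OF p])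
  interpret R: product_prob_space "\<lambda>_::nat \<times> nat. \<mu>" I by unfold_locales
  have d: "distr P \<mu> (\<lambda>x. x p) = \<mu>" by (rule R.PiM_component[OF p])
  have "integrable \<mu> (\<lambda>x. x ^ 1)" by (rule wigner_law_integrable_power[OF law]) simp
  then have "integrable (distr P \<mu> (\<lambda>x. x p)) (\<lambda>x. x)" unfolding d by simp
  then have i: "integrable P (\<lambda>x. x p)" by (rule integrable_distr[OF m])
  have m': "(\<lambda>x. x p) \<in> borel_measurable P" using i by (rule borel_measurable_integrable)
  show ?thesis
  proof (rule Bochner_Integration.integrable_bound[where f = "\<lambda>x. b * x p"])
    show "integrable P (\<lambda>x. b * x p)" using i by simp
    show "(\<lambda>x. complex_of_real (x p) * tword F p 0 x) \<in> borel_measurable P"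
      by (intro borel_measurable_times measurable_compose[OF m' borel_measurable_of_real] measurable_tword)
    show "AE x in P. norm (complex_of_real (x p) * tword F p 0 x) \<le> norm (b * x p)"
    proof (rule AE_I2)
      fix x
      have "\<bar>x p\<bar> * norm (tword F p 0 x) \<le> \<bar>x p\<bar> * \<bar>b\<bar>"
        using b[of x] by (intro mult_left_mono) auto
      then show "norm (complex_of_real (x p) * tword F p 0 x) \<le> norm (b * x p)"
        by (simp add: norm_mult abs_mult mult.commute)
    qed
  qed
qed

lemma coordinate_expansion:
  assumes p: "p \<in> I"
  shows "norm ((\<integral>x. complex_of_real (x p) * tword F p 0 x \<partial>P)
      - (\<sigma>\<^sup>2 * (\<integral>x. tword F p 1 x \<partial>P) + \<kappa> / 6 * (\<integral>x. tword F p 3 x \<partial>P)))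
    \<le> expansion_const \<mu> \<sigma> * (960 * K ^ 6 / real n ^ 3 * fcol F p)"
proof -
  let ?c = "expansion_const \<mu> \<sigma> * (960 * K ^ 6 / real n ^ 3 * fcol F p)"
  let ?s = "\<lambda>x :: nat \<times> nat \<Rightarrow> real. \<integral>y. complex_of_real y * tword F p 0 (x(p := y)) \<partial>\<mu>"
  let ?a = "\<lambda>(k :: nat) (x :: nat \<times> nat \<Rightarrow> real). \<integral>y. tword F p k (x(p := y)) \<partial>\<mu>"
  have pw: "norm (?s x - (\<sigma>\<^sup>2 * ?a 1 x + \<kappa> / 6 * ?a 3 x)) \<le> ?c" for x :: "nat \<times> nat \<Rightarrow> real"
  proof -
    obtain b0 b1 b3 where b: "\<And>x. norm (tword F p 0 x) \<le> b0" "\<And>x. norm (tword F p 1 x) \<le> b1" "\<And>x. norm (tword F p 3 x) \<le> b3"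
      using norm_tword_bounded[OF p] by metis
    define b where "b = max b0 (max b1 b3)"
    have b': "norm (tword F p 0 x) \<le> b" "norm (tword F p 1 x) \<le> b" "norm (tword F p 3 x) \<le> b" for x
      unfolding b_def using b[of x] by linarith+
    have "norm ((\<integral>y. y *\<^sub>R tword F p 0 (x(p := y)) \<partial>\<mu>) - (\<sigma>\<^sup>2 *\<^sub>R ?a 1 x + (\<kappa> / 6) *\<^sub>R ?a 3 x)) \<le> ?c"
      by (rule wigner_law_cumulant_expansion[OF law, where t = "\<lambda>k s. tword F p k (x(p := s))"])
        (rule has_vector_derivative_tword[OF p] b' norm_tword5_le[OF p])+
    then show ?thesis by (simp add: scaleR_conv_of_real)
  qed
  have r0: "(\<integral>x. complex_of_real (x p) * tword F p 0 x \<partial>P) = (\<integral>x. ?s x \<partial>P)" "integrable P ?s"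
    using iid.integral_resample[OF p integrable_coord_tword[OF p, of F]] by simp_all
  have r: "(\<integral>x. tword F p k x \<partial>P) = (\<integral>x. ?a k x \<partial>P)" "integrable P (?a k)" for k
    using iid.integral_resample[OF p integrable_tword[OF p, of F k]] by simp_all
  have "(\<integral>x. ?s x \<partial>P) - (\<sigma>\<^sup>2 * (\<integral>x. ?a 1 x \<partial>P) + \<kappa> / 6 * (\<integral>x. ?a 3 x \<partial>P))
      = (\<integral>x. ?s x - (\<sigma>\<^sup>2 * ?a 1 x + \<kappa> / 6 * ?a 3 x) \<partial>P)"
    using r0(2) r(2)[of 1] r(2)[of 3] by simp
  also have "norm \<dots> \<le> ?c"
  proof (rule P.norm_integral_le_const[OF pw])
    show "0 \<le> ?c" using expansion_const_nonneg[of \<mu> \<sigma>] K_nonneg fcol_nonneg[of F p] by simp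
  qed
  finally show ?thesis unfolding r0(1) r(1) .
qed


definition unit_mat :: "nat \<Rightarrow> nat \<Rightarrow> complex" where "unit_mat i j = (if i = j then 1 else 0)"

lemma mm_unit_right: "j < n \<Longrightarrow> mm n X unit_mat i j = X i j"
  by (simp add: mm_def unit_mat_def if_distrib[of "\<lambda>x. _ * x"] cong: if_cong)

lemma mm_unit_left: "i < n \<Longrightarrow> mm n unit_mat X i j = X i j"
  by (simp add: mm_def unit_mat_def if_distrib[of "\<lambda>x. x * _"] cong: if_cong)

lemma tr_mm_unit: "tr n (mm n X unit_mat) = tr n X"
  unfolding tr_def by (simp add: mm_unit_right)

lemma hs_unit: "hs n unit_mat = n"
  by (simp add: hs_def unit_mat_def if_distrib[of norm] if_distrib[of "\<lambda>x. x\<^sup>2"] cong: if_cong)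

lemma covariance_bound:
  "norm ((\<integral>x. tr n (G x) / n * tr n (mm n (G x) F) \<partial>P) - g * (\<integral>x. tr n (mm n (G x) F) \<partial>P))
    \<le> C * K ^ 4 * (1 + hs n F / n) / n"
proof -
  define X where "X x = tr n (G x) / n" for x
  define Y where "Y x = tr n (mm n (G x) F)" for x
  let ?VX = "(\<integral>x. (norm (X x))\<^sup>2 \<partial>P) - (norm (\<integral>x. X x \<partial>P))\<^sup>2"
  let ?VY = "(\<integral>x. (norm (Y x))\<^sup>2 \<partial>P) - (norm (\<integral>x. Y x \<partial>P))\<^sup>2"
  have n0: "real n > 0" using n_pos by simp
  have gX: "(\<integral>x. X x \<partial>P) = g" by (simp add: X_def g_def)
  have VX: "?VX \<le> 2 * C * K ^ 4 / (real n)\<^sup>2"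
  proof -
    have "?VX = ((\<integral>x. (norm (tr n (mm n (G x) unit_mat)))\<^sup>2 \<partial>P) - (norm (\<integral>x. tr n (mm n (G x) unit_mat) \<partial>P))\<^sup>2) / (real n)\<^sup>2"
      unfolding tr_mm_unit X_def by (simp add: norm_divide power_divide diff_divide_distrib)
    also have "\<dots> \<le> (2 * C / n * K ^ 4 * hs n unit_mat) / (real n)\<^sup>2"
      by (intro divide_right_mono variance_tr_GF) simp
    also have "\<dots> = 2 * C * K ^ 4 / (real n)\<^sup>2" using n0 by (simp add: hs_unit)
    finally show ?thesis .
  qed
  have VY: "?VY \<le> 2 * C / n * K ^ 4 * hs n F" unfolding Y_def by (rule variance_tr_GF)
  \<comment> \<open>The weight is \<open>n\<close>: the normalized trace \<open>X\<close> has
    variance \<open>O(1/n^2)\<close>, while that of \<open>Y\<close> is only bounded by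
    \<open>hs n F / n\<close> up to constants.\<close>
  have "norm ((\<integral>x. X x * Y x \<partial>P) - (\<integral>x. X x \<partial>P) * (\<integral>x. Y x \<partial>P)) \<le> (real n * ?VX + ?VY / real n) / 2"
  proof (rule P.norm_covariance_le)
    show "X \<in> borel_measurable P" unfolding X_def
      by (intro borel_measurable_divide borel_measurable_const measurable_tr measurable_G)
    show "norm (X x) \<le> K" for x
      unfolding X_def using norm_tr_G_le[of x] n0 by (simp add: norm_divide field_simps)
    show "Y \<in> borel_measurable P" unfolding Y_def by (rule measurable_tr_GF)
    show "norm (Y x) \<le> K * (\<Sum>i<n. vnorm n (\<lambda>k. F k i))" for x unfolding Y_def by (rule norm_tr_GF_le)
  qed (rule n0)
  also have "\<dots> \<le> (real n * (2 * C * K ^ 4 / (real n)\<^sup>2) + (2 * C / n * K ^ 4 * hs n F) / real n) / 2"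
    using VX VY n0 by (intro divide_right_mono add_mono mult_left_mono) auto
  also have "\<dots> = C * K ^ 4 * (1 + hs n F / n) / n"
    using n0 by (simp add: power2_eq_square field_simps)
  finally show ?thesis unfolding gX unfolding X_def Y_def .
qed

definition \<Phi> where "\<Phi> F = (\<Sum>i<n. vnorm n (\<lambda>k. F k i))"

text \<open>The factor \<open>1920 = 2 * 960\<close> comes from the fifth derivative and the double
  count of columns in \<open>sum_fcol\<close>; 29 is the constant of
  \<open>sum_tword3_bound\<close>.\<close>

abbreviation c1 where "c1 \<equiv> 1920 * expansion_const \<mu> \<sigma> * K ^ 6 + 29 * \<bar>\<kappa>\<bar> * K ^ 4"

lemma integrable_quart: "integrable P (quart F)"
proof -
  have m: "(\<lambda>x. mm n (G x) F i i) \<in> borel_measurable P" for i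
    by (intro measurable_mm measurable_G borel_measurable_const)
  have i: "integrable P (\<lambda>x. (G x j j)\<^sup>2 * G x i i * mm n (G x) F i i)" if "i < n" "j < n" for i j
  proof (rule iid.integrable_law_bounded[where b = "K\<^sup>2 * K * (K * vnorm n (\<lambda>k. F k i))"])
    show "(\<lambda>x. (G x j j)\<^sup>2 * G x i i * mm n (G x) F i i) \<in> borel_measurable P"
      by (intro borel_measurable_times borel_measurable_power measurable_G m)
    show "norm ((G x j j)\<^sup>2 * G x i i * mm n (G x) F i i) \<le> K\<^sup>2 * K * (K * vnorm n (\<lambda>k. F k i))" for x
      unfolding norm_mult norm_power using that K_nonneg G_entry
      by (intro mult_mono power_mono norm_GF_le) auto
  qed
  show ?thesis unfolding quart_def
    by (intro integrable_divide Bochner_Integration.integrable_sum i) auto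
qed

text \<open>The test matrix \<open>E\<close> is left free: \<open>E = 1\<close> gives the expansion
  of \<open>g\<close>, rank one \<open>E\<close> the entries. The two error terms measure
  \<open>F\<close> by its Hilbert-Schmidt norm and by its column norms.\<close>

lemma master_estimate:
  fixes E :: "nat \<Rightarrow> nat \<Rightarrow> complex"
  defines "F \<equiv> mm n E B"
  shows "norm ((\<integral>x. tr n (mm n (G x) E) \<partial>P) - tr n F - \<kappa> * (\<integral>x. quart F x \<partial>P))
    \<le> \<sigma>\<^sup>2 * (C * K ^ 4 * (1 + hs n F / n) / n) + c1 / (real n)\<^sup>2 * \<Phi> F"
proof -
  let ?Y = "\<integral>x. tr n (mm n (G x) F) \<partial>P"
  define S0 where "S0 = (\<Sum>p\<in>I. \<integral>x. complex_of_real (x p) * tword F p 0 x \<partial>P)"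
  define T where "T k = (\<Sum>p\<in>I. \<integral>x. tword F p k x \<partial>P)" for k
  have n0: "real n > 0" using n_pos by simp
  have e: "(\<integral>x. tr n (mm n (G x) E) \<partial>P) = tr n F + S0 - \<sigma>\<^sup>2 * g * ?Y"
  proof -
    define X where "X x = (\<Sum>p\<in>I. complex_of_real (x p) * tword F p 0 x)" for x
    have i: "integrable P X"
      unfolding X_def by (intro Bochner_Integration.integrable_sum integrable_coord_tword)
    have s: "(\<integral>x. X x \<partial>P) = S0"
      unfolding S0_def X_def by (intro Bochner_Integration.integral_sum integrable_coord_tword)
    have "tr n (mm n (G x) E) = tr n F + X x - \<sigma>\<^sup>2 * g * tr n (mm n (G x) F)" for x
      unfolding X_def F_def by (rule tr_expand)
    then show ?thesis using i integrable_tr_GF[of F] s P.prob_space by simp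
  qed
  have T: "T k = (\<integral>x. (\<Sum>p\<in>I. tword F p k x) \<partial>P)" for k
    unfolding T_def by (intro Bochner_Integration.integral_sum[symmetric] integrable_tword)
  have b_0: "norm (S0 - (\<sigma>\<^sup>2 * T 1 + \<kappa> / 6 * T 3)) \<le> 1920 * expansion_const \<mu> \<sigma> * K ^ 6 / (real n)\<^sup>2 * \<Phi> F"
  proof -
    have "S0 - (\<sigma>\<^sup>2 * T 1 + \<kappa> / 6 * T 3) = (\<Sum>p\<in>I. (\<integral>x. complex_of_real (x p) * tword F p 0 x \<partial>P)
      - (\<sigma>\<^sup>2 * (\<integral>x. tword F p 1 x \<partial>P) + \<kappa> / 6 * (\<integral>x. tword F p 3 x \<partial>P)))"
      unfolding S0_def T_def by (simp only: sum_subtractf sum.distrib sum_distrib_left)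
    then have "norm (S0 - (\<sigma>\<^sup>2 * T 1 + \<kappa> / 6 * T 3)) \<le> (\<Sum>p\<in>I. expansion_const \<mu> \<sigma> * (960 * K ^ 6 / real n ^ 3 * fcol F p))"
      by (simp only:) (intro sum_norm_le coordinate_expansion)
    also have "\<dots> = expansion_const \<mu> \<sigma> * (960 * K ^ 6 / real n ^ 3 * (2 * real n * \<Phi> F))"
      unfolding \<Phi>_def by (subst sum_distrib_left[symmetric], subst sum_distrib_left[symmetric], subst sum_fcol) (rule refl)
    also have "\<dots> = 1920 * expansion_const \<mu> \<sigma> * K ^ 6 / (real n)\<^sup>2 * \<Phi> F"
    proof -
      have "real n ^ 3 = (real n)\<^sup>2 * real n" by (simp add: power_numeral_reduce)
      then show ?thesis using n0 by simp
    qed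
    finally show ?thesis .
  qed
  have b1: "norm (T 1 - g * ?Y) \<le> C * K ^ 4 * (1 + hs n F / n) / n"
    unfolding T sum_tword1 by (rule covariance_bound)
  have b3: "norm (T 3 / 6 - (\<integral>x. quart F x \<partial>P)) \<le> 29 * K ^ 4 / (real n)\<^sup>2 * \<Phi> F"
  proof -
    have i: "integrable P (\<lambda>x. (\<Sum>p\<in>I. tword F p 3 x) / 6)"
      by (intro integrable_divide Bochner_Integration.integrable_sum integrable_tword)
    have "T 3 / 6 = (\<integral>x. (\<Sum>p\<in>I. tword F p 3 x) / 6 \<partial>P)" unfolding T by simp
    then have "T 3 / 6 - (\<integral>x. quart F x \<partial>P) = (\<integral>x. (\<Sum>p\<in>I. tword F p 3 x) / 6 - quart F x \<partial>P)"
      using Bochner_Integration.integral_diff[OF i integrable_quart[of F]] by simp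
    also have "norm \<dots> \<le> 29 * K ^ 4 / (real n)\<^sup>2 * \<Phi> F"
    proof (rule P.norm_integral_le_const)
      show "norm ((\<Sum>p\<in>I. tword F p 3 x) / 6 - quart F x) \<le> 29 * K ^ 4 / (real n)\<^sup>2 * \<Phi> F" for x
        unfolding \<Phi>_def by (rule sum_tword3_bound)
      show "0 \<le> 29 * K ^ 4 / (real n)\<^sup>2 * \<Phi> F" unfolding \<Phi>_def by (simp add: sum_nonneg)
    qed
    finally show ?thesis .
  qed
  \<comment> \<open>The term \<open>\<sigma>\<^sup>2 * g * ?Y\<close> of the identity is absorbed by
    the first derivatives, up to the covariance of \<open>tr G / n\<close> with
    \<open>tr (G F)\<close>.\<close>
  have "(\<integral>x. tr n (mm n (G x) E) \<partial>P) - tr n F - \<kappa> * (\<integral>x. quart F x \<partial>P)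
    = \<sigma>\<^sup>2 * (T 1 - g * ?Y) + ((S0 - (\<sigma>\<^sup>2 * T 1 + \<kappa> / 6 * T 3)) + \<kappa> * (T 3 / 6 - (\<integral>x. quart F x \<partial>P)))"
    unfolding e by (simp add: algebra_simps)
  also have "norm \<dots> \<le> \<sigma>\<^sup>2 * (C * K ^ 4 * (1 + hs n F / n) / n) +
     (1920 * expansion_const \<mu> \<sigma> * K ^ 6 / (real n)\<^sup>2 * \<Phi> F + \<bar>\<kappa>\<bar> * (29 * K ^ 4 / (real n)\<^sup>2 * \<Phi> F))"
    using b_0 b1 b3 by (intro norm_add_le norm_mult_le) (auto simp: norm_power)
  also have "\<dots> = \<sigma>\<^sup>2 * (C * K ^ 4 * (1 + hs n F / n) / n) + c1 / (real n)\<^sup>2 * \<Phi> F"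
    by (simp add: add_divide_distrib distrib_right)
  finally show ?thesis .
qed

text \<open>Take \<open>E\<close> with column \<open>i\<close> equal to \<open>u\<close> and zero
  elsewhere, so that \<open>tr (G E)\<close> is entry \<open>i\<close> of \<open>G u\<close>. A
  basis vector \<open>u\<close> gives an entry of \<open>G\<close>, a column of \<open>B\<close> an
  entry of \<open>G B\<close>.\<close>

lemma entry_bias:
  assumes i: "i < n" and u: "vnorm n u \<le> t"
  shows "norm ((\<integral>x. (\<Sum>k<n. G x i k * u k) \<partial>P) - (\<Sum>k<n. B i k * u k))
     \<le> (\<bar>\<kappa>\<bar> * K ^ 5 * t + \<sigma>\<^sup>2 * (C * K ^ 4 * (1 + t\<^sup>2 * K\<^sup>2)) + c1 * (t * K)) / n"
    and "(\<integral>x. (norm (\<Sum>k<n. G x i k * u k))\<^sup>2 \<partial>P) - (norm (\<integral>x. (\<Sum>k<n. G x i k * u k) \<partial>P))\<^sup>2 \<le> 2 * C * K ^ 4 * t\<^sup>2 / n"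
proof -
  have n0: "real n > 0" "real n \<ge> 1" using n_pos by auto
  have t0: "0 \<le> t" using u vnorm_nonneg[of n u] by linarith
  define E where "E k l = (if l = i then u k else 0)" for k l
  define F where "F = mm n E B"
  have trGE: "tr n (mm n X E) = (\<Sum>k<n. X i k * u k)" for X
  proof -
    have "mm n X E j j = (if j = i then (\<Sum>k<n. X i k * u k) else 0)" for j
      by (simp add: mm_def E_def)
    then show ?thesis using i by (simp add: tr_def)
  qed
  have F: "F k l = u k * B i l" for k l
    using i by (simp add: F_def mm_def E_def if_distrib[of "\<lambda>x. x * _"] cong: if_cong)
  have trF: "tr n F = (\<Sum>k<n. B i k * u k)" by (simp add: tr_def F mult.commute)
  have hsE: "hs n E = (vnorm n u)\<^sup>2"
    using i by (simp add: hs_def vnorm_sq E_def if_distrib[of norm] if_distrib[of "\<lambda>x. x\<^sup>2"] cong: if_cong)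
  have u2: "(vnorm n u)\<^sup>2 \<le> t\<^sup>2" using u by (intro power_mono) auto
  have Bcol: "vnorm n (\<lambda>k. B i k) \<le> K" by (rule op_bounded_row[OF op_bounded_B K_nonneg i])
  have hsF: "hs n F / n \<le> t\<^sup>2 * K\<^sup>2"
  proof -
    have "hs n F = (vnorm n u)\<^sup>2 * (vnorm n (\<lambda>k. B i k))\<^sup>2"
      unfolding hs_def F norm_mult power_mult_distrib vnorm_sq by (rule sum_product[symmetric])
    also have "\<dots> \<le> t\<^sup>2 * K\<^sup>2" by (intro mult_mono u2 power_mono Bcol) auto
    finally have "hs n F \<le> t\<^sup>2 * K\<^sup>2" .
    moreover have "hs n F / n \<le> hs n F / 1" using hs_nonneg[of n F] n0 by (intro divide_left_mono) auto
    ultimately show ?thesis by simp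
  qed
  have \<Phi>F: "\<Phi> F \<le> real n * (t * K)"
  proof -
    have "vnorm n (\<lambda>k. F k l) \<le> t * K" if l: "l < n" for l
    proof -
      have "vnorm n (\<lambda>k. F k l) = norm (B i l) * vnorm n u"
        unfolding F vnorm_scale[symmetric] by (simp add: mult.commute)
      also have "\<dots> \<le> K * t"
        using op_bounded_entry[OF op_bounded_B K_nonneg i l] u K_nonneg by (intro mult_mono) auto
      finally show ?thesis by (simp add: mult.commute)
    qed
    then have "\<Phi> F \<le> (\<Sum>l<n. t * K)" unfolding \<Phi>_def by (intro sum_mono) auto
    then show ?thesis by simp
  qed
  have q: "norm (quart F x) \<le> K ^ 5 * t / n" for x
  proof -
    have GF: "mm n (G x) F k k = (\<Sum>m<n. G x k m * u m) * B i k" for k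
      by (simp add: mm_def F sum_distrib_right mult.assoc)
    \<comment> \<open>The diagonal of \<open>G F\<close> is the product of the vectors
      \<open>G u\<close> and row \<open>i\<close> of \<open>B\<close>; Cauchy-Schwarz bounds its sum
      without a factor \<open>n\<close>, which makes \<open>quart F\<close> of order
      \<open>1/n\<close>.\<close>
    have s: "(\<Sum>k<n. norm (mm n (G x) F k k)) \<le> K * t * K"
    proof -
      have "(\<Sum>k<n. norm (mm n (G x) F k k)) \<le> vnorm n (\<lambda>k. \<Sum>m<n. G x k m * u m) * vnorm n (\<lambda>k. B i k)"
        unfolding GF norm_mult by (rule vnorm_cauchy_schwarz)
      also have "\<dots> \<le> (K * vnorm n u) * K"
        using Bcol K_nonneg by (intro mult_mono op_bounded_apply[OF op_bounded_G]) auto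
      also have "\<dots> \<le> (K * t) * K" using u K_nonneg by (intro mult_right_mono mult_left_mono) auto
      finally show ?thesis .
    qed
    have "norm (\<Sum>k<n. \<Sum>j<n. (G x j j)\<^sup>2 * G x k k * mm n (G x) F k k) \<le> (\<Sum>k<n. \<Sum>j<n. K\<^sup>2 * K * norm (mm n (G x) F k k))"
    proof (intro sum_norm_le)
      fix k j assume "k \<in> {..<n}" "j \<in> {..<n}"
      then show "norm ((G x j j)\<^sup>2 * G x k k * mm n (G x) F k k) \<le> K\<^sup>2 * K * norm (mm n (G x) F k k)"
        unfolding norm_mult norm_power using G_entry K_nonneg by (intro mult_mono power_mono) auto
    qed
    also have "\<dots> = real n * (K\<^sup>2 * K) * (\<Sum>k<n. norm (mm n (G x) F k k))"
      by (simp add: sum_distrib_left mult.assoc)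
    also have "\<dots> \<le> real n * (K\<^sup>2 * K) * (K * t * K)"
      using s K_nonneg by (intro mult_left_mono) auto
    finally have "norm (quart F x) \<le> real n * (K\<^sup>2 * K) * (K * t * K) / (2 * (real n)\<^sup>2)"
      unfolding quart_def norm_divide by (simp add: norm_mult norm_power divide_right_mono)
    also have "\<dots> = (K ^ 5 * t / n) / 2"
      using n0 by (simp add: power_numeral_reduce mult_ac)
    also have "\<dots> \<le> K ^ 5 * t / n"
    proof -
      have "y / 2 \<le> y" if "0 \<le> y" for y :: real using that by simp
      moreover have "0 \<le> K ^ 5 * t / n" using K_nonneg t0 by simp
      ultimately show ?thesis by blast
    qed
    finally show ?thesis .
  qed
  have "norm (\<integral>x. quart F x \<partial>P) \<le> K ^ 5 * t / n"
    using K_nonneg t0 by (intro P.norm_integral_le_const q) auto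
  then have qi: "norm (complex_of_real \<kappa> * (\<integral>x. quart F x \<partial>P)) \<le> \<bar>\<kappa>\<bar> * (K ^ 5 * t / n)"
    unfolding norm_mult norm_of_real by (intro mult_left_mono) auto
  have c10: "0 \<le> c1" using expansion_const_nonneg[of \<mu> \<sigma>] by simp
  have "norm ((\<integral>x. (\<Sum>k<n. G x i k * u k) \<partial>P) - (\<Sum>k<n. B i k * u k) - \<kappa> * (\<integral>x. quart F x \<partial>P))
      \<le> \<sigma>\<^sup>2 * (C * K ^ 4 * (1 + hs n F / n) / n) + c1 / (real n)\<^sup>2 * \<Phi> F"
    using master_estimate[of E] unfolding F_def[symmetric] trGE trF .
  also have "\<dots> \<le> \<sigma>\<^sup>2 * (C * K ^ 4 * (1 + t\<^sup>2 * K\<^sup>2) / n) + c1 / (real n)\<^sup>2 * (real n * (t * K))"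
    using C_pos c10 hsF \<Phi>F n0 by (intro add_mono mult_left_mono divide_right_mono) auto
  also have "\<dots> = (\<sigma>\<^sup>2 * (C * K ^ 4 * (1 + t\<^sup>2 * K\<^sup>2)) + c1 * (t * K)) / n"
  proof -
    have e: "c / (real n)\<^sup>2 * (real n * y) = c * y / n" for c y :: real
      using n0 by (simp add: power2_eq_square)
    show ?thesis unfolding e by (simp only: add_divide_distrib times_divide_eq_right)
  qed
  finally have m: "norm ((\<integral>x. (\<Sum>k<n. G x i k * u k) \<partial>P) - (\<Sum>k<n. B i k * u k) - \<kappa> * (\<integral>x. quart F x \<partial>P))
      \<le> (\<sigma>\<^sup>2 * (C * K ^ 4 * (1 + t\<^sup>2 * K\<^sup>2)) + c1 * (t * K)) / n" .
  have "norm ((\<integral>x. (\<Sum>k<n. G x i k * u k) \<partial>P) - (\<Sum>k<n. B i k * u k))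
      \<le> (\<sigma>\<^sup>2 * (C * K ^ 4 * (1 + t\<^sup>2 * K\<^sup>2)) + c1 * (t * K)) / n + \<bar>\<kappa>\<bar> * (K ^ 5 * t / n)"
    using norm_add_le[OF m qi] by simp
  also have "\<dots> = (\<bar>\<kappa>\<bar> * K ^ 5 * t + \<sigma>\<^sup>2 * (C * K ^ 4 * (1 + t\<^sup>2 * K\<^sup>2)) + c1 * (t * K)) / n"
    by (simp add: add_divide_distrib)
  finally show "norm ((\<integral>x. (\<Sum>k<n. G x i k * u k) \<partial>P) - (\<Sum>k<n. B i k * u k))
     \<le> (\<bar>\<kappa>\<bar> * K ^ 5 * t + \<sigma>\<^sup>2 * (C * K ^ 4 * (1 + t\<^sup>2 * K\<^sup>2)) + c1 * (t * K)) / n" .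
  have "(\<integral>x. (norm (\<Sum>k<n. G x i k * u k))\<^sup>2 \<partial>P) - (norm (\<integral>x. (\<Sum>k<n. G x i k * u k) \<partial>P))\<^sup>2 \<le> 2 * C / n * K ^ 4 * hs n E"
    using variance_tr_GF[of E] unfolding trGE .
  also have "\<dots> \<le> 2 * C / n * K ^ 4 * t\<^sup>2"
    unfolding hsE using u2 C_pos n0 by (intro mult_left_mono) auto
  finally show "(\<integral>x. (norm (\<Sum>k<n. G x i k * u k))\<^sup>2 \<partial>P) - (norm (\<integral>x. (\<Sum>k<n. G x i k * u k) \<partial>P))\<^sup>2 \<le> 2 * C * K ^ 4 * t\<^sup>2 / n"
    by simp
qed


text \<open>\<open>b\<close> approximates the random \<open>X\<close>; \<open>m\<close> bounds both,
  \<open>s\<close> the mean square error, \<open>t\<close> the bias. From \<open>s\<close> alone the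
  bias would only be \<open>sqrt s\<close>, too large for the final order.\<close>

definition close :: "((nat \<times> nat \<Rightarrow> real) \<Rightarrow> complex) \<Rightarrow> complex \<Rightarrow> real \<Rightarrow> real \<Rightarrow> real \<Rightarrow> bool" where
  "close X b m s t \<longleftrightarrow> X \<in> borel_measurable P \<and> (\<forall>x. norm (X x) \<le> m) \<and> norm b \<le> m \<and>
     (\<integral>x. (norm (X x - b))\<^sup>2 \<partial>P) \<le> s \<and> norm ((\<integral>x. X x \<partial>P) - b) \<le> t"

text \<open>Decomposition of the mean square error into variance and squared bias.\<close>

lemma mean_square_error:
  fixes X :: "(nat \<times> nat \<Rightarrow> real) \<Rightarrow> complex"
  assumes X: "X \<in> borel_measurable P" "\<And>x. norm (X x) \<le> m"
  shows "(\<integral>x. (norm (X x - b))\<^sup>2 \<partial>P) = ((\<integral>x. (norm (X x))\<^sup>2 \<partial>P) - (norm (\<integral>x. X x \<partial>P))\<^sup>2)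
     + (norm ((\<integral>x. X x \<partial>P) - b))\<^sup>2"
proof -
  have i: "integrable P X" by (rule iid.integrable_law_bounded[OF X])
  have i2: "integrable P (\<lambda>x. (norm (X x))\<^sup>2)"
    using X by (intro iid.integrable_law_bounded[where b = "m\<^sup>2"] sq_norm_bound) auto
  have ib: "integrable P (\<lambda>x. X x * cnj b)" using i by simp
  have r: "integrable P (\<lambda>x. Re (X x * cnj b))" using ib by (rule integrable_Re)
  have R: "(\<integral>x. Re (X x * cnj b) \<partial>P) = Re ((\<integral>x. X x \<partial>P) * cnj b)"
    using integral_Re[OF ib] i by (simp del: times_complex.sel)
  have "(\<integral>x. (norm (X x - b))\<^sup>2 \<partial>P) = (\<integral>x. (norm (X x))\<^sup>2 \<partial>P) - 2 * (\<integral>x. Re (X x * cnj b) \<partial>P) + (norm b)\<^sup>2"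
    unfolding cmod_diff_sq using i2 r P.prob_space by (simp del: times_complex.sel)
  then show ?thesis unfolding R cmod_diff_sq[of "\<integral>x. X x \<partial>P" b] by simp
qed

text \<open>With \<open>U = X - b\<close> and \<open>V = Y - c\<close>, the mean of
  \<open>U V\<close> is at most \<open>s\<close>, and \<open>b V + c U\<close> contributes only
  biases, at most \<open>2 m t\<close>. The mean square part uses
  \<open>X Y - b c = X V + c U\<close> instead. Equal parameters for both factors suffice, as
  products are formed in balanced pairs.\<close>

lemma close_mult:
  assumes "close X b m s t" "close Y c m s t"
  shows "close (\<lambda>x. X x * Y x) (b * c) (m * m) (4 * m\<^sup>2 * s) (s + 2 * m * t)"
proof -
  have X: "X \<in> borel_measurable P" "\<And>x. norm (X x) \<le> m" "norm b \<le> m"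
    and Xs: "(\<integral>x. (norm (X x - b))\<^sup>2 \<partial>P) \<le> s" and Xt: "norm ((\<integral>x. X x \<partial>P) - b) \<le> t"
    using assms(1) by (auto simp: close_def)
  have Y: "Y \<in> borel_measurable P" "\<And>x. norm (Y x) \<le> m" "norm c \<le> m"
    and Ys: "(\<integral>x. (norm (Y x - c))\<^sup>2 \<partial>P) \<le> s" and Yt: "norm ((\<integral>x. Y x \<partial>P) - c) \<le> t"
    using assms(2) by (auto simp: close_def)
  have m0: "0 \<le> m" using X(3) norm_ge_zero order_trans by blast
  define U where "U x = X x - b" for x
  define V where "V x = Y x - c" for x
  have mU: "U \<in> borel_measurable P" "V \<in> borel_measurable P"
    unfolding U_def V_def using X(1) Y(1) by simp_all
  have bU: "norm (U x) \<le> m + m" "norm (V x) \<le> m + m" for x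
    unfolding U_def V_def using norm_triangle_le_diff[OF add_mono[OF X(2) X(3)]] norm_triangle_le_diff[OF add_mono[OF Y(2) Y(3)]]
    by auto
  have iX: "integrable P X" by (rule iid.integrable_law_bounded[OF X(1,2)])
  have iY: "integrable P Y" by (rule iid.integrable_law_bounded[OF Y(1,2)])
  have iU: "integrable P U" unfolding U_def using iX by simp
  have iV: "integrable P V" unfolding V_def using iY by simp
  have iU2: "integrable P (\<lambda>x. (norm (U x))\<^sup>2)"
    using mU bU by (intro iid.integrable_law_bounded[where b = "(m + m)\<^sup>2"] sq_norm_bound) auto
  have iV2: "integrable P (\<lambda>x. (norm (V x))\<^sup>2)"
    using mU bU by (intro iid.integrable_law_bounded[where b = "(m + m)\<^sup>2"] sq_norm_bound) auto
  have iUV: "integrable P (\<lambda>x. U x * V x)"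
    using mU bU by (intro iid.integrable_law_bounded[where b = "(m + m) * (m + m)"] norm_mult_le) auto
  have mXY: "(\<lambda>x. X x * Y x) \<in> borel_measurable P" using X(1) Y(1) by simp
  have bXY: "norm (X x * Y x) \<le> m * m" for x using X(2) Y(2) by (intro norm_mult_le)
  have U2: "(\<integral>x. (norm (U x))\<^sup>2 \<partial>P) \<le> s" "(\<integral>x. (norm (V x))\<^sup>2 \<partial>P) \<le> s"
    using Xs Ys by (simp_all add: U_def V_def)
  have "(\<integral>x. (norm (X x * Y x - b * c))\<^sup>2 \<partial>P) \<le> (\<integral>x. 2 * m\<^sup>2 * (norm (V x))\<^sup>2 + 2 * m\<^sup>2 * (norm (U x))\<^sup>2 \<partial>P)"
  proof (rule integral_mono)
    show "integrable P (\<lambda>x. (norm (X x * Y x - b * c))\<^sup>2)"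
    proof (rule iid.integrable_law_bounded[where b = "(m * m + m * m)\<^sup>2"])
      show "(\<lambda>x. (norm (X x * Y x - b * c))\<^sup>2) \<in> borel_measurable P" using mXY by simp
      show "norm ((norm (X x * Y x - b * c))\<^sup>2) \<le> (m * m + m * m)\<^sup>2" for x
        by (intro sq_norm_bound norm_triangle_le_diff add_mono bXY norm_mult_le X(3) Y(3))
    qed
    show "integrable P (\<lambda>x. 2 * m\<^sup>2 * (norm (V x))\<^sup>2 + 2 * m\<^sup>2 * (norm (U x))\<^sup>2)" using iU2 iV2 by simp
    fix x
    have "norm (X x * Y x - b * c) = norm (X x * V x + c * U x)"
      by (simp add: U_def V_def algebra_simps)
    also have "\<dots> \<le> m * norm (V x) + m * norm (U x)"
      by (intro norm_add_le norm_mult_le X(2) Y(3) order_refl)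
    finally have "(norm (X x * Y x - b * c))\<^sup>2 \<le> (m * norm (V x) + m * norm (U x))\<^sup>2"
      by (intro power_mono) auto
    also have "\<dots> \<le> 2 * m\<^sup>2 * (norm (V x))\<^sup>2 + 2 * m\<^sup>2 * (norm (U x))\<^sup>2"
    proof -
      have "0 \<le> (m * norm (V x) - m * norm (U x))\<^sup>2" by simp
      then show ?thesis by (simp add: power2_eq_square algebra_simps)
    qed
    finally show "(norm (X x * Y x - b * c))\<^sup>2 \<le> 2 * m\<^sup>2 * (norm (V x))\<^sup>2 + 2 * m\<^sup>2 * (norm (U x))\<^sup>2" .
  qed
  also have "\<dots> = 2 * m\<^sup>2 * (\<integral>x. (norm (V x))\<^sup>2 \<partial>P) + 2 * m\<^sup>2 * (\<integral>x. (norm (U x))\<^sup>2 \<partial>P)"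
    using iU2 iV2 by simp
  also have "\<dots> \<le> 2 * m\<^sup>2 * s + 2 * m\<^sup>2 * s" by (intro add_mono mult_left_mono U2) auto
  finally have A: "(\<integral>x. (norm (X x * Y x - b * c))\<^sup>2 \<partial>P) \<le> 4 * m\<^sup>2 * s" by (simp add: mult_ac)
  have UV: "norm (\<integral>x. U x * V x \<partial>P) \<le> s"
  proof -
    have "norm (\<integral>x. U x * V x \<partial>P) \<le> (\<integral>x. norm (U x * V x) \<partial>P)" by (rule integral_norm_bound)
    also have "\<dots> \<le> (\<integral>x. ((norm (U x))\<^sup>2 + (norm (V x))\<^sup>2) / 2 \<partial>P)"
    proof (rule integral_mono)
      show "integrable P (\<lambda>x. norm (U x * V x))" using iUV by (rule Bochner_Integration.integrable_norm)
      show "integrable P (\<lambda>x. ((norm (U x))\<^sup>2 + (norm (V x))\<^sup>2) / 2)" using iU2 iV2 by simp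
      fix x
      have "0 \<le> (norm (U x) - norm (V x))\<^sup>2" by simp
      then show "norm (U x * V x) \<le> ((norm (U x))\<^sup>2 + (norm (V x))\<^sup>2) / 2"
        by (simp add: norm_mult power2_eq_square algebra_simps)
    qed
    also have "\<dots> = ((\<integral>x. (norm (U x))\<^sup>2 \<partial>P) + (\<integral>x. (norm (V x))\<^sup>2 \<partial>P)) / 2"
      using iU2 iV2 by simp
    finally show ?thesis using U2 by simp
  qed
  have EU: "(\<integral>x. U x \<partial>P) = (\<integral>x. X x \<partial>P) - b" "(\<integral>x. V x \<partial>P) = (\<integral>x. Y x \<partial>P) - c"
    unfolding U_def V_def using iX iY P.prob_space by simp_all
  have "X x * Y x = U x * V x + (b * V x + c * U x) + b * c" for x
    by (simp add: U_def V_def algebra_simps)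
  then have "(\<integral>x. X x * Y x \<partial>P) = (\<integral>x. U x * V x \<partial>P) + (b * (\<integral>x. V x \<partial>P) + c * (\<integral>x. U x \<partial>P)) + b * c"
    using iUV iU iV P.prob_space by simp
  then have "norm ((\<integral>x. X x * Y x \<partial>P) - b * c) = norm ((\<integral>x. U x * V x \<partial>P) + (b * (\<integral>x. V x \<partial>P) + c * (\<integral>x. U x \<partial>P)))"
    by simp
  also have "\<dots> \<le> s + (m * t + m * t)"
    unfolding EU by (intro norm_add_le norm_mult_le UV X(3) Y(3) Xt Yt)
  finally have "norm ((\<integral>x. X x * Y x \<partial>P) - b * c) \<le> s + 2 * m * t" by simp
  moreover have "norm (b * c) \<le> m * m" by (intro norm_mult_le X(3) Y(3))
  ultimately show ?thesis unfolding close_def using mXY bXY A by blast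
qed

text \<open>A common bound for the norms of basis vectors, which are 1, and of the columns of
  \<open>B\<close>, which are at most \<open>K\<close>.\<close>

abbreviation \<tau> where "\<tau> \<equiv> 1 + K"
definition bias where
  "bias = \<bar>\<kappa>\<bar> * K ^ 5 * \<tau> + \<sigma>\<^sup>2 * (C * K ^ 4 * (1 + \<tau>\<^sup>2 * K\<^sup>2)) + c1 * (\<tau> * K)"
definition mse where "mse = 2 * C * K ^ 4 * \<tau>\<^sup>2 + bias\<^sup>2"

lemma close_entry:
  assumes i: "i < n" and u: "vnorm n u \<le> \<tau>"
  shows "close (\<lambda>x. \<Sum>k<n. G x i k * u k) (\<Sum>k<n. B i k * u k) (K * \<tau>) (mse / n) (bias / n)"
proof -
  have n0: "real n > 0" "real n \<ge> 1" using n_pos by auto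
  have b: "norm (\<Sum>k<n. X i k * u k) \<le> K * \<tau>" if "op_bounded n K X" for X
  proof -
    have "norm (\<Sum>k<n. X i k * u k) \<le> vnorm n (\<lambda>k. X i k) * vnorm n u" by (rule norm_sum_le_vnorm)
    also have "\<dots> \<le> K * \<tau>" using u K_nonneg by (intro mult_mono op_bounded_row[OF that _ i]) auto
    finally show ?thesis .
  qed
  have m: "(\<lambda>x. \<Sum>k<n. G x i k * u k) \<in> borel_measurable P"
    by (intro borel_measurable_sum borel_measurable_times measurable_G borel_measurable_const)
  have bi: "norm ((\<integral>x. (\<Sum>k<n. G x i k * u k) \<partial>P) - (\<Sum>k<n. B i k * u k)) \<le> bias / n"
    unfolding bias_def by (rule entry_bias(1)[OF i u])
  have "(\<integral>x. (norm ((\<Sum>k<n. G x i k * u k) - (\<Sum>k<n. B i k * u k)))\<^sup>2 \<partial>P)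
      \<le> 2 * C * K ^ 4 * \<tau>\<^sup>2 / n + (bias / n)\<^sup>2"
    unfolding mean_square_error[OF m b[OF op_bounded_G]]
    by (intro add_mono entry_bias(2)[OF i u] power_mono bi) simp
  \<comment> \<open>Giving up one factor \<open>1/n\<close> lets the squared bias join the variance,
    which is only \<open>O(1/n)\<close>.\<close>
  also have "(bias / n)\<^sup>2 \<le> bias\<^sup>2 / n"
  proof -
    have "bias\<^sup>2 / (real n)\<^sup>2 \<le> bias\<^sup>2 / real n"
      using n0 by (intro divide_left_mono) (auto simp: power2_eq_square)
    then show ?thesis by (simp add: power_divide)
  qed
  finally have "(\<integral>x. (norm ((\<Sum>k<n. G x i k * u k) - (\<Sum>k<n. B i k * u k)))\<^sup>2 \<partial>P) \<le> mse / n"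
    by (simp add: mse_def add_divide_distrib)
  then show ?thesis unfolding close_def using m b[OF op_bounded_G] b[OF op_bounded_B] bi by blast
qed

lemma close_G:
  assumes "i < n" "j < n"
  shows "close (\<lambda>x. G x i j) (B i j) (K * \<tau>) (mse / n) (bias / n)"
  using close_entry[OF assms(1), of "\<lambda>k. if k = j then 1 else 0"] assms(2) vnorm_unit[OF assms(2), of 1] K_nonneg
  by (simp add: if_distrib[of "\<lambda>x. _ * x"] cong: if_cong)

lemma close_GB:
  assumes "i < n" "j < n"
  shows "close (\<lambda>x. mm n (G x) B i j) (mm n B B i j) (K * \<tau>) (mse / n) (bias / n)"
  unfolding mm_def using op_bounded_col[OF op_bounded_B K_nonneg assms(2)]
  by (intro close_entry assms(1)) simp

definition quartB where
  "quartB = (\<Sum>i<n. \<Sum>j<n. (B j j)\<^sup>2 * B i i * mm n B B i i) / (2 * (of_nat n)\<^sup>2)"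

abbreviation c4 where "c4 \<equiv> 6 * (K * \<tau>)\<^sup>2 * mse + 4 * (K * \<tau>) ^ 3 * bias"

text \<open>The four factors are multiplied as \<open>(G j j * G j j) * (G i i * (G B) i i)\<close>,
  all with the parameters of \<open>close_entry\<close>; this holds uniformly in \<open>i\<close>
  and \<open>j\<close>, so averaging preserves it.\<close>

lemma quart_bias: "norm ((\<integral>x. quart B x \<partial>P) - quartB) \<le> c4 / n"
proof -
  have n0: "real n > 0" using n_pos by simp
  let ?m = "K * \<tau>"
  let ?X = "\<lambda>i j x. (G x j j)\<^sup>2 * G x i i * mm n (G x) B i i"
  let ?b = "\<lambda>i j. (B j j)\<^sup>2 * B i i * mm n B B i i"
  have c: "close (?X i j) (?b i j) (?m * ?m * (?m * ?m)) (4 * (?m * ?m)\<^sup>2 * (4 * ?m\<^sup>2 * (mse / n)))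
     (4 * ?m\<^sup>2 * (mse / n) + 2 * (?m * ?m) * (mse / n + 2 * ?m * (bias / n)))" if "i < n" "j < n" for i j
    using close_mult[OF close_mult[OF close_G[OF that(2,2)] close_G[OF that(2,2)]] close_mult[OF close_G[OF that(1,1)] close_GB[OF that(1,1)]]]
    by (simp add: power2_eq_square mult.assoc)
  \<comment> \<open>With \<open>m = K * \<tau>\<close>, the inner products have parameters
    \<open>m^2\<close>, \<open>4 m^2 s\<close> and \<open>s + 2 m t\<close>. The outer one then has
    bias at most \<open>6 m^2 s + 4 m^3 t\<close>, which is \<open>c4 / n\<close>.\<close>
  have e: "4 * ?m\<^sup>2 * (mse / n) + 2 * (?m * ?m) * (mse / n + 2 * ?m * (bias / n)) = c4 / n"
    by (simp add: power2_eq_square power3_eq_cube algebra_simps add_divide_distrib)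
  have t: "norm ((\<integral>x. ?X i j x \<partial>P) - ?b i j) \<le> c4 / n" and int: "integrable P (?X i j)" if "i < n" "j < n" for i j
  proof -
    note cc = c[OF that, unfolded e close_def]
    show "norm ((\<integral>x. ?X i j x \<partial>P) - ?b i j) \<le> c4 / n" using cc by blast
    show "integrable P (?X i j)" using cc by (intro iid.integrable_law_bounded[where b = "?m * ?m * (?m * ?m)"]) blast+
  qed
  have "(\<integral>x. quart B x \<partial>P) = (\<Sum>i<n. \<Sum>j<n. \<integral>x. ?X i j x \<partial>P) / (2 * (of_nat n)\<^sup>2)"
  proof -
    have "(\<integral>x. (\<Sum>i<n. \<Sum>j<n. ?X i j x) \<partial>P) = (\<Sum>i<n. \<integral>x. (\<Sum>j<n. ?X i j x) \<partial>P)"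
      by (intro Bochner_Integration.integral_sum Bochner_Integration.integrable_sum int) auto
    also have "\<dots> = (\<Sum>i<n. \<Sum>j<n. \<integral>x. ?X i j x \<partial>P)"
      by (intro sum.cong refl Bochner_Integration.integral_sum int) auto
    finally have s: "(\<integral>x. (\<Sum>i<n. \<Sum>j<n. ?X i j x) \<partial>P) = (\<Sum>i<n. \<Sum>j<n. \<integral>x. ?X i j x \<partial>P)" .
    show ?thesis unfolding quart_def s[symmetric] by simp
  qed
  then have "(\<integral>x. quart B x \<partial>P) - quartB = (\<Sum>i<n. \<Sum>j<n. (\<integral>x. ?X i j x \<partial>P) - ?b i j) / (2 * (of_nat n)\<^sup>2)"
    unfolding quartB_def by (simp add: sum_subtractf diff_divide_distrib)
  then have "norm ((\<integral>x. quart B x \<partial>P) - quartB) = norm (\<Sum>i<n. \<Sum>j<n. (\<integral>x. ?X i j x \<partial>P) - ?b i j) / (2 * (real n)\<^sup>2)"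
    by (simp only: norm_divide norm_mult norm_power norm_of_nat norm_numeral)
  also have "\<dots> \<le> (\<Sum>i<n. \<Sum>j<n. c4 / n) / (2 * (real n)\<^sup>2)"
    by (intro divide_right_mono sum_norm_le t) auto
  also have "\<dots> = (c4 / n) / 2"
  proof -
    have "(\<Sum>i<n. \<Sum>j<n. y) / (2 * (real n)\<^sup>2) = y / 2" for y :: real
      using n0 by (simp add: power2_eq_square)
    then show ?thesis by blast
  qed
  also have "\<dots> \<le> c4 / n"
  proof -
    have "0 \<le> c4 / n" by (rule order_trans[OF norm_ge_zero t[OF n_pos n_pos]])
    moreover have "y / 2 \<le> y" if "0 \<le> y" for y :: real using that by simp
    ultimately show ?thesis by blast
  qed
  finally show ?thesis .
qed

text \<open>For \<open>E = 1\<close> the fourth order term is of order one, so an error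
  \<open>O(1/n)\<close> in it is affordable: the division by \<open>n\<close> that turns the trace
  into \<open>g\<close> makes it \<open>O(1/n^2)\<close>.\<close>

lemma expansion:
  "norm (g - (tr n B / n + \<kappa> / n * quartB))
    \<le> (\<sigma>\<^sup>2 * C * K ^ 4 * (1 + K\<^sup>2) + c1 * K + \<bar>\<kappa>\<bar> * c4) / (real n)\<^sup>2"
proof -
  have n0: "real n > 0" using n_pos by simp
  define F where "F = mm n unit_mat B"
  have F: "F i j = B i j" if "i < n" for i j using that by (simp add: F_def mm_unit_left)
  have trF: "tr n F = tr n B" by (simp add: tr_def F)
  have hsF: "hs n F / n \<le> K\<^sup>2"
  proof -
    have "hs n F = (\<Sum>i<n. (vnorm n (\<lambda>j. B i j))\<^sup>2)" unfolding hs_rows using F by (intro sum.cong refl) (simp add: vnorm_sq)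
    also have "\<dots> \<le> (\<Sum>i<n. K\<^sup>2)"
      by (intro sum_mono power_mono op_bounded_row[OF op_bounded_B K_nonneg]) auto
    finally show ?thesis using n0 by (simp add: field_simps)
  qed
  have \<Phi>F: "\<Phi> F \<le> real n * K"
  proof -
    have "\<Phi> F = (\<Sum>i<n. vnorm n (\<lambda>k. B k i))" by (simp add: \<Phi>_def F vnorm_def L2_set_def)
    also have "\<dots> \<le> (\<Sum>i<n. K)"
      by (intro sum_mono op_bounded_col[OF op_bounded_B K_nonneg]) auto
    finally show ?thesis by simp
  qed
  have qF: "quart F x = quart B x" for x unfolding quart_def by (simp add: mm_def[of n "G x"] F)
  have c10: "0 \<le> c1" using expansion_const_nonneg[of \<mu> \<sigma>] by simp
  have "norm ((\<integral>x. tr n (G x) \<partial>P) - tr n B - \<kappa> * (\<integral>x. quart B x \<partial>P))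
      \<le> \<sigma>\<^sup>2 * (C * K ^ 4 * (1 + hs n F / n) / n) + c1 / (real n)\<^sup>2 * \<Phi> F"
    using master_estimate[of unit_mat] unfolding F_def[symmetric] tr_mm_unit trF qF .
  also have "\<dots> \<le> \<sigma>\<^sup>2 * (C * K ^ 4 * (1 + K\<^sup>2) / n) + c1 / (real n)\<^sup>2 * (real n * K)"
    using C_pos c10 hsF \<Phi>F n0 by (intro add_mono mult_left_mono divide_right_mono) auto
  also have "\<dots> = (\<sigma>\<^sup>2 * C * K ^ 4 * (1 + K\<^sup>2) + c1 * K) / n"
  proof -
    have e: "c / (real n)\<^sup>2 * (real n * y) = c * y / n" for c y :: real
      using n0 by (simp add: power2_eq_square)
    show ?thesis unfolding e by (simp only: add_divide_distrib times_divide_eq_right mult.assoc)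
  qed
  finally have 1: "norm ((\<integral>x. tr n (G x) \<partial>P) - tr n B - \<kappa> * (\<integral>x. quart B x \<partial>P))
      \<le> (\<sigma>\<^sup>2 * C * K ^ 4 * (1 + K\<^sup>2) + c1 * K) / n" .
  have 2: "norm (complex_of_real \<kappa> * ((\<integral>x. quart B x \<partial>P) - quartB)) \<le> \<bar>\<kappa>\<bar> * (c4 / n)"
    using quart_bias by (intro norm_mult_le) auto
  have "g - (tr n B / n + \<kappa> / n * quartB)
    = (((\<integral>x. tr n (G x) \<partial>P) - tr n B - \<kappa> * (\<integral>x. quart B x \<partial>P)) + \<kappa> * ((\<integral>x. quart B x \<partial>P) - quartB)) / n"
    unfolding g_def by (simp add: algebra_simps diff_divide_distrib add_divide_distrib)
  then have "norm (g - (tr n B / n + \<kappa> / n * quartB))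
    = norm (((\<integral>x. tr n (G x) \<partial>P) - tr n B - \<kappa> * (\<integral>x. quart B x \<partial>P)) + \<kappa> * ((\<integral>x. quart B x \<partial>P) - quartB)) / n"
    by (simp add: norm_divide)
  also have "\<dots> \<le> ((\<sigma>\<^sup>2 * C * K ^ 4 * (1 + K\<^sup>2) + c1 * K) / n + \<bar>\<kappa>\<bar> * (c4 / n)) / n"
    by (intro divide_right_mono norm_add_le 1 2) simp
  also have "\<dots> = (\<sigma>\<^sup>2 * C * K ^ 4 * (1 + K\<^sup>2) + c1 * K + \<bar>\<kappa>\<bar> * c4) / (real n)\<^sup>2"
    by (simp only: power2_eq_square times_divide_eq_right add_divide_distrib[symmetric] divide_divide_eq_left)
  finally show ?thesis .
qed

end

section \<open>Resolvent trace and Stieltjes transform\<close>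

lemma poly_char_poly_eq_det:
  assumes "A \<in> carrier_mat n n"
  shows "poly (char_poly A) w = det (shifted n (\<lambda>i j. A $$ (i, j)) w)"
proof -
  have "- (char_matrix A w) = shifted n (\<lambda>i j. A $$ (i, j)) w"
    using assms by (intro eq_matI) (auto simp: char_matrix_def shifted_index)
  then show ?thesis unfolding char_poly_matrix[OF assms] by simp
qed

text \<open>Jacobi's formula: the derivative of the characteristic polynomial is the sum of the
  characteristic polynomials of the principal submatrices, that is, the trace of the
  adjugate.\<close>

lemma poly_pderiv_char_poly:
  assumes A: "A \<in> carrier_mat n n"
  shows "poly (pderiv (char_poly A)) w = (\<Sum>i<n. adj_mat (shifted n (\<lambda>i j. A $$ (i, j)) w) $$ (i, i))"
  unfolding pderiv_char_poly[OF A] poly_sum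
proof (intro sum.cong refl)
  fix i assume "i \<in> {..<n}"
  then have i: "i < n" by simp
  let ?Z = "shifted n (\<lambda>i j. A $$ (i, j)) w"
  have "shifted (n - 1) (\<lambda>k l. mat_delete A i i $$ (k, l)) w = mat_delete ?Z i i"
  proof (rule eq_matI)
    fix k l assume "k < dim_row (mat_delete ?Z i i)" "l < dim_col (mat_delete ?Z i i)"
    then have kl: "k < n - 1" "l < n - 1" by auto
    have "mat_delete ?Z i i $$ (k, l) = ?Z $$ (if k < i then k else Suc k, if l < i then l else Suc l)"
      using kl by (simp add: mat_delete_def)
    also have "\<dots> = (if k = l then w else 0) - A $$ (if k < i then k else Suc k, if l < i then l else Suc l)"
      using kl by (auto simp: shifted_index)
    also have "\<dots> = shifted (n - 1) (\<lambda>k l. mat_delete A i i $$ (k, l)) w $$ (k, l)"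
      using kl A by (simp add: shifted_index mat_delete_def)
    finally show "shifted (n - 1) (\<lambda>k l. mat_delete A i i $$ (k, l)) w $$ (k, l) = mat_delete ?Z i i $$ (k, l)" ..
  qed auto
  then have "poly (char_poly (mat_delete A i i)) w = det (mat_delete ?Z i i)"
    using poly_char_poly_eq_det[OF mat_delete_carrier[OF A], of i i w] by simp
  also have "\<dots> = adj_mat ?Z $$ (i, i)"
    using i by (simp add: adj_mat_def cofactor_def power_add flip: power_mult_distrib)
  finally show "poly (char_poly (mat_delete A i i)) w = adj_mat ?Z $$ (i, i)" .
qed

text \<open>The logarithmic derivative of a product of linear factors, with multiplicities.\<close>

lemma poly_pderiv_prod_mset:
  fixes w :: complex
  assumes "\<And>a. a \<in># M \<Longrightarrow> w \<noteq> a"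
  shows "poly (pderiv (\<Prod>a\<in>#M. [:-a, 1:])) w = poly (\<Prod>a\<in>#M. [:-a, 1:]) w * (\<Sum>a\<in>#M. 1 / (w - a))"
  using assms
proof (induction M)
  case empty
  then show ?case by simp
next
  case (add b M)
  define Q where "Q = (\<Prod>a\<in>#M. [:-a, 1:])"
  define S where "S = (\<Sum>a\<in>#M. 1 / (w - a))"
  have wb: "w \<noteq> b" using add.prems by simp
  have IH: "poly (pderiv Q) w = poly Q w * S" using add unfolding Q_def S_def by simp
  have "poly (pderiv ([:-b, 1:] * Q)) w = (w - b) * poly (pderiv Q) w + poly Q w"
    by (simp only: pderiv_mult poly_add poly_mult) (simp add: pderiv_pCons)
  also have "\<dots> = poly ([:-b, 1:] * Q) w * (1 / (w - b) + S)"
    unfolding IH poly_mult using wb by (simp add: distrib_left)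
  finally show ?case unfolding Q_def S_def by simp
qed

lemma sum_mset_eq_sum_count:
  fixes f :: "'a \<Rightarrow> complex"
  assumes "finite A" "set_mset M \<subseteq> A"
  shows "(\<Sum>a\<in>#M. f a) = (\<Sum>a\<in>A. of_nat (count M a) * f a)"
  using assms(2)
proof (induction M)
  case (add b M)
  have "(\<Sum>a\<in>A. of_nat (count (add_mset b M) a) * f a)
      = (\<Sum>a\<in>A. of_nat (count M a) * f a + (if a = b then f a else 0))"
    by (intro sum.cong refl) (auto simp: algebra_simps)
  also have "\<dots> = (\<Sum>a\<in>A. of_nat (count M a) * f a) + f b"
    using add.prems assms(1) by (simp add: sum.distrib)
  finally show ?case using add by simp
qed simp

text \<open>Invertibility in the upper half-plane is applied to \<open>A\<close> at \<open>a\<close>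
  and to \<open>- A\<close> at \<open>- a\<close>, which excludes both signs of the imaginary
  part.\<close>

lemma hermitian_eigenvalue_real:
  assumes A: "hermitian_mat n A" and a: "poly (char_poly A) a = 0"
  shows "Im a = 0"
proof -
  let ?H = "\<lambda>i j. A $$ (i, j)"
  have cA: "A \<in> carrier_mat n n" using A by (simp add: hermitian_mat_def)
  have h: "herm n ?H" by (rule herm_of_hermitian_mat[OF A])
  have d: "det (shifted n ?H a) = 0" using a poly_char_poly_eq_det[OF cA] by simp
  have "herm n (\<lambda>i j. - ?H i j)" unfolding herm_def using herm_cnj[OF h] by simp
  moreover have "shifted n (\<lambda>i j. - ?H i j) (- a) = (- 1) \<cdot>\<^sub>m shifted n ?H a"
    by (intro eq_matI) (auto simp: shifted_index)
  then have "det (shifted n (\<lambda>i j. - ?H i j) (- a)) = 0" using d by simp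
  ultimately have "\<not> Im (- a) > 0" using det_shifted_nonzero by blast
  moreover have "\<not> Im a > 0" using det_shifted_nonzero[OF h] d by blast
  ultimately show ?thesis by simp
qed

lemma integral_pmf_of_multiset:
  fixes f :: "'a \<Rightarrow> complex"
  assumes "M \<noteq> {#}"
  shows "(\<integral>a. f a \<partial>measure_pmf (pmf_of_multiset M)) = (\<Sum>a\<in>#M. f a) / of_nat (size M)"
proof -
  have "(\<integral>a. f a \<partial>measure_pmf (pmf_of_multiset M)) = (\<Sum>a\<in>set_mset M. (count M a / size M) *\<^sub>R f a)"
    using assms by (subst integral_measure_pmf[where A = "set_mset M"]) (auto simp: pmf_of_multiset)
  also have "\<dots> = (\<Sum>a\<in>set_mset M. of_nat (count M a) * f a) / of_nat (size M)"
    by (simp add: sum_divide_distrib scaleR_conv_of_real)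
  also have "(\<Sum>a\<in>set_mset M. of_nat (count M a) * f a) = (\<Sum>a\<in>#M. f a)"
    by (rule sum_mset_eq_sum_count[symmetric]) auto
  finally show ?thesis .
qed

text \<open>Both sides equal \<open>p'(w) / (n p(w))\<close> for the characteristic polynomial \<open>p\<close> of \<open>A\<close>.\<close>

lemma stieltjes_spectral_measure:
  assumes A: "hermitian_mat n A" and n: "n > 0" and w: "Im w > 0"
  shows "stieltjes (spectral_measure A) w = tr n (res n (\<lambda>i j. A $$ (i, j)) w) / of_nat n"
proof -
  have cA: "A \<in> carrier_mat n n" using A by (simp add: hermitian_mat_def)
  let ?p = "char_poly A"
  let ?M = "proots ?p"
  have monic: "degree ?p = n" "lead_coeff ?p = 1" using degree_monic_char_poly[OF cA] by auto
  have p0: "?p \<noteq> 0" using monic by auto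
  have real: "Im a = 0" if "a \<in># ?M" for a
    using hermitian_eigenvalue_real[OF A, of a] that p0 by simp
  have wa: "w \<noteq> a" if "a \<in># ?M" for a using real[OF that] w by auto
  have size: "size ?M = n" using size_proots_complex[of ?p] monic by simp
  then have M0: "?M \<noteq> {#}" using n by auto
  have p: "(\<Prod>a\<in>#?M. [:-a, 1:]) = ?p" using complex_poly_decompose_multiset[of ?p] monic by simp
  have "stieltjes (spectral_measure A) w = (\<integral>a. 1 / (w - complex_of_real (Re a)) \<partial>measure_pmf (pmf_of_multiset ?M))"
    unfolding stieltjes_def spectral_measure_def by (rule integral_distr) auto
  also have "\<dots> = (\<Sum>a\<in>#?M. 1 / (w - complex_of_real (Re a))) / of_nat n"
    unfolding integral_pmf_of_multiset[OF M0] size ..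
  also have "(\<Sum>a\<in>#?M. 1 / (w - complex_of_real (Re a))) = (\<Sum>a\<in>#?M. 1 / (w - a))"
  proof (rule arg_cong[where f = sum_mset], rule image_mset_cong)
    fix a assume "a \<in># ?M"
    then have "complex_of_real (Re a) = a" using real by (simp add: complex_eq_iff)
    then show "1 / (w - complex_of_real (Re a)) = 1 / (w - a)" by simp
  qed
  finally have s: "stieltjes (spectral_measure A) w = (\<Sum>a\<in>#?M. 1 / (w - a)) / of_nat n" .
  have pw: "poly ?p w \<noteq> 0" using hermitian_eigenvalue_real[OF A, of w] w by auto
  have "poly (pderiv ?p) w = poly ?p w * (\<Sum>a\<in>#?M. 1 / (w - a))"
    using poly_pderiv_prod_mset[of ?M w] wa unfolding p by blast
  then have "(\<Sum>a\<in>#?M. 1 / (w - a)) = poly (pderiv ?p) w / poly ?p w"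
    using pw by (simp only: nonzero_mult_div_cancel_left not_False_eq_True)
  also have "\<dots> = tr n (res n (\<lambda>i j. A $$ (i, j)) w)"
    unfolding poly_pderiv_char_poly[OF cA] poly_char_poly_eq_det[OF cA]
    by (simp add: tr_def res_def sum_divide_distrib)
  finally show ?thesis using s by simp
qed

section \<open>Conclusion\<close>

text \<open>Stated for functions, so that the explicit error bound in \<open>K\<close> is recognized
  as a polynomial by closure rules, without computing coefficients.\<close>

definition nonneg_polynomial :: "(real \<Rightarrow> real) \<Rightarrow> bool" where
  "nonneg_polynomial f \<longleftrightarrow> (\<exists>P :: real poly. (\<forall>i. poly.coeff P i \<ge> 0) \<and> (\<forall>x. f x = poly P x))"

lemma nonneg_polynomial_const: "0 \<le> c \<Longrightarrow> nonneg_polynomial (\<lambda>_. c)"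
  unfolding nonneg_polynomial_def by (intro exI[of _ "[:c:]"]) (auto simp: coeff_pCons split: nat.split)

lemma nonneg_polynomial_id: "nonneg_polynomial (\<lambda>x. x)"
  unfolding nonneg_polynomial_def by (intro exI[of _ "[:0, 1:]"]) (auto simp: coeff_pCons split: nat.split)

lemma nonneg_polynomial_add:
  assumes "nonneg_polynomial f" "nonneg_polynomial h"
  shows "nonneg_polynomial (\<lambda>x. f x + h x)"
proof -
  obtain P Q :: "real poly" where P: "\<forall>i. poly.coeff P i \<ge> 0" "\<forall>x. f x = poly P x"
    and Q: "\<forall>i. poly.coeff Q i \<ge> 0" "\<forall>x. h x = poly Q x"
    using assms by (auto simp: nonneg_polynomial_def)
  show ?thesis unfolding nonneg_polynomial_def using P Q by (intro exI[of _ "P + Q"]) auto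
qed

lemma nonneg_polynomial_mult:
  assumes "nonneg_polynomial f" "nonneg_polynomial h"
  shows "nonneg_polynomial (\<lambda>x. f x * h x)"
proof -
  obtain P Q :: "real poly" where P: "\<forall>i. poly.coeff P i \<ge> 0" "\<forall>x. f x = poly P x"
    and Q: "\<forall>i. poly.coeff Q i \<ge> 0" "\<forall>x. h x = poly Q x"
    using assms by (auto simp: nonneg_polynomial_def)
  show ?thesis unfolding nonneg_polynomial_def using P Q
    by (intro exI[of _ "P * Q"]) (auto simp: coeff_mult intro!: sum_nonneg)
qed

lemma nonneg_polynomial_power:
  assumes "nonneg_polynomial f"
  shows "nonneg_polynomial (\<lambda>x. f x ^ k)"
  by (induction k) (auto intro: nonneg_polynomial_const nonneg_polynomial_mult assms)

lemmas nonneg_polynomial_intros = nonneg_polynomial_add nonneg_polynomial_mult nonneg_polynomial_power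
  nonneg_polynomial_id nonneg_polynomial_const

lemma hermitian_matI:
  assumes "A \<in> carrier_mat n n" "\<And>i j. i < n \<Longrightarrow> j < n \<Longrightarrow> A $$ (j, i) = cnj (A $$ (i, j))"
  shows "hermitian_mat n A"
proof -
  have "mat_adjoint A = A"
  proof (rule eq_matI)
    fix i j assume "i < dim_row A" "j < dim_col A"
    then have ij: "i < n" "j < n" using assms(1) by auto
    have "mat_adjoint A $$ (i, j) = cnj (A $$ (j, i))"
      using assms(1) ij by (simp add: mat_adjoint_def mat_of_rows_def)
    then show "mat_adjoint A $$ (i, j) = A $$ (i, j)" using assms(2)[OF ij(2,1)] by simp
  qed (use assms(1) in \<open>auto simp: mat_adjoint_def\<close>)
  then show ?thesis using assms(1) by (simp add: hermitian_mat_def)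
qed

lemma deformed_wigner_index:
  assumes "X \<in> carrier_mat n n" "A \<in> carrier_mat n n" "i < n" "j < n"
  shows "deformed_wigner n X A $$ (i, j) = X $$ (i, j) / sqrt n + A $$ (i, j)"
  using assms by (simp add: deformed_wigner_def)

lemma deformed_wigner_hermitian:
  assumes "hermitian_mat n X" "hermitian_mat n A"
  shows "hermitian_mat n (deformed_wigner n X A)"
proof (rule hermitian_matI)
  have c: "X \<in> carrier_mat n n" "A \<in> carrier_mat n n" using assms by (auto simp: hermitian_mat_def)
  then show "deformed_wigner n X A \<in> carrier_mat n n" by (simp add: deformed_wigner_def)
  fix i j assume ij: "i < n" "j < n"
  show "deformed_wigner n X A $$ (j, i) = cnj (deformed_wigner n X A $$ (i, j))"
    unfolding deformed_wigner_index[OF c ij] deformed_wigner_index[OF c ij(2,1)]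
      hermitian_mat_index[OF assms(1) ij] hermitian_mat_index[OF assms(2) ij] by simp
qed

lemma hmat_cong:
  assumes "\<And>p. p \<in> {..<n} \<times> {..<n} \<Longrightarrow> x p = y p"
  shows "hmat n A x = hmat n A y"
  unfolding hmat_def using assms by (intro ext arg_cong2[where f = "(+)"] refl sum.cong) auto

context deformed_wigner_law
begin

text \<open>By independence and identical distribution the coordinates of \<open>W\<close> have law
  \<open>P\<close>, and the integrand is a function of them alone. The abstract probability space
  disappears here.\<close>

lemma mean_resolvent_trace_eq:
  assumes W: "wigner_matrix \<mu> n M W" and A': "hermitian_mat n A'" and A: "A = (\<lambda>i j. A' $$ (i, j))"
  shows "mean_resolvent_trace n M W A' z = g"
proof -
  interpret M: prob_space M using W by (simp add: wigner_matrix_def)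
  define X where "X p \<omega> = wigner_component (W \<omega>) p" for p \<omega>
  \<comment> \<open>The restriction to \<open>I\<close> is needed because the product measure lives
    on functions undefined outside \<open>I\<close>; \<open>hmat\<close> does not read those
    values.\<close>
  define Y where "Y = (\<lambda>\<omega>. \<lambda>p\<in>I. X p \<omega>)"
  have herm: "hermitian_mat n (W \<omega>)" if "\<omega> \<in> space M" for \<omega> using W that by (simp add: wigner_matrix_def)
  have ind: "M.indep_vars (\<lambda>_. borel) X I" and dX: "\<And>p. p \<in> I \<Longrightarrow> distr M borel (X p) = \<mu>"
    using W unfolding wigner_matrix_def X_def by auto
  have rv: "X p \<in> borel_measurable M" if "p \<in> I" for p
    using ind that unfolding M.indep_vars_def by blast
  have I0: "I \<noteq> {}" using n_pos by auto
  have "distr M (Pi\<^sub>M I (\<lambda>_. borel)) Y = Pi\<^sub>M I (\<lambda>p. distr M borel (X p))"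
    unfolding Y_def by (rule iffD1[OF M.indep_vars_iff_distr_eq_PiM'[OF I0 rv] ind])
  also have "\<dots> = P" by (intro PiM_cong refl dX)
  finally have dY: "distr M (Pi\<^sub>M I (\<lambda>_. borel)) Y = P" .
  have mY: "Y \<in> measurable M (Pi\<^sub>M I (\<lambda>_. borel))"
    unfolding Y_def by (intro measurable_restrict rv)
  have pw: "1 / of_nat n * mat_trace (resolvent (deformed_wigner n (W \<omega>) A') z) = tr n (G (Y \<omega>)) / n"
    if \<omega>: "\<omega> \<in> space M" for \<omega>
  proof -
    let ?D = "deformed_wigner n (W \<omega>) A'"
    note r = resolvent_eq_res[OF deformed_wigner_hermitian[OF herm[OF \<omega>] A'] Im_z]
    have c: "W \<omega> \<in> carrier_mat n n" "A' \<in> carrier_mat n n"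
      using herm[OF \<omega>] A' by (auto simp: hermitian_mat_def)
    have "?D $$ (i, j) = hmat n A (Y \<omega>) i j" if "i < n" "j < n" for i j
    proof -
      have "hmat n A (Y \<omega>) = hmat n A (wigner_component (W \<omega>))"
        by (rule hmat_cong) (simp add: Y_def X_def)
      then show ?thesis
        unfolding deformed_wigner_index[OF c that] using hmat_wigner_component[OF herm[OF \<omega>] that, of A] by (simp add: A)
    qed
    then have "res n (\<lambda>i j. ?D $$ (i, j)) z = G (Y \<omega>)" unfolding G_def by (rule res_cong)
    then have "mat_trace (resolvent ?D z) = tr n (G (Y \<omega>))"
      using r by (auto simp: mat_trace_def tr_def intro!: sum.cong)
    then show ?thesis by simp
  qed
  have mG: "(\<lambda>x. tr n (G x) / n) \<in> borel_measurable (Pi\<^sub>M I (\<lambda>_. borel))"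
  proof -
    have "(\<lambda>x. tr n (G x) / n) \<in> borel_measurable P"
      by (intro borel_measurable_divide borel_measurable_const measurable_tr measurable_G)
    then show ?thesis unfolding dY[symmetric] by simp
  qed
  have "mean_resolvent_trace n M W A' z = (\<integral>\<omega>. tr n (G (Y \<omega>)) / n \<partial>M)"
    unfolding mean_resolvent_trace_def by (intro Bochner_Integration.integral_cong refl pw)
  also have "\<dots> = (\<integral>x. tr n (G x) / n \<partial>distr M (Pi\<^sub>M I (\<lambda>_. borel)) Y)"
    by (rule integral_distr[OF mY mG, symmetric])
  also have "\<dots> = g" unfolding dY g_def by simp
  finally show ?thesis .
qed

lemma B_eq_res: "A = H \<Longrightarrow> B = res n H w"
  unfolding B_def by (rule arg_cong[where f = "\<lambda>H. res n H w"])

lemma correction_eq: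
  assumes A': "hermitian_mat n A'" and A: "A = (\<lambda>i j. A' $$ (i, j))"
  shows "correction \<kappa> n A' w = \<kappa> * quartB"
proof -
  note r = resolvent_eq_res[OF A' Im_w_pos]
  have B: "resolvent A' w $$ (i, j) = B i j" if "i < n" "j < n" for i j
    using r(2)[OF that] unfolding B_eq_res[OF A] .
  have BB: "(resolvent A' w ^\<^sub>m 2) $$ (i, i) = mm n B B i i" if i: "i < n" for i
  proof -
    have "resolvent A' w ^\<^sub>m 2 = resolvent A' w * resolvent A' w"
      using r(1) by (simp add: numeral_2_eq_2)
    then show ?thesis
      using mat_mult_index[OF r(1) r(1) i i] B i by (simp add: mm_def)
  qed
  have "(\<Sum>i<n. \<Sum>l<n. (resolvent A' w ^\<^sub>m 2) $$ (i, i) * resolvent A' w $$ (i, i) * (resolvent A' w $$ (l, l))\<^sup>2)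
     = (\<Sum>i<n. \<Sum>j<n. (B j j)\<^sup>2 * B i i * mm n B B i i)"
    by (intro sum.cong refl) (simp add: B BB mult_ac)
  then show ?thesis unfolding correction_def quartB_def by simp
qed

lemma resolvent_trace_expansion:
  assumes W: "wigner_matrix \<mu> n M W" and A': "hermitian_mat n A'" and A: "A = (\<lambda>i j. A' $$ (i, j))"
  defines "h \<equiv> mean_resolvent_trace n M W A' z"
  shows "norm (h - (stieltjes (spectral_measure A') (z - (complex_of_real \<sigma>)\<^sup>2 * h)
        + 1 / of_nat n * correction \<kappa> n A' (z - (complex_of_real \<sigma>)\<^sup>2 * h)))
    \<le> (\<sigma>\<^sup>2 * C * K ^ 4 * (1 + K\<^sup>2) + c1 * K + \<bar>\<kappa>\<bar> * c4) / (real n)\<^sup>2"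
proof -
  have h: "h = g" unfolding h_def by (rule mean_resolvent_trace_eq[OF W A' A])
  have w: "z - (complex_of_real \<sigma>)\<^sup>2 * h = w" unfolding h w_def by simp
  have s: "stieltjes (spectral_measure A') w = tr n B / n"
    unfolding stieltjes_spectral_measure[OF A' n_pos Im_w_pos] B_eq_res[OF A] by simp
  show ?thesis unfolding w s correction_eq[OF A' A] using expansion unfolding h by simp
qed

end

theorem proposition3p3:
  fixes \<sigma> :: real and \<mu> \<nu> :: "real measure"
    and M :: "nat \<Rightarrow> 'a measure" and W :: "nat \<Rightarrow> 'a \<Rightarrow> complex mat"
    and A :: "nat \<Rightarrow> complex mat"
    and r J :: nat and \<theta> :: "nat \<Rightarrow> real" and k :: "nat \<Rightarrow> nat"
    and g L :: "nat \<Rightarrow> complex \<Rightarrow> complex"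
  assumes "\<sigma> > 0"
    and "wigner_law \<mu> \<sigma>"
    and "\<And>N. N \<ge> max 1 r \<Longrightarrow> wigner_matrix \<mu> N (M N) (W N)"
    and "spiked_deformation A \<nu> r J \<theta> k"
  defines "g \<equiv> \<lambda>N. mean_resolvent_trace N (M N) (W N) (A N)"
    and "L \<equiv> \<lambda>N z. correction (cumulant \<mu> 4) N (A N) (z - (complex_of_real \<sigma>)\<^sup>2 * g N z)"
  shows "error_order (max 1 r) 2 (\<lambda>N z.
    g N z - (stieltjes (spectral_measure (A N)) (z - (complex_of_real \<sigma>)\<^sup>2 * g N z)
             + 1 / of_nat N * L N z))"
proof -
  have law: "real_distribution \<mu>" "poincare_inequality \<mu>" using assms(2) by (auto simp: wigner_law_def)
  obtain C where C: "C > 0" "variance_bound \<mu> C"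
    using poincare_inequality_variance[OF law] by blast
  define c where "c = \<bar>cumulant \<mu> 4\<bar>"
  define e where "e = expansion_const \<mu> \<sigma>"
  \<comment> \<open>These copy the constants of the locale with \<open>K\<close> replaced by a
    variable. They depend only on \<open>\<mu>\<close>, \<open>\<sigma>\<close> and
    \<open>C\<close>, so the polynomial is fixed before \<open>N\<close> and
    \<open>z\<close>.\<close>
  define c1 where "c1 x = 1920 * e * x ^ 6 + 29 * c * x ^ 4" for x :: real
  define bias where "bias x = c * x ^ 5 * (1 + x) + \<sigma>\<^sup>2 * (C * x ^ 4 * (1 + (1 + x)\<^sup>2 * x\<^sup>2)) + c1 x * ((1 + x) * x)" for x
  define mse where "mse x = 2 * C * x ^ 4 * (1 + x)\<^sup>2 + (bias x)\<^sup>2" for x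
  define R where "R x = \<sigma>\<^sup>2 * C * x ^ 4 * (1 + x\<^sup>2) + c1 x * x
    + c * (6 * (x * (1 + x))\<^sup>2 * mse x + 4 * (x * (1 + x)) ^ 3 * bias x)" for x
  have nn: "0 \<le> c" "0 \<le> e" "0 \<le> C" "0 \<le> \<sigma>"
    using C(1) assms(1) expansion_const_nonneg by (auto simp: c_def e_def)
  have p1: "nonneg_polynomial c1" unfolding c1_def[abs_def] by (intro nonneg_polynomial_intros nn) auto
  have p2: "nonneg_polynomial bias" unfolding bias_def[abs_def] by (intro nonneg_polynomial_intros nn p1) auto
  have p3: "nonneg_polynomial mse" unfolding mse_def[abs_def] by (intro nonneg_polynomial_intros nn p2) auto
  have "nonneg_polynomial R" unfolding R_def[abs_def] by (intro nonneg_polynomial_intros nn p1 p2 p3) auto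
  then obtain Q :: "real poly" where Q: "\<forall>i. poly.coeff Q i \<ge> 0" "\<forall>x. R x = poly Q x"
    unfolding nonneg_polynomial_def by blast
  show ?thesis unfolding error_order_def
  proof (intro exI[of _ Q] conjI Q(1) allI impI)
    fix N z assume N: "max 1 r \<le> N" and z: "Im z > 0"
    have A: "hermitian_mat N (A N)" using assms(4) N by (simp add: spiked_deformation_def)
    interpret D: deformed_wigner_law N "\<lambda>i j. A N $$ (i, j)" z \<mu> \<sigma> C
      using N z A assms(2) C by unfold_locales (auto intro: herm_of_hermitian_mat)
    have K: "D.K = inverse \<bar>Im z\<bar>" using z by (simp add: D.K_def inverse_eq_divide)
    have "norm (g N z - (stieltjes (spectral_measure (A N)) (z - (complex_of_real \<sigma>)\<^sup>2 * g N z)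
             + 1 / of_nat N * L N z)) \<le> R (inverse \<bar>Im z\<bar>) / (real N)\<^sup>2"
      using D.resolvent_trace_expansion[OF assms(3)[OF N] A refl]
      unfolding R_def mse_def bias_def c1_def D.mse_def D.bias_def K c_def e_def g_def L_def .
    then show "norm (g N z - (stieltjes (spectral_measure (A N)) (z - (complex_of_real \<sigma>)\<^sup>2 * g N z)
             + 1 / of_nat N * L N z)) \<le> poly Q (inverse \<bar>Im z\<bar>) / real N ^ 2"
      using Q(2) by simp
  qed
qed

end
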